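(* Let $d\ge 2$ and $m\in\mathbb{N}$. Suppose $\{\mathbf{V}_n:n\in\mathbb{N}_0\}$ is a sequence of independent $m$-variate random vectors with $\mathsf{E}[\mathbf{V}_n]=\mathbf{0}$ and $\operatorname{cov}(\mathbf{V}_n,\mathbf{V}_n)=a_n^2\mathsf{I}_m$; $\mathbf{U}$ is a random element uniformly distributed on $\mathbb{M}^d$, independent of $\{\mathbf{V}_n\}$; and $\{\mathsf{B}_n:n\in\mathbb{N}_0\}$ is a sequence of $m\times m$ symmetric nonnegative-definite matrices such that $\sum_{n=0}^\infty \mathsf{B}_nP_n^{(\alpha,\beta)}(1)$ converges (entrywise). Then the series \[ \mathbf{Z}(\mathbf{x})=\sum_{n=0}^\infty \mathsf{B}_n^{1/2}\mathbf{V}_nP_n^{(\alpha,\beta)}(\cos\rho(\mathbf{x},\mathbf{U})),\qquad \mathbf{x}\in\mathbb{M}^d, \] converges in mean square for each $\mathbf{x}$ and defines a centred $m$-variate isotropic random field on $\mathbb{M}^d$ with covariance matrix function \[ \operatorname{cov}(\mathbf{Z}(\mathbf{x}_1),\mathbf{Z}(\mathbf{x}_2))=\sum_{n=0}^\infty \mathsf{B}_nP_n^{(\alpha,\beta)}(\cos\rho(\mathbf{x}_1,\mathbf{x}_2)),\qquad \mathbf{x}_1,\mathbf{x}_2\in\mathbb{M}^d. \] Moreover, distinct terms of the series are uncorrelated: for $i\neq j$ and all $\mathbf{x}_1,\mathbf{x}_2\in\mathbb{M}^d$, $\operatorname{cov}\big(\mathsf{B}_i^{1/2}\mathbf{V}_iP_i^{(\alpha,\beta)}(\cos\rho(\mathbf{x}_1,\mathbf{U})),\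 \mathsf{B}_j^{1/2}\mathbf{V}_jP_j^{(\alpha,\beta)}(\cos\rho(\mathbf{x}_2,\mathbf{U}))\big)=\mathbf{0}$.
   Context: A compact connected two-point homogeneous space $\mathbb{M}^d$ of real dimension $d$ is one of: the sphere $\mathbb{S}^d$, the real projective space $\mathbb{P}^d(\mathbb{R})$, the complex projective space $\mathbb{P}^d(\mathbb{C})$ ($d$ even, $d\ge4$), the quaternionic projective space $\mathbb{P}^d(\mathbb{H})$ ($d=8,12,\dots$), or the octonionic projective plane $\mathbb{P}^{16}(\mathbb{O})$. Each is a Riemannian manifold all of whose geodesics are closed; the metric is normalized so that every closed geodesic has length $2\pi$ (as for the unit sphere $\mathbb{S}^d\subset\mathbb{R}^{d+1}$ with $\rho(\mathbf{x}_1,\mathbf{x}_2)=\arccos(\mathbf{x}_1^\top\mathbf{x}_2)$). $\rho$ denotes the induced geodesic distance, $\mu$ the canonical Riemannian volume measure, $\omega_d=\mu(\mathbb{M}^d)$. The parameters $(\alpha,\beta)$ are: for $\mathbb{S}^d$, $\alpha=\beta=\frac{d-2}{2}$; for $\mathbb{P}^d(\mathbb{R})$, $\alpha=\frac{d-2}{2}$, $\beta=-\frac12$; for $\mathbb{P}^d(\mathbb{C})$, $\alpha=\frac{d-2}{2}$, $\beta=0$; for $\mathbb{P}^d(\mathbb{H})$, $\alpha=\frac{d-2}{2}$, $\beta=1$; for $\mathbb{P}^{16}(\mathbb{O})$, $\alpha=7$, $\beta=3$. $P_n^{(\alpha,\beta)}$ is the Jacobi polynomial of degree $n$ in the standard normalization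 $P_n^{(\alpha,\beta)}(1)=\frac{\Gamma(n+\alpha+1)}{\Gamma(n+1)\Gamma(\alpha+1)}$. The constants are $a_n=\left(\frac{\Gamma(\beta+1)(2n+\alpha+\beta+1)\Gamma(n+\alpha+\beta+1)}{\Gamma(\alpha+\beta+2)\Gamma(n+\beta+1)}\right)^{1/2}$. A random element $\mathbf{U}$ of $\mathbb{M}^d$ is uniformly distributed if its law is invariant under all isometries of $\mathbb{M}^d$; equivalently its law is $\mu/\omega_d$. An $m$-variate random field on $\mathbb{M}^d$ is isotropic if its mean is constant and its covariance matrix $\operatorname{cov}(\mathbf{Z}(\mathbf{x}_1),\mathbf{Z}(\mathbf{x}_2))=\mathsf{E}[(\mathbf{Z}(\mathbf{x}_1)-\mathsf{E}\mathbf{Z}(\mathbf{x}_1))(\mathbf{Z}(\mathbf{x}_2)-\mathsf{E}\mathbf{Z}(\mathbf{x}_2))^\top]$ depends only on $\rho(\mathbf{x}_1,\mathbf{x}_2)$. For a symmetric nonnegative-definite matrix $\mathsf{B}=\mathsf{S}\mathsf{D}\mathsf{S}^{-1}$ ($\mathsf{S}$ orthogonal, $\mathsf{D}$ diagonal), $\mathsf{B}^{1/2}=\mathsf{S}\mathsf{D}^{1/2}\mathsf{S}^{-1}$. A series of matrices converges if each entry converges. *)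

theory Defs
  imports "HOL-Probability.Probability"
begin

text \<open>An element of the Cayley-Dickson algebra of level k (real dimension 2^k) is a
  function nat => real supported on {0..<2^k}. Level 0,1,2,3 give R, C, H, O.\<close>

definition cd_conj :: "nat \<Rightarrow> (nat \<Rightarrow> real) \<Rightarrow> (nat \<Rightarrow> real)" where
  "cd_conj k x = (\<lambda>i. if i = 0 then x 0 else if i < 2 ^ k then - x i else 0)"

fun cd_mult :: "nat \<Rightarrow> (nat \<Rightarrow> real) \<Rightarrow> (nat \<Rightarrow> real) \<Rightarrow> (nat \<Rightarrow> real)" where
  "cd_mult 0 x y = (\<lambda>i. if i = 0 then x 0 * y 0 else 0)"
| "cd_mult (Suc k) x y =
    (let h = (2::nat) ^ k;
         a = (\<lambda>i. if i < h then x i else 0); b = (\<lambda>i. if i < h then x (i + h) else 0);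
         c = (\<lambda>i. if i < h then y i else 0); e = (\<lambda>i. if i < h then y (i + h) else 0);
         l = (\<lambda>i. cd_mult k a c i - cd_mult k (cd_conj k e) b i);
         r = (\<lambda>i. cd_mult k e a i + cd_mult k b (cd_conj k c) i)
     in (\<lambda>i. if i < h then l i else if i < 2 * h then r (i - h) else 0))"

text \<open>Points are encoded as N x N matrices with entries in the level-k algebra:
  P i j c is the c-th real component of the (i,j) entry.\<close>

type_synonym pt = "nat \<Rightarrow> nat \<Rightarrow> nat \<Rightarrow> real"

definition supported :: "nat \<Rightarrow> nat \<Rightarrow> pt \<Rightarrow> bool" where
  "supported k N P \<longleftrightarrow> (\<forall>i j c. \<not> (i < N \<and> j < N \<and> c < 2 ^ k) \<longrightarrow> P i j c = 0)"

text \<open>Real Frobenius inner product (equals Re tr(PQ) for Hermitian P, Q).\<close>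
definition frob :: "nat \<Rightarrow> nat \<Rightarrow> pt \<Rightarrow> pt \<Rightarrow> real" where
  "frob k N P Q = (\<Sum>i<N. \<Sum>j<N. \<Sum>c<2 ^ k. P i j c * Q i j c)"

text \<open>Projective space over the level-k algebra with N homogeneous coordinates:
  Hermitian idempotent N x N matrices of trace 1 (rank-one projections; for k = 3, N = 3
  this is the Cayley plane, the primitive idempotents of the exceptional Jordan algebra).\<close>
definition proj_pts :: "nat \<Rightarrow> nat \<Rightarrow> pt set" where
  "proj_pts k N = {P. supported k N P
      \<and> (\<forall>i j. P j i = cd_conj k (P i j))
      \<and> (\<forall>i j. (\<lambda>c. \<Sum>l<N. cd_mult k (P i l) (P l j) c) = P i j)
      \<and> (\<Sum>i<N. P i i 0) = 1}"

text \<open>Geodesic distance, normalized so that closed geodesics have length 2 pi: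
  cos rho(P,Q) = 2 tr(P o Q) - 1.\<close>
definition proj_dist :: "nat \<Rightarrow> nat \<Rightarrow> pt \<Rightarrow> pt \<Rightarrow> real" where
  "proj_dist k N P Q = arccos (2 * frob k N P Q - 1)"

text \<open>Unit sphere S^d in R^(d+1): the vector x is stored in column 0, real component 0.\<close>
definition sphere_pts :: "nat \<Rightarrow> pt set" where
  "sphere_pts d = {P. supported 0 (d + 1) P \<and> (\<forall>i j. j \<noteq> 0 \<longrightarrow> P i j 0 = 0)
                       \<and> frob 0 (d + 1) P P = 1}"

definition sphere_dist :: "nat \<Rightarrow> pt \<Rightarrow> pt \<Rightarrow> real" where
  "sphere_dist d P Q = arccos (frob 0 (d + 1) P Q)"

text \<open>M is (a model of) a compact connected two-point homogeneous space of real dimension d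
  with geodesic distance rho and associated Jacobi parameters (alpha, beta).\<close>
definition tphs :: "nat \<Rightarrow> pt set \<Rightarrow> (pt \<Rightarrow> pt \<Rightarrow> real) \<Rightarrow> real \<Rightarrow> real \<Rightarrow> bool" where
  "tphs d M \<rho> \<alpha> \<beta> \<longleftrightarrow>
     (M = sphere_pts d \<and> \<rho> = sphere_dist d \<and> \<alpha> = (real d - 2) / 2 \<and> \<beta> = (real d - 2) / 2)
   \<or> (M = proj_pts 0 (d + 1) \<and> \<rho> = proj_dist 0 (d + 1) \<and> \<alpha> = (real d - 2) / 2 \<and> \<beta> = - 1 / 2)
   \<or> (even d \<and> d \<ge> 4 \<and> M = proj_pts 1 (d div 2 + 1) \<and> \<rho> = proj_dist 1 (d div 2 + 1)
        \<and> \<alpha> = (real d - 2) / 2 \<and> \<beta> = 0)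
   \<or> (4 dvd d \<and> d \<ge> 8 \<and> M = proj_pts 2 (d div 4 + 1) \<and> \<rho> = proj_dist 2 (d div 4 + 1)
        \<and> \<alpha> = (real d - 2) / 2 \<and> \<beta> = 1)
   \<or> (d = 16 \<and> M = proj_pts 3 3 \<and> \<rho> = proj_dist 3 3 \<and> \<alpha> = 7 \<and> \<beta> = 3)"

definition jacobiP :: "real \<Rightarrow> real \<Rightarrow> nat \<Rightarrow> real \<Rightarrow> real" where
  "jacobiP \<alpha> \<beta> n x = (\<Sum>s\<le>n. ((real n + \<alpha>) gchoose (n - s)) * ((real n + \<beta>) gchoose s)
                              * ((x - 1) / 2) ^ s * ((x + 1) / 2) ^ (n - s))"

definition jacobi_a :: "real \<Rightarrow> real \<Rightarrow> nat \<Rightarrow> real" where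
  "jacobi_a \<alpha> \<beta> n = sqrt (Gamma (\<beta> + 1) * (2 * real n + \<alpha> + \<beta> + 1) * Gamma (real n + \<alpha> + \<beta> + 1)
                          / (Gamma (\<alpha> + \<beta> + 2) * Gamma (real n + \<beta> + 1)))"

definition sym_nnd :: "real^'m^'m \<Rightarrow> bool" where
  "sym_nnd B \<longleftrightarrow> transpose B = B \<and> (\<forall>x. 0 \<le> x \<bullet> (B *v x))"

definition msqrt :: "real^'m^'m \<Rightarrow> real^'m^'m" where
  "msqrt B = (SOME R. \<exists>S D. orthogonal_matrix S \<and> (\<forall>i j. i \<noteq> j \<longrightarrow> D $ i $ j = 0)
                 \<and> B = S ** D ** matrix_inv S
                 \<and> R = S ** (\<chi> i j. if i = j then sqrt (D $ i $ j) else 0) ** matrix_inv S)"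

definition mcov :: "'w measure \<Rightarrow> ('w \<Rightarrow> real^'m) \<Rightarrow> ('w \<Rightarrow> real^'m) \<Rightarrow> real^'m^'m" where
  "mcov Pr X Y = (\<chi> i j. LINT \<omega>|Pr. (X \<omega> $ i - (LINT \<eta>|Pr. X \<eta> $ i)) * (Y \<omega> $ j - (LINT \<eta>|Pr. Y \<eta> $ j)))"

text \<open>Borel sigma algebra of the metric space (M, rho), generated by open balls
  (M is separable, so this is the Borel sigma algebra).\<close>
definition metric_sigma :: "'a set \<Rightarrow> ('a \<Rightarrow> 'a \<Rightarrow> real) \<Rightarrow> 'a measure" where
  "metric_sigma M \<rho> = sigma M {{y \<in> M. \<rho> x y < r} | x r. x \<in> M}"

definition isometry_of :: "'a set \<Rightarrow> ('a \<Rightarrow> 'a \<Rightarrow> real) \<Rightarrow> ('a \<Rightarrow> 'a) \<Rightarrow> bool" where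
  "isometry_of M \<rho> g \<longleftrightarrow> g ` M = M \<and> (\<forall>x\<in>M. \<forall>y\<in>M. \<rho> (g x) (g y) = \<rho> x y)"

definition uniform_elem :: "'w measure \<Rightarrow> 'a set \<Rightarrow> ('a \<Rightarrow> 'a \<Rightarrow> real) \<Rightarrow> ('w \<Rightarrow> 'a) \<Rightarrow> bool" where
  "uniform_elem Pr M \<rho> U \<longleftrightarrow> U \<in> measurable Pr (metric_sigma M \<rho>)
     \<and> (\<forall>g. isometry_of M \<rho> g \<longrightarrow> (\<forall>A\<in>sets (metric_sigma M \<rho>).
           measure Pr {\<omega> \<in> space Pr. U \<omega> \<in> A} = measure Pr {\<omega> \<in> space Pr. g (U \<omega>) \<in> A}))"

text \<open>Independence of two random elements X (law on MX) and Y (law on MY), possibly of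
  different types (the library's indep_var requires a common type).\<close>
definition indep_elems :: "'w measure \<Rightarrow> 'a measure \<Rightarrow> ('w \<Rightarrow> 'a) \<Rightarrow> 'b measure \<Rightarrow> ('w \<Rightarrow> 'b) \<Rightarrow> bool" where
  "indep_elems Pr MX X MY Y \<longleftrightarrow> X \<in> measurable Pr MX \<and> Y \<in> measurable Pr MY
     \<and> (\<forall>A\<in>sets MX. \<forall>E\<in>sets MY.
          measure Pr {\<omega> \<in> space Pr. X \<omega> \<in> A \<and> Y \<omega> \<in> E}
            = measure Pr {\<omega> \<in> space Pr. X \<omega> \<in> A} * measure Pr {\<omega> \<in> space Pr. Y \<omega> \<in> E})"

definition sterm :: "real \<Rightarrow> real \<Rightarrow> (pt \<Rightarrow> pt \<Rightarrow> real) \<Rightarrow> (nat \<Rightarrow> real^'m^'m)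
      \<Rightarrow> (nat \<Rightarrow> 'w \<Rightarrow> real^'m) \<Rightarrow> ('w \<Rightarrow> pt) \<Rightarrow> nat \<Rightarrow> pt \<Rightarrow> 'w \<Rightarrow> real^'m" where
  "sterm \<alpha> \<beta> \<rho> B V U n x \<omega> = jacobiP \<alpha> \<beta> n (cos (\<rho> x (U \<omega>))) *\<^sub>R (msqrt (B n) *v V n \<omega>)"

definition isotropic_field :: "'w measure \<Rightarrow> 'a set \<Rightarrow> ('a \<Rightarrow> 'a \<Rightarrow> real) \<Rightarrow> ('a \<Rightarrow> 'w \<Rightarrow> real^'m) \<Rightarrow> bool" where
  "isotropic_field Pr M \<rho> Z \<longleftrightarrow>
     (\<forall>x\<in>M. Z x \<in> borel_measurable Pr \<and> integrable Pr (\<lambda>\<omega>. (norm (Z x \<omega>))\<^sup>2))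
   \<and> (\<exists>\<mu>. \<forall>x\<in>M. (LINT \<omega>|Pr. Z x \<omega>) = \<mu>)
   \<and> (\<exists>C. \<forall>x1\<in>M. \<forall>x2\<in>M. mcov Pr (Z x1) (Z x2) = C (\<rho> x1 x2))"

end

theory Submission
  imports Defs
begin

text \<open>
  Everything reduces to the identity
  \<open>a\<^sub>n\<^sup>2 E[P\<^sub>n(cos \<rho>(x\<^sub>1, U)) P\<^sub>n(cos \<rho>(x\<^sub>2, U))] = P\<^sub>n(cos \<rho>(x\<^sub>1, x\<^sub>2))\<close>: given independence, it makes the terms of the
  series orthogonal in \<open>L\<^sup>2\<close> with the stated covariances, and the convergence of \<open>\<Sum> B\<^sub>n P\<^sub>n(1)\<close> makes the partial sums Cauchy.

  The identity is obtained without harmonic analysis. Move \<open>x\<^sub>1\<close> to a standard point by an isometry; then \<open>(1 + cos \<rho>(x\<^sub>1, U)) / 2\<close>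
  is the first diagonal entry \<open>u\<^sub>0\<close> of the rank-one idempotent \<open>U\<close>, and a rotation in two coordinates moves \<open>x\<^sub>2\<close> to the
  span of the first two. (For the sphere, \<open>u\<^sub>0\<close> and \<open>u\<^sub>1\<close> are \<open>(1 + t) / 2\<close> and \<open>(1 - t) / 2\<close> for the height \<open>t\<close>.)
  Differentiating the invariance under rotations of the coordinates \<open>0\<close> and \<open>q\<close> at the angle 0 yields a recursion showing that the
  diagonal has Dirichlet moments. The mixed moments of the two distances follow by diagonalising
  \<open>x u\<^sub>0 + y t\<close>, a quadratic form in the homogeneous coordinates, by one more rotation and comparing coefficients in a generating function,
  and the Chu-Vandermonde identity contracts them with the coefficients of the Jacobi polynomials.

  In the octonionic plane the isometries are not given by matrices acting on vectors; besides real reflections it suffices to use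
  conjugations by diagonal unit matrices, which preserve idempotents by the Moufang identities.
\<close>

section \<open>Square roots of nonnegative definite matrices\<close>

text \<open>Uniformity is given only as invariance under isometries, with no density to integrate
  against, so every expectation must come from an explicit isometry. The Jacobi parameters are those
  of the resulting Dirichlet law: an entry at position \<open>(0, q)\<close> has \<delta> real
  components that contribute equally, and their squares add up to \<open>u 0 * u q\<close>; this
  gives each diagonal entry the parameter \<open>a = \<delta> / 2\<close> and the whole diagonal the
  total \<open>c = N * a\<close>, with \<beta> = a - 1 and \<alpha> = c - a - 1. The projective
  spaces have \<delta> = 2 ^ k; the sphere is the case of rank 2 with \<delta> = d. Over the
  octonions an idempotent comes with no vector of homogeneous coordinates, so rank one is expressed
  by the vanishing of the 2 by 2 minors, a condition on triples of indices that can be followed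
  through a conjugation. A phase on a single coordinate would destroy it over the octonions, which
  is why a further coordinate must be available to carry the inverse phase.\<close>

lemma selfadjoint_eigenbasis:
  fixes f :: "'a::euclidean_space \<Rightarrow> 'a"
  assumes lin: "linear f" and sa: "\<And>x y. f x \<bullet> y = x \<bullet> f y"
  shows "subspace W \<Longrightarrow> f ` W \<subseteq> W \<Longrightarrow>
    \<exists>b. finite b \<and> pairwise orthogonal b \<and> (\<forall>v\<in>b. norm v = 1 \<and> (\<exists>e. f v = e *\<^sub>R v)) \<and> span b = W"
proof (induction "dim W" arbitrary: W rule: less_induct)
  case less
  note sub = less.prems(1) and inv = less.prems(2)
  show ?case
  proof (cases "W = {0}")
    case True
    thus ?thesis by (intro exI[of _ "{}"]) auto
  next
    case False
    then obtain w where w: "w \<in> W" "w \<noteq> 0" using subspace_0[OF sub] by auto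
    \<comment> \<open>The eigenvector is a maximiser of the Rayleigh quotient on the unit sphere of
      \<open>W\<close>, and its value \<open>e\<close> will be the eigenvalue.\<close>
    have "compact (sphere 0 1 \<inter> W)"
      by (intro compact_Int_closed closed_subspace sub) auto
    moreover have "(1 / norm w) *\<^sub>R w \<in> sphere 0 1 \<inter> W"
      using w sub by (auto simp: subspace_scale)
    moreover have "continuous_on (sphere 0 1 \<inter> W) (\<lambda>x. x \<bullet> f x)"
      using lin by (intro continuous_intros linear_continuous_on) (simp add: linear_conv_bounded_linear)
    ultimately obtain x0 where x0: "x0 \<in> sphere 0 1 \<inter> W" and max: "\<And>y. y \<in> sphere 0 1 \<inter> W \<Longrightarrow> y \<bullet> f y \<le> x0 \<bullet> f x0"
      using continuous_attains_sup[of "sphere 0 1 \<inter> W" "\<lambda>x. x \<bullet> f x"] by blast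
    define e where "e = x0 \<bullet> f x0"
    have x0W: "x0 \<in> W" and n0: "norm x0 = 1" "x0 \<bullet> x0 = 1" using x0 by (auto simp: norm_eq_1)
    have fW: "f y \<in> W" if "y \<in> W" for y using inv that by auto
    have max': "y \<bullet> f y \<le> e * (y \<bullet> y)" if "y \<in> W" for y
    proof (cases "y = 0")
      case True thus ?thesis by (simp add: linear_0[OF lin])
    next
      case False
      have "((1 / norm y) *\<^sub>R y) \<bullet> f ((1 / norm y) *\<^sub>R y) \<le> e"
        unfolding e_def by (rule max) (use that False sub in \<open>auto simp: subspace_scale\<close>)
      thus ?thesis using False
        by (simp add: linear_scale[OF lin] dot_square_norm power2_eq_square field_simps)
    qed
    have orth: "y \<bullet> (f x0 - e *\<^sub>R x0) = 0" if y: "y \<in> W" for y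
    proof -
      define g where "g = y \<bullet> (f x0 - e *\<^sub>R x0)"
      define K where "K = e * (y \<bullet> y) - y \<bullet> f y"
      have K: "K \<ge> 0" using max'[OF y] by (simp add: K_def)
      \<comment> \<open>First variation: when \<open>x0\<close> is compared with
        \<open>x0 + t *\<^sub>R y\<close>, the terms linear in \<open>t\<close> add up to
        \<open>2 * t * g\<close> because \<open>f\<close> is self-adjoint.\<close>
      have *: "2 * t * g \<le> t\<^sup>2 * K" for t
      proof -
        have "(x0 + t *\<^sub>R y) \<bullet> f (x0 + t *\<^sub>R y) \<le> e * ((x0 + t *\<^sub>R y) \<bullet> (x0 + t *\<^sub>R y))"
          by (rule max') (use x0W y sub in \<open>auto simp: subspace_add subspace_scale\<close>)
        moreover have "x0 \<bullet> f y = y \<bullet> f x0" using sa[of x0 y] by (simp add: inner_commute)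
        ultimately show ?thesis
          using n0 by (simp add: g_def K_def e_def linear_add[OF lin] linear_scale[OF lin] inner_add inner_diff
              power2_eq_square inner_commute algebra_simps)
      qed
      have "g = 0"
      proof (rule ccontr)
        assume g: "g \<noteq> 0"
        \<comment> \<open>A small step along \<open>g\<close> contradicts the bound;
          \<open>K + 1\<close> keeps the denominator positive when \<open>K = 0\<close>.\<close>
        have "2 * (g / (K + 1)) * g \<le> (g / (K + 1))\<^sup>2 * K" by (rule *)
        hence "2 * (K + 1) * g\<^sup>2 \<le> K * g\<^sup>2"
          using K by (simp add: power2_eq_square divide_simps split: if_splits) (simp add: algebra_simps)
        thus False using g K by (simp add: mult_le_cancel_right)
      qed
      thus ?thesis by (simp add: g_def)
    qed
    have eig: "f x0 = e *\<^sub>R x0"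
      using orth[of "f x0 - e *\<^sub>R x0"] fW[OF x0W] x0W sub
      by (simp add: subspace_diff subspace_scale)
    define W' where "W' = {y \<in> W. y \<bullet> x0 = 0}"
    have sub': "subspace W'"
      using sub unfolding W'_def subspace_def by (auto simp: inner_add)
    have inv': "f ` W' \<subseteq> W'"
      using fW sa[of _ x0] by (auto simp: W'_def eig)
    have "x0 \<notin> W'" using n0 by (simp add: W'_def)
    moreover have "W' \<subseteq> W" by (auto simp: W'_def)
    ultimately have "W' \<subset> W" using x0W by blast
    hence "dim W' < dim W" using sub sub' by (metis dim_psubset span_eq_iff)
    from less.hyps[OF this sub' inv'] obtain b where
      b: "finite b" "pairwise orthogonal b" "\<forall>v\<in>b. norm v = 1 \<and> (\<exists>e. f v = e *\<^sub>R v)" "span b = W'" by blast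
    have bW: "v \<in> W'" if "v \<in> b" for v using b(4) span_base[OF that] by simp
    have "pairwise orthogonal (insert x0 b)"
      using b(2) bW by (auto simp: pairwise_insert W'_def orthogonal_def inner_commute)
    moreover have "span (insert x0 b) = W"
    proof
      show "span (insert x0 b) \<subseteq> W"
        using bW x0W sub by (intro span_minimal) (auto simp: W'_def)
      show "W \<subseteq> span (insert x0 b)"
      proof
        fix y assume y: "y \<in> W"
        have "y - (y \<bullet> x0) *\<^sub>R x0 \<in> W'"
          using y x0W sub n0 by (auto simp: W'_def subspace_diff subspace_scale inner_diff)
        thus "y \<in> span (insert x0 b)" using b(4) by (auto simp: span_insert)
      qed
    qed
    ultimately show ?thesis using b n0 eig by (intro exI[of _ "insert x0 b"]) auto
  qed
qed

lemma matrix_inv_orthogonal: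
  fixes S :: "real^'m^'m"
  assumes "orthogonal_matrix S"
  shows "matrix_inv S = transpose S"
proof -
  have "S ** matrix_inv S = mat 1 \<and> matrix_inv S ** S = mat 1"
    unfolding matrix_inv_def by (rule someI[of _ "transpose S"]) (use assms in \<open>simp add: orthogonal_matrix_def\<close>)
  moreover have "transpose S ** S = mat 1" using assms by (simp add: orthogonal_matrix)
  ultimately show ?thesis by (metis matrix_mul_assoc matrix_mul_lid matrix_mul_rid)
qed

lemma symmetric_matrix_diagonalizable:
  fixes B :: "real^'m^'m"
  assumes "transpose B = B"
  obtains S D :: "real^'m^'m" where "orthogonal_matrix S" "\<forall>i j. i \<noteq> j \<longrightarrow> D $ i $ j = 0" "B = S ** D ** matrix_inv S"
proof -
  have sa: "(B *v x) \<bullet> y = x \<bullet> (B *v y)" for x y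
    using assms by (metis dot_lmul_matrix vector_transpose_matrix)
  obtain b where b: "finite b" "pairwise orthogonal b" "\<forall>v\<in>b. norm v = 1 \<and> (\<exists>e. B *v v = e *\<^sub>R v)" "span b = UNIV"
    using selfadjoint_eigenbasis[of "\<lambda>x. B *v x" UNIV] sa by auto
  have "independent b"
    using b by (intro pairwise_orthogonal_independent) auto
  hence "card b = CARD('m)"
    using b(4) by (metis dim_span_eq_card_independent dim_UNIV DIM_cart DIM_real mult.right_neutral)
  \<comment> \<open>The eigenbasis is a set with as many elements as the index type; a bijection
    turns its members into the columns of \<open>S\<close>.\<close>
  then obtain h where h: "bij_betw h (UNIV :: 'm set) b"
    using b(1) finite_same_card_bij[of "UNIV :: 'm set" b] by auto
  have hb: "h j \<in> b" for j using h by (auto simp: bij_betw_def)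
  have "\<forall>j. \<exists>e. B *v h j = e *\<^sub>R h j" using b(3) hb by blast
  from choice[OF this] obtain e where e: "\<And>j. B *v h j = e j *\<^sub>R h j" by blast
  define S :: "real^'m^'m" where "S = (\<chi> i j. h j $ i)"
  define D :: "real^'m^'m" where "D = (\<chi> i j. if i = j then e i else 0)"
  have col: "column j S = h j" for j by (simp add: S_def column_def vec_eq_iff)
  have S: "orthogonal_matrix S"
    unfolding orthogonal_matrix_orthonormal_columns col
    using b(2,3) hb h by (auto simp: pairwise_def bij_betw_def inj_on_def) metis
  have inv: "S ** matrix_inv S = mat 1"
    using S by (simp add: matrix_inv_orthogonal orthogonal_matrix_def)
  have "(B ** S) $ i $ j = (S ** D) $ i $ j" for i j
  proof -
    have "(B ** S) $ i $ j = (B *v h j) $ i"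
      by (simp add: matrix_matrix_mult_def matrix_vector_mult_def S_def)
    also have "\<dots> = (S ** D) $ i $ j"
      unfolding e by (simp add: matrix_matrix_mult_def S_def D_def if_distrib[of "\<lambda>x. _ * x"] cong: if_cong)
    finally show ?thesis .
  qed
  hence "B ** S = S ** D" by (simp add: vec_eq_iff)
  hence "B = S ** D ** matrix_inv S"
    by (metis inv matrix_mul_assoc matrix_mul_rid)
  with S show thesis by (intro that[of S D]) (auto simp: D_def)
qed

text \<open>\<open>msqrt B\<close> is picked by \<open>SOME\<close> among the roots coming from all
  diagonalisations, so the argument takes whichever \<open>S\<close> and \<open>D\<close> the choice
  delivers. The product with the transpose is the form in which the root enters the
  covariances.\<close>

lemma msqrt_mult_transpose:
  fixes B :: "real^'m^'m"
  assumes "sym_nnd B"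
  shows "msqrt B ** transpose (msqrt B) = B"
proof -
  define P where "P R \<longleftrightarrow> (\<exists>S D. orthogonal_matrix S \<and> (\<forall>i j. i \<noteq> j \<longrightarrow> D $ i $ j = 0)
                 \<and> B = S ** D ** matrix_inv S
                 \<and> R = S ** (\<chi> i j. if i = j then sqrt (D $ i $ j) else 0) ** matrix_inv S)" for R :: "real^'m^'m"
  obtain S D :: "real^'m^'m" where "orthogonal_matrix S" "\<forall>i j. i \<noteq> j \<longrightarrow> D $ i $ j = 0" "B = S ** D ** matrix_inv S"
    using symmetric_matrix_diagonalizable[of B] assms unfolding sym_nnd_def by blast
  hence "\<exists>R. P R" unfolding P_def by blast
  hence "P (msqrt B)" unfolding msqrt_def P_def[symmetric] by (rule someI_ex)
  then obtain S D where S: "orthogonal_matrix S" and D: "\<forall>i j. i \<noteq> j \<longrightarrow> D $ i $ j = 0"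
    and B: "B = S ** D ** matrix_inv S"
    and R: "msqrt B = S ** (\<chi> i j. if i = j then sqrt (D $ i $ j) else 0) ** matrix_inv S"
    unfolding P_def by blast
  define Q :: "real^'m^'m" where "Q = (\<chi> i j. if i = j then sqrt (D $ i $ j) else 0)"
  have inv: "matrix_inv S = transpose S"
    using S by (rule matrix_inv_orthogonal)
  have SS: "transpose S ** S = mat 1" using S by (simp add: orthogonal_matrix)
  have DB: "D = transpose S ** B ** S"
  proof -
    have "transpose S ** B ** S = (transpose S ** S) ** D ** (transpose S ** S)"
      unfolding B inv by (simp only: matrix_mul_assoc)
    thus ?thesis by (simp add: SS)
  qed
  \<comment> \<open>A diagonal entry of \<open>D\<close> is the quadratic form of \<open>B\<close>
    at a column of \<open>S\<close>, so the square roots in \<open>Q\<close> are genuine.\<close>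
  have D0: "D $ i $ i \<ge> 0" for i
  proof -
    have "D $ i $ i = column i S \<bullet> (B *v column i S)"
      unfolding DB by (simp add: matrix_matrix_mult_def matrix_vector_mult_def inner_vec_def column_def transpose_def
          sum_distrib_left sum_distrib_right mult_ac) (subst sum.swap, simp add: mult_ac)
    thus ?thesis using assms by (simp add: sym_nnd_def)
  qed
  have "Q ** Q = D"
    using D D0 by (auto simp: Q_def matrix_matrix_mult_def vec_eq_iff if_distrib[of "\<lambda>x. x * _"] cong: if_cong)
  moreover have "transpose Q = Q"
    by (simp add: Q_def transpose_def vec_eq_iff)
  moreover have "msqrt B ** transpose (msqrt B) = S ** Q ** (transpose S ** S) ** transpose Q ** transpose S"
    unfolding R Q_def[symmetric] inv by (simp add: matrix_transpose_mul matrix_mul_assoc)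
  ultimately show ?thesis using SS B inv by (simp flip: matrix_mul_assoc)
qed

section \<open>Jacobi polynomials\<close>

text \<open>The variable \<open>t = (x + 1) / 2\<close> is the one whose moments are computable: it
  becomes a diagonal entry of the idempotent. Expanding the powers of \<open>t - 1\<close>, the sum
  over \<open>s\<close> collapses by trinomial revision and Vandermonde.\<close>

lemma jacobiP_expand:
  "jacobiP \<alpha> \<beta> n (2 * t - 1) =
    (\<Sum>k\<le>n. (-1) ^ k * ((real n + \<beta>) gchoose k) * ((2 * real n + \<alpha> + \<beta> - real k) gchoose (n - k)) * t ^ (n - k))"
proof -
  have term_s: "(t - 1) ^ s * t ^ (n - s) = (\<Sum>k\<le>n. real (s choose k) * (-1) ^ k * t ^ (n - k))"
    if "s \<le> n" for s
  proof -
    have "(t - 1) ^ s = (\<Sum>k\<le>s. real (s choose k) * (-1) ^ k * t ^ (s - k))"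
      using binomial_ring[of "-1::real" t s] by simp
    hence "(t - 1) ^ s * t ^ (n - s) = (\<Sum>k\<le>s. real (s choose k) * (-1) ^ k * (t ^ (s - k) * t ^ (n - s)))"
      by (simp add: sum_distrib_right sum_distrib_left mult_ac)
    also have "\<dots> = (\<Sum>k\<le>s. real (s choose k) * (-1) ^ k * t ^ (n - k))"
      using that by (intro sum.cong refl) (simp flip: power_add)
    also have "\<dots> = (\<Sum>k\<le>n. real (s choose k) * (-1) ^ k * t ^ (n - k))"
      using that by (intro sum.mono_neutral_left) auto
    finally show ?thesis .
  qed
  have "jacobiP \<alpha> \<beta> n (2 * t - 1) =
      (\<Sum>s\<le>n. ((real n + \<alpha>) gchoose (n - s)) * ((real n + \<beta>) gchoose s) * ((t - 1) ^ s * t ^ (n - s)))"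
    unfolding jacobiP_def by (intro sum.cong refl) (simp add: algebra_simps diff_divide_distrib add_divide_distrib)
  also have "\<dots> = (\<Sum>s\<le>n. \<Sum>k\<le>n. ((real n + \<alpha>) gchoose (n - s)) * ((real n + \<beta>) gchoose s)
       * (real (s choose k) * (-1) ^ k * t ^ (n - k)))"
    by (intro sum.cong refl) (simp add: term_s sum_distrib_left)
  also have "\<dots> = (\<Sum>k\<le>n. (\<Sum>s\<le>n. ((real n + \<alpha>) gchoose (n - s)) * ((real n + \<beta>) gchoose s)
       * real (s choose k)) * ((-1) ^ k * t ^ (n - k)))"
    by (subst sum.swap) (simp add: sum_distrib_right sum_distrib_left mult_ac)
  also have "\<dots> = (\<Sum>k\<le>n. (-1) ^ k * ((real n + \<beta>) gchoose k) *
      ((2 * real n + \<alpha> + \<beta> - real k) gchoose (n - k)) * t ^ (n - k))"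
  proof (intro sum.cong refl)
    fix k assume "k \<in> {..n}"
    hence k: "k \<le> n" by simp
    have "(\<Sum>s\<le>n. ((real n + \<alpha>) gchoose (n - s)) * ((real n + \<beta>) gchoose s) * real (s choose k))
        = (\<Sum>s\<in>{k..n}. ((real n + \<alpha>) gchoose (n - s)) * ((real n + \<beta>) gchoose s) * real (s choose k))"
      by (intro sum.mono_neutral_right) auto
    also have "\<dots> = (\<Sum>s\<in>{k..n}. ((real n + \<beta>) gchoose k) *
        (((real n + \<beta> - real k) gchoose (s - k)) * ((real n + \<alpha>) gchoose (n - s))))"
    proof (intro sum.cong refl)
      fix s assume "s \<in> {k..n}"
      hence "((real n + \<beta>) gchoose s) * (real s gchoose k) =
          ((real n + \<beta>) gchoose k) * ((real n + \<beta> - real k) gchoose (s - k))"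
        by (subst gbinomial_trinomial_revision) auto
      thus "((real n + \<alpha>) gchoose (n - s)) * ((real n + \<beta>) gchoose s) * real (s choose k) =
        ((real n + \<beta>) gchoose k) * (((real n + \<beta> - real k) gchoose (s - k)) * ((real n + \<alpha>) gchoose (n - s)))"
        by (simp add: binomial_gbinomial mult_ac)
    qed
    also have "\<dots> = ((real n + \<beta>) gchoose k) * (\<Sum>s\<in>{k..n}.
        ((real n + \<beta> - real k) gchoose (s - k)) * ((real n + \<alpha>) gchoose (n - s)))"
      by (simp add: sum_distrib_left)
    also have "(\<Sum>s\<in>{k..n}. ((real n + \<beta> - real k) gchoose (s - k)) * ((real n + \<alpha>) gchoose (n - s)))
       = (\<Sum>l = 0..n - k. ((real n + \<beta> - real k) gchoose l) * ((real n + \<alpha>) gchoose (n - k - l)))"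
      by (rule sum.reindex_bij_witness[of _ "\<lambda>l. l + k" "\<lambda>s. s - k"]) (use k in auto)
    also have "\<dots> = ((2 * real n + \<alpha> + \<beta> - real k) gchoose (n - k))"
      by (subst gbinomial_Vandermonde) (simp add: algebra_simps)
    finally show "(\<Sum>s\<le>n. ((real n + \<alpha>) gchoose (n - s)) * ((real n + \<beta>) gchoose s) * real (s choose k)) *
          ((-1) ^ k * t ^ (n - k)) =
       (-1) ^ k * ((real n + \<beta>) gchoose k) * ((2 * real n + \<alpha> + \<beta> - real k) gchoose (n - k)) * t ^ (n - k)"
      by simp
  qed
  finally show ?thesis .
qed

text \<open>Coefficients of the hypergeometric form
  \<open>(-1)^n (a)_n / n! 2F1(-n, n + c - 1; a; t)\<close> of the Jacobi polynomial with \<beta> =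
  a - 1 and \<alpha> = c - a - 1, written with the two Dirichlet parameters.\<close>

definition jcoeff :: "real \<Rightarrow> real \<Rightarrow> nat \<Rightarrow> nat \<Rightarrow> real" where
  "jcoeff a c n i = (-1) ^ (n - i) * pochhammer a n * pochhammer (real n + c - 1) i
      / (pochhammer a i * fact i * fact (n - i))"

lemma jacobiP_jcoeff:
  assumes "\<beta> > -1"
  shows "jacobiP \<alpha> \<beta> n (2 * t - 1) = (\<Sum>i\<le>n. jcoeff (\<beta> + 1) (\<alpha> + \<beta> + 2) n i * t ^ i)"
proof -
  have "jacobiP \<alpha> \<beta> n (2 * t - 1) = (\<Sum>i\<le>n. (-1) ^ (n - i) * ((real n + \<beta>) gchoose (n - i))
      * ((2 * real n + \<alpha> + \<beta> - real (n - i)) gchoose i) * t ^ i)"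
    unfolding jacobiP_expand by (rule sum.reindex_bij_witness[of _ "\<lambda>i. n - i" "\<lambda>i. n - i"]) auto
  also have "\<dots> = (\<Sum>i\<le>n. jcoeff (\<beta> + 1) (\<alpha> + \<beta> + 2) n i * t ^ i)"
  proof (intro sum.cong refl)
    fix i assume "i \<in> {..n}"
    hence i: "i \<le> n" by simp
    have a0: "pochhammer (\<beta> + 1) i \<noteq> 0" using assms pochhammer_pos[of "\<beta> + 1" i] by auto
    have 1: "((real n + \<beta>) gchoose (n - i)) = pochhammer (\<beta> + 1) n / (pochhammer (\<beta> + 1) i * fact (n - i))"
      unfolding gbinomial_pochhammer'
      using pochhammer_product[OF i, of "\<beta> + 1"] i a0 by (simp add: of_nat_diff algebra_simps)
    have 2: "((2 * real n + \<alpha> + \<beta> - real (n - i)) gchoose i) = pochhammer (real n + (\<alpha> + \<beta> + 2) - 1) i / fact i"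
      unfolding gbinomial_pochhammer' using i by (simp add: of_nat_diff algebra_simps)
    show "(-1) ^ (n - i) * ((real n + \<beta>) gchoose (n - i))
      * ((2 * real n + \<alpha> + \<beta> - real (n - i)) gchoose i) * t ^ i = jcoeff (\<beta> + 1) (\<alpha> + \<beta> + 2) n i * t ^ i"
      unfolding jcoeff_def 1 2 by simp
  qed
  finally show ?thesis .
qed

text \<open>The value that \<open>joint_moment\<close> finds for the mixed moment of order
  \<open>(i, j)\<close> of the diagonal values of the random point at two fixed points, where
  \<open>s\<close> is the squared cosine of half their distance. At \<open>s = 0\<close> it is a
  Dirichlet moment of two entries, at \<open>s = 1\<close> the moment of order \<open>i + j\<close>
  of one entry.\<close>

definition jmoment :: "real \<Rightarrow> real \<Rightarrow> real \<Rightarrow> nat \<Rightarrow> nat \<Rightarrow> real" where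
  "jmoment a c s i j = pochhammer a i * pochhammer a j / pochhammer c (i + j)
     * (\<Sum>r\<le>i. real (i choose r) * real (j choose r) * fact r / pochhammer a r * s ^ r)"

text \<open>Contracts the coefficients with the part of \<open>jmoment\<close> that depends on
  \<open>i\<close>. The factor \<open>pochhammer (real j - real n + 1) (n - r)\<close> is zero for
  \<open>r \<le> j < n\<close>, which is the source of the orthogonality to lower powers.\<close>

lemma jcoeff_Chu_Vandermonde:
  assumes a: "a > 0" and c: "c > 0" and r: "r \<le> n"
  shows "(\<Sum>i\<le>n. jcoeff a c n i * pochhammer a i * real (i choose r) / pochhammer c (i + j)) =
     (-1) ^ (n - r) * pochhammer a n * pochhammer (real n + c - 1) r * pochhammer (real j - real n + 1) (n - r)
       / (fact r * fact (n - r) * pochhammer c (j + n))"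
proof -
  define m where "m = n - r"
  have n: "n = r + m" using r by (simp add: m_def)
  have pa: "pochhammer a i > 0" and pc: "pochhammer c i > 0" for i
    using a c by (auto intro: pochhammer_pos)
  have pc': "pochhammer (c + real (r + j)) i > 0" for i
    using c by (auto intro: pochhammer_pos)
  have "(\<Sum>i\<le>n. jcoeff a c n i * pochhammer a i * real (i choose r) / pochhammer c (i + j))
      = (\<Sum>i\<in>{r..n}. jcoeff a c n i * pochhammer a i * real (i choose r) / pochhammer c (i + j))"
    by (intro sum.mono_neutral_right) auto
  also have "\<dots> = (\<Sum>l = 0..m. jcoeff a c n (l + r) * pochhammer a (l + r) * real ((l + r) choose r) / pochhammer c (l + r + j))"
    by (rule sum.reindex_bij_witness[of _ "\<lambda>l. l + r" "\<lambda>s. s - r"]) (auto simp: n)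
  also have "\<dots> = (\<Sum>l = 0..m. (-1) ^ m * pochhammer a n * pochhammer (real n + c - 1) r
       / (fact r * fact m * pochhammer c (r + j)) *
      (pochhammer (real n + c - 1 + real r) l * pochhammer (- real m) l / (fact l * pochhammer (c + real (r + j)) l)))"
  proof (intro sum.cong refl)
    fix l assume "l \<in> {0..m}"
    hence l: "l \<le> m" by simp
    have 1: "real ((l + r) choose r) = fact (l + r) / (fact r * fact l)"
      by (subst binomial_fact) (auto simp: field_simps)
    have 2: "pochhammer (real n + c - 1) (l + r) = pochhammer (real n + c - 1) r * pochhammer (real n + c - 1 + real r) l"
      by (subst add.commute) (rule pochhammer_product')
    have 3: "pochhammer c (l + r + j) = pochhammer c (r + j) * pochhammer (c + real (r + j)) l"
      using pochhammer_product'[of c "r + j" l] by (simp add: ac_simps)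
    have 4: "pochhammer (- real m) l = (-1) ^ l * fact m / fact (m - l)"
    proof -
      have "fact (m - l) * real (fact m div fact (m - l)) = fact m"
        using fact_dvd[of "m - l" m] l
        by (metis diff_le_self dvd_mult_div_cancel of_nat_fact of_nat_mult)
      moreover have "pochhammer (- real m) l = (-1) ^ l * (real (m choose l) * fact l)"
        using gbinomial_pochhammer[of "real m" l]
        by (simp add: binomial_gbinomial field_simps flip: power_mult_distrib)
      ultimately show ?thesis
        using binomial_fact[OF l, where ?'a = real] by (simp add: field_simps)
    qed
    have 5: "(-1::real) ^ (m - l) = (-1) ^ m * (-1) ^ l"
      using l by (auto simp: minus_one_power_iff)
    show "jcoeff a c n (l + r) * pochhammer a (l + r) * real ((l + r) choose r) / pochhammer c (l + r + j) =
     (-1) ^ m * pochhammer a n * pochhammer (real n + c - 1) r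
       / (fact r * fact m * pochhammer c (r + j)) *
      (pochhammer (real n + c - 1 + real r) l * pochhammer (- real m) l / (fact l * pochhammer (c + real (r + j)) l))"
      unfolding jcoeff_def 1 2 3 4 using pa[of "l + r"] l
      by (simp add: n 5 divide_simps) 
  qed
  also have "\<dots> = (-1) ^ m * pochhammer a n * pochhammer (real n + c - 1) r
       / (fact r * fact m * pochhammer c (r + j)) * (\<Sum>l = 0..m.
      (pochhammer (real n + c - 1 + real r) l * pochhammer (- real m) l / (fact l * pochhammer (c + real (r + j)) l)))"
    by (simp add: sum_distrib_left)
  \<comment> \<open>A terminating 2F1 at 1. The difference of the lower and the upper parameter is
    \<open>c + r + j - (n + c - 1 + r) = j - n + 1\<close>, from which \<open>c\<close>
    cancels.\<close>
  also have "(\<Sum>l = 0..m. (pochhammer (real n + c - 1 + real r) l * pochhammer (- real m) l / (fact l * pochhammer (c + real (r + j)) l)))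
     = pochhammer (real j - real n + 1) m / pochhammer (c + real (r + j)) m"
    using Vandermonde_pochhammer[of m "c + real (r + j)" "real n + c - 1 + real r"] c
    by (force simp: algebra_simps)
  also have "(-1) ^ m * pochhammer a n * pochhammer (real n + c - 1) r / (fact r * fact m * pochhammer c (r + j)) *
      (pochhammer (real j - real n + 1) m / pochhammer (c + real (r + j)) m) =
      (-1) ^ m * pochhammer a n * pochhammer (real n + c - 1) r * pochhammer (real j - real n + 1) m
       / (fact r * fact m * pochhammer c (j + n))"
    using pochhammer_product'[of c "r + j" m] by (simp add: n ac_simps)
  finally show ?thesis by (simp add: m_def)
qed

text \<open>The vanishing factor leaves only \<open>j = n\<close>, where the coefficient of
  \<open>s ^ r\<close> turns into that of the polynomial itself. Read as moments: the polynomial in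
  the first variable is orthogonal to all lower powers of the second, and against the power
  \<open>n\<close> it reproduces the polynomial in \<open>s\<close>.\<close>

lemma jcoeff_jmoment:
  assumes a: "a > 0" and c: "c > 0" and j: "j \<le> n"
  shows "(\<Sum>i\<le>n. jcoeff a c n i * jmoment a c s i j) =
    (if j = n then fact n * pochhammer a n / pochhammer c (2 * n) * (\<Sum>r\<le>n. jcoeff a c n r * s ^ r) else 0)"
proof -
  define K where "K i r = real (i choose r) * real (j choose r) * fact r / pochhammer a r * s ^ r" for i r
  have pa: "pochhammer a i > 0" and pc: "pochhammer c i > 0" for i
    using a c by (auto intro: pochhammer_pos)
  have "(\<Sum>i\<le>n. jcoeff a c n i * jmoment a c s i j)
     = (\<Sum>i\<le>n. \<Sum>r\<le>n. jcoeff a c n i * (pochhammer a i * pochhammer a j / pochhammer c (i + j)) * K i r)"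
  proof (intro sum.cong refl)
    fix i assume "i \<in> {..n}"
    hence "(\<Sum>r\<le>i. K i r) = (\<Sum>r\<le>n. K i r)"
      by (intro sum.mono_neutral_left) (auto simp: K_def)
    thus "jcoeff a c n i * jmoment a c s i j =
       (\<Sum>r\<le>n. jcoeff a c n i * (pochhammer a i * pochhammer a j / pochhammer c (i + j)) * K i r)"
      by (simp add: jmoment_def K_def sum_distrib_left mult_ac)
  qed
  also have "\<dots> = (\<Sum>r\<le>n. real (j choose r) * fact r * pochhammer a j / pochhammer a r * s ^ r *
      (\<Sum>i\<le>n. jcoeff a c n i * pochhammer a i * real (i choose r) / pochhammer c (i + j)))"
    by (subst sum.swap) (simp add: K_def sum_distrib_left mult_ac)
  also have "\<dots> = (\<Sum>r\<le>n. real (j choose r) * fact r * pochhammer a j / pochhammer a r * s ^ r *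
      ((-1) ^ (n - r) * pochhammer a n * pochhammer (real n + c - 1) r * pochhammer (real j - real n + 1) (n - r)
       / (fact r * fact (n - r) * pochhammer c (j + n))))"
    by (intro sum.cong refl) (simp add: jcoeff_Chu_Vandermonde[OF a c])
  also have "\<dots> = (if j = n then fact n * pochhammer a n / pochhammer c (2 * n) * (\<Sum>r\<le>n. jcoeff a c n r * s ^ r) else 0)"
  proof (cases "j = n")
    case True
    have "real (n choose r) * fact r * pochhammer a n / pochhammer a r * s ^ r *
      ((-1) ^ (n - r) * pochhammer a n * pochhammer (real n + c - 1) r * pochhammer (real n - real n + 1) (n - r)
       / (fact r * fact (n - r) * pochhammer c (n + n))) =
       fact n * pochhammer a n / pochhammer c (2 * n) * (jcoeff a c n r * s ^ r)" if "r \<le> n" for r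
      using that pa[of r]
      by (simp add: jcoeff_def binomial_fact mult_2 mult_2_right mult_ac flip: pochhammer_fact)
    thus ?thesis using True by (simp add: sum_distrib_left)
  next
    case False
    \<comment> \<open>The two factors share the work: the binomial vanishes for
      \<open>r > j\<close>, the Pochhammer symbol for \<open>r \<le> j\<close>.\<close>
    have "real (j choose r) * pochhammer (real j - real n + 1) (n - r) = 0" if "r \<le> n" for r
    proof (cases "r \<le> j")
      case True
      have "real j - real n + 1 = - real (n - j - 1)" using False j by (simp add: of_nat_diff)
      moreover have "pochhammer (- real (n - j - 1)) (n - r) = 0"
        by (rule pochhammer_of_nat_eq_0_lemma) (use True False j in auto)
      ultimately show ?thesis by simp
    qed simp
    hence z: "real (j choose r) * fact r * pochhammer a j / pochhammer a r * s ^ r *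
      ((-1) ^ (n - r) * pochhammer a n * pochhammer (real n + c - 1) r * pochhammer (real j - real n + 1) (n - r)
       / (fact r * fact (n - r) * pochhammer c (j + n))) = 0" if "r \<le> n" for r
      using that by fastforce
    show ?thesis unfolding if_not_P[OF False] by (rule sum.neutral) (use z in blast)
  qed
  finally show ?thesis .
qed

text \<open>Of the second polynomial only the leading power survives, so its leading coefficient
  multiplies the constant of \<open>jcoeff_jmoment\<close>.\<close>

lemma jcoeff_jmoment_double:
  assumes a: "a > 0" and c: "c > 0"
  shows "(\<Sum>i\<le>n. \<Sum>j\<le>n. jcoeff a c n i * jcoeff a c n j * jmoment a c s i j) =
     pochhammer (real n + c - 1) n * pochhammer a n / pochhammer c (2 * n) * (\<Sum>r\<le>n. jcoeff a c n r * s ^ r)"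
proof -
  have "(\<Sum>i\<le>n. \<Sum>j\<le>n. jcoeff a c n i * jcoeff a c n j * jmoment a c s i j) =
     (\<Sum>j\<le>n. jcoeff a c n j * (\<Sum>i\<le>n. jcoeff a c n i * jmoment a c s i j))"
    by (subst sum.swap) (simp add: sum_distrib_left mult_ac)
  also have "\<dots> = (\<Sum>j\<le>n. if j = n then jcoeff a c n n * (fact n * pochhammer a n / pochhammer c (2 * n) * (\<Sum>r\<le>n. jcoeff a c n r * s ^ r)) else 0)"
    by (intro sum.cong refl) (simp add: jcoeff_jmoment[OF a c])
  also have "\<dots> = jcoeff a c n n * (fact n * pochhammer a n / pochhammer c (2 * n) * (\<Sum>r\<le>n. jcoeff a c n r * s ^ r))"
    by simp
  also have "jcoeff a c n n = pochhammer (real n + c - 1) n / fact n"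
    using pochhammer_pos[OF a, of n] by (simp add: jcoeff_def)
  finally show ?thesis by simp
qed

text \<open>With the Pochhammer symbols written as quotients of Gamma values, the factor
  \<open>2 * real n + c - 1\<close> in \<open>jacobi_a\<close> is the quotient of Gamma at
  \<open>c + 2 n\<close> and at \<open>2 n + c - 1\<close>. The bound \<open>c > 1\<close> keeps the
  argument \<open>n + c - 1\<close> positive at \<open>n = 0\<close>.\<close>

lemma jacobi_a_square:
  assumes a: "a > 0" and c: "c > 1" and ab: "\<beta> = a - 1" "\<alpha> = c - a - 1"
  shows "(jacobi_a \<alpha> \<beta> n)\<^sup>2 * (pochhammer (real n + c - 1) n * pochhammer a n / pochhammer c (2 * n)) = 1"
    and "jacobi_a \<alpha> \<beta> n \<noteq> 0"
proof -
  let ?x = "Gamma a * (2 * real n + c - 1) * Gamma (real n + c - 1) / (Gamma c * Gamma (real n + a))"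
  have e: "jacobi_a \<alpha> \<beta> n = sqrt ?x"
    unfolding jacobi_a_def ab by (simp add: algebra_simps)
  have pos: "Gamma a > 0" "Gamma (real n + c - 1) > 0" "Gamma c > 0" "Gamma (real n + a) > 0"
      "2 * real n + c - 1 > 0" "Gamma (c + 2 * real n) > 0" "Gamma (2 * real n + c - 1) > 0"
    using a c by (auto intro!: Gamma_real_pos)
  hence x: "?x > 0" by simp
  show "jacobi_a \<alpha> \<beta> n \<noteq> 0" using x unfolding e by (metis less_irrefl real_sqrt_gt_zero)
  have 1: "pochhammer (real n + c - 1) n = Gamma (2 * real n + c - 1) / Gamma (real n + c - 1)"
    using c by (subst pochhammer_Gamma) (auto simp: algebra_simps elim!: nonpos_Ints_cases)
  have 2: "pochhammer a n = Gamma (real n + a) / Gamma a"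
    using a by (subst pochhammer_Gamma) (auto simp: algebra_simps elim!: nonpos_Ints_cases)
  have 3: "pochhammer c (2 * n) = Gamma (c + 2 * real n) / Gamma c"
    using c by (subst pochhammer_Gamma) (auto simp: algebra_simps elim!: nonpos_Ints_cases)
  have 4: "Gamma (c + 2 * real n) = (2 * real n + c - 1) * Gamma (2 * real n + c - 1)"
    using Gamma_plus1[of "2 * real n + c - 1"] c by (force simp: algebra_simps elim!: nonpos_Ints_cases)
  have sq: "(jacobi_a \<alpha> \<beta> n)\<^sup>2 = ?x" using x unfolding e by simp
  show "(jacobi_a \<alpha> \<beta> n)\<^sup>2 * (pochhammer (real n + c - 1) n * pochhammer a n / pochhammer c (2 * n)) = 1"
    proof -
    have "Gamma a \<noteq> 0" "Gamma (real n + c - 1) \<noteq> 0" "Gamma c \<noteq> 0" "Gamma (real n + a) \<noteq> 0"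
      "2 * real n + c - 1 \<noteq> 0" "Gamma (2 * real n + c - 1) \<noteq> 0"
      using pos by linarith+
    thus ?thesis unfolding sq 1 2 3 4 by (simp add: divide_simps)
  qed
qed

section \<open>Moments of rotation invariant rank-one idempotents\<close>

lemma fps_linear_ODE_unique:
  fixes F G B W :: "real fps"
  assumes "fps_deriv F * B = W * F" "fps_deriv G * B = W * G" "fps_nth F 0 = fps_nth G 0" "fps_nth B 0 = 1"
  shows "F = G"
proof -
  define E where "E = F - G"
  have E: "fps_deriv E * B = W * E" "fps_nth E 0 = 0"
    using assms by (auto simp: E_def algebra_simps)
  have "fps_nth E n = 0" for n
  proof (induction n rule: less_induct)
    case (less n)
    show ?case
    proof (cases n)
      case 0 thus ?thesis using E by simp
    next
      case (Suc k)
      \<comment> \<open>Once all coefficients of \<open>E\<close> below \<open>n = k + 1\<close>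
        vanish, coefficient \<open>k\<close> of the equation reduces to \<open>(k + 1)\<close> times
        coefficient \<open>n\<close>, because \<open>B\<close> has constant term 1.\<close>
      have "fps_nth (W * E) k = 0"
        unfolding fps_mult_nth by (intro sum.neutral) (use less Suc in auto)
      moreover have "fps_nth (fps_deriv E * B) k = (\<Sum>i\<in>{k}. fps_nth (fps_deriv E) i * fps_nth B (k - i))"
        unfolding fps_mult_nth by (rule sum.mono_neutral_right) (use less Suc in auto)
      ultimately show ?thesis using E Suc assms(4) by simp
    qed
  qed
  hence "E = 0" by (simp add: fps_eq_iff)
  thus ?thesis by (simp add: E_def)
qed

text \<open>The binomial series of \<open>(1 - l z)^(-a)\<close>. Products of such powers are
  compared through the linear equation \<open>(1 - l z) F' = a l F\<close> that each of them
  satisfies.\<close>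

definition fps_negpow :: "real \<Rightarrow> real \<Rightarrow> real fps" where
  "fps_negpow a l = Abs_fps (\<lambda>k. pochhammer a k / fact k * l ^ k)"

lemma fps_negpow_nth [simp]: "fps_nth (fps_negpow a l) k = pochhammer a k / fact k * l ^ k"
  by (simp add: fps_negpow_def)

lemma fps_negpow_deriv:
  "fps_deriv (fps_negpow a l) * (1 - fps_const l * fps_X) = fps_const (a * l) * fps_negpow a l"
proof (rule fps_ext)
  fix k
  show "fps_nth (fps_deriv (fps_negpow a l) * (1 - fps_const l * fps_X)) k = fps_nth (fps_const (a * l) * fps_negpow a l) k"
  proof (cases k)
    case 0 thus ?thesis by (simp add: fps_mult_nth_0)
  next
    case (Suc j)
    define q where "q m = pochhammer a m / fact m" for m
    have q: "fps_nth (fps_negpow a l) m = q m * l ^ m" for m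
      by (simp add: q_def)
    have rec: "real (Suc m) * q (Suc m) = (a + real m) * q m" for m
      unfolding q_def by (simp add: pochhammer_Suc divide_simps)
    have "fps_deriv (fps_negpow a l) * (1 - fps_const l * fps_X)
        = fps_deriv (fps_negpow a l) - fps_const l * (fps_X * fps_deriv (fps_negpow a l))"
      by (simp add: algebra_simps)
    hence "fps_nth (fps_deriv (fps_negpow a l) * (1 - fps_const l * fps_X)) k =
        (real (Suc k) * q (Suc k)) * l ^ Suc k - (real (Suc j) * q (Suc j)) * l ^ Suc k"
      using Suc by (simp add: q mult_ac del: fps_negpow_nth of_nat_Suc)
    also have "\<dots> = fps_nth (fps_const (a * l) * fps_negpow a l) k"
      unfolding rec[of k] using Suc by (simp add: q algebra_simps del: fps_negpow_nth)
    finally show ?thesis .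
  qed
qed

lemma fps_negpow_Suc: "fps_negpow (a + 1) l * (1 - fps_const l * fps_X) = fps_negpow a l"
proof (rule fps_ext)
  fix k
  have e: "fps_negpow (a + 1) l * (1 - fps_const l * fps_X) = fps_negpow (a + 1) l - fps_const l * (fps_X * fps_negpow (a + 1) l)"
    by (simp add: algebra_simps)
  show "fps_nth (fps_negpow (a + 1) l * (1 - fps_const l * fps_X)) k = fps_nth (fps_negpow a l) k"
  proof (cases k)
    case 0 thus ?thesis unfolding e by simp
  next
    case (Suc j)
    have "pochhammer a (Suc j) = a * pochhammer (a + 1) j" by (rule pochhammer_rec)
    moreover have "pochhammer (a + 1) (Suc j) = (a + 1 + real j) * pochhammer (a + 1) j" by (simp add: pochhammer_Suc)
    ultimately show ?thesis unfolding e Suc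
      by (simp add: divide_simps del: pochhammer_Suc) (simp add: algebra_simps del: pochhammer_Suc)
  qed
qed

lemma fps_negpow_0 [simp]: "fps_negpow 0 l = 1"
  by (rule fps_ext) (simp add: pochhammer_0_left)

lemma fps_negpow_mult_1: "fps_negpow (a + 1) l = fps_negpow a l * fps_negpow 1 l"
proof -
  have "fps_negpow 1 l * (1 - fps_const l * fps_X) = 1"
    using fps_negpow_Suc[of 0 l] by simp
  moreover have "fps_negpow a l * fps_negpow 1 l = fps_negpow (a + 1) l * (fps_negpow 1 l * (1 - fps_const l * fps_X))"
    unfolding fps_negpow_Suc[of a l, symmetric] by (simp only: mult_ac)
  ultimately show ?thesis by simp
qed

lemma fps_negpow_mult_power: "fps_negpow a l * fps_negpow 1 l ^ r = fps_negpow (a + real r) l"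
proof (induction r)
  case (Suc r)
  thus ?case using fps_negpow_mult_1[of "a + real r" l] by (simp add: algebra_simps)
qed simp

text \<open>Both sides are the power \<open>-a\<close> of
  \<open>(1 - l z) (1 - m z) = (1 - x z) (1 - y z) (1 - Y)\<close>, where \<open>Y = s x y z\<^sup>2 / ((1 - x z) (1 - y z))\<close>.\<close>

lemma fps_negpow_product:
  fixes a l m x y s :: real
  assumes sum: "l + m = x + y" and prod: "l * m = x * y * (1 - s)"
  defines "Y \<equiv> fps_const (s * x * y) * fps_X ^ 2 * (fps_negpow 1 x * fps_negpow 1 y)"
  shows "fps_negpow a l * fps_negpow a m = fps_negpow a x * fps_negpow a y * (fps_negpow a 1 oo Y)"
proof -
  define L where "L u = 1 - fps_const u * fps_X" for u :: real
  define D where "D = fps_negpow a x * fps_negpow a y"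
  define K where "K = fps_negpow a 1 oo Y"
  define B where "B = L l * L m"
  define c where "c = fps_const (s * x * y) * fps_X ^ 2"
  have Y0: "fps_nth Y 0 = 0" by (simp add: Y_def fps_mult_nth_0)
  have L0: "fps_nth (L u) 0 = 1" for u by (simp add: L_def fps_mult_nth_0)
  have dL: "fps_deriv (L u) = - fps_const u" for u by (simp add: L_def)
  have inv1: "fps_negpow 1 u * L u = 1" for u
    using fps_negpow_Suc[of 0 u] by (simp add: L_def)
  have YA: "Y * (L x * L y) = c"
  proof -
    have "Y * (L x * L y) = c * (fps_negpow 1 x * L x) * (fps_negpow 1 y * L y)"
      by (simp add: Y_def c_def mult_ac)
    thus ?thesis by (simp add: inv1)
  qed
  have BA: "B = L x * L y * (1 - Y)"
  proof -
    have "L l * L m = 1 - fps_const (l + m) * fps_X + fps_const (l * m) * fps_X ^ 2"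
      by (simp add: L_def algebra_simps power2_eq_square flip: fps_const_add fps_const_mult)
    also have "\<dots> = 1 - fps_const (x + y) * fps_X + fps_const (x * y) * fps_X ^ 2 - c"
      unfolding sum prod c_def
      by (simp add: algebra_simps flip: fps_const_add fps_const_mult fps_const_sub)
    also have "1 - fps_const (x + y) * fps_X + fps_const (x * y) * fps_X ^ 2 = L x * L y"
      by (simp add: L_def algebra_simps power2_eq_square flip: fps_const_add fps_const_mult)
    finally show ?thesis using YA by (simp add: B_def algebra_simps)
  qed
  have dG: "fps_deriv (fps_negpow a u) * L u = fps_const a * fps_const u * fps_negpow a u" for u
    using fps_negpow_deriv[of a u] by (simp add: L_def)
  have dK: "fps_deriv K * (1 - Y) = fps_const a * K * fps_deriv Y"
  proof -
    have "(fps_deriv (fps_negpow a 1) * (1 - fps_X)) oo Y = (fps_const a * fps_negpow a 1) oo Y"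
      using dG[of 1] by (simp add: L_def)
    hence "(fps_deriv (fps_negpow a 1) oo Y) * (1 - Y) = fps_const a * K"
      by (simp add: fps_compose_mult_distrib[OF Y0] fps_compose_sub_distrib fps_X_fps_compose_startby0[OF Y0] K_def)
    moreover have "fps_deriv K * (1 - Y) = ((fps_deriv (fps_negpow a 1) oo Y) * (1 - Y)) * fps_deriv Y"
      unfolding K_def fps_compose_deriv[OF Y0] by (simp only: mult_ac)
    ultimately show ?thesis by simp
  qed
  have lhs: "fps_deriv (fps_negpow a l * fps_negpow a m) * B = (- fps_const a * fps_deriv B) * (fps_negpow a l * fps_negpow a m)"
  proof -
    have "fps_deriv (fps_negpow a l * fps_negpow a m) * B =
       (fps_deriv (fps_negpow a l) * L l) * L m * fps_negpow a m + (fps_deriv (fps_negpow a m) * L m) * L l * fps_negpow a l"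
      by (simp add: B_def algebra_simps)
    also have "\<dots> = (- fps_const a * fps_deriv B) * (fps_negpow a l * fps_negpow a m)"
      unfolding dG by (simp add: B_def dL algebra_simps del: fps_const_mult fps_const_neg)
    finally show ?thesis .
  qed
  have dD: "fps_deriv D * (L x * L y) = - fps_const a * fps_deriv (L x * L y) * D"
  proof -
    have "fps_deriv D * (L x * L y) =
       (fps_deriv (fps_negpow a x) * L x) * L y * fps_negpow a y + (fps_deriv (fps_negpow a y) * L y) * L x * fps_negpow a x"
      by (simp add: D_def algebra_simps)
    also have "\<dots> = (- fps_const a * fps_deriv (L x * L y)) * D"
      unfolding dG by (simp add: D_def dL algebra_simps del: fps_const_mult fps_const_neg)
    finally show ?thesis .
  qed
  have rhs: "fps_deriv (D * K) * B = (- fps_const a * fps_deriv B) * (D * K)"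
  proof -
    have "fps_deriv (D * K) * B = (fps_deriv D * (L x * L y)) * (1 - Y) * K + D * (L x * L y) * (fps_deriv K * (1 - Y))"
      unfolding BA by (simp add: algebra_simps)
    also have "\<dots> = (- fps_const a * (fps_deriv (L x * L y) * (1 - Y) - (L x * L y) * fps_deriv Y)) * (D * K)"
      unfolding dD dK by (simp add: algebra_simps del: fps_deriv_mult fps_const_mult fps_const_neg)
    also have "fps_deriv (L x * L y) * (1 - Y) - (L x * L y) * fps_deriv Y = fps_deriv B"
      unfolding BA by (simp add: algebra_simps)
    finally show ?thesis .
  qed
  \<comment> \<open>Both sides have constant term 1 and solve \<open>B F' = - a B' F\<close> for the
    common base \<open>B = (1 - l z) (1 - m z)\<close>.\<close>
  have "fps_negpow a l * fps_negpow a m = D * K"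
    by (rule fps_linear_ODE_unique[OF lhs rhs])
       (use Y0 in \<open>simp_all add: D_def K_def B_def L0 fps_mult_nth_0\<close>)
  thus ?thesis by (simp add: D_def K_def)
qed

lemma fps_mult_compose_nth:
  fixes D F Y :: "real fps"
  assumes "fps_nth Y 0 = 0"
  shows "fps_nth (D * (F oo Y)) k = (\<Sum>r\<le>k. fps_nth F r * fps_nth (D * Y ^ r) k)"
proof -
  have "fps_nth (D * (F oo Y)) k = (\<Sum>i=0..k. fps_nth D i * (\<Sum>r\<le>k. fps_nth F r * fps_nth (Y ^ r) (k - i)))"
    unfolding fps_mult_nth
  proof (intro sum.cong refl arg_cong2[where f = "(*)"])
    fix i assume "i \<in> {0..k}"
    show "fps_nth (F oo Y) (k - i) = (\<Sum>r\<le>k. fps_nth F r * fps_nth (Y ^ r) (k - i))"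
      unfolding fps_compose_nth
      by (rule sum.mono_neutral_left) (use startsby_zero_power_prefix[OF assms] in force)+
  qed
  also have "\<dots> = (\<Sum>r\<le>k. fps_nth F r * fps_nth (D * Y ^ r) k)"
    by (simp add: sum_distrib_left fps_mult_nth mult_ac sum.swap[of _ "{..k}"])
  finally show ?thesis .
qed

text \<open>Coefficient of \<open>z^k\<close> in \<open>fps_negpow_product\<close>: the term of
  order \<open>r\<close> of \<open>(1 - Y)^(-a)\<close> contributes
  \<open>(a)_r / r! (s x y z^2)^r\<close> and raises the exponents of the other two factors to
  \<open>a + r\<close>. Up to the factor \<open>k! / (c)_k\<close> the left side is moment
  \<open>k\<close> of \<open>l u_0 + m u_1\<close> under the Dirichlet law, \<open>l\<close> and
  \<open>m\<close> being eigenvalues of a quadratic form.\<close>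

lemma elliptic_moment_identity:
  fixes a l m x y s :: real
  assumes a: "a > 0" and sum: "l + m = x + y" and prod: "l * m = x * y * (1 - s)"
  shows "(\<Sum>i\<le>k. pochhammer a i / fact i * (pochhammer a (k - i) / fact (k - i)) * l ^ i * m ^ (k - i)) =
    (\<Sum>i\<le>k. pochhammer a i / fact i * (pochhammer a (k - i) / fact (k - i)) *
       (\<Sum>r\<le>i. real (i choose r) * real ((k - i) choose r) * fact r / pochhammer a r * s ^ r) * x ^ i * y ^ (k - i))"
proof -
  define Y where "Y = fps_const (s * x * y) * fps_X ^ 2 * (fps_negpow 1 x * fps_negpow 1 y)"
  define D where "D = fps_negpow a x * fps_negpow a y"
  define T where "T r i = pochhammer a i / fact i * (pochhammer a (k - i) / fact (k - i)) *
       (real (i choose r) * real ((k - i) choose r) * fact r / pochhammer a r * s ^ r) * x ^ i * y ^ (k - i)" for r i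
  have pa: "pochhammer a i > 0" for i using a by (rule pochhammer_pos)
  have Y0: "fps_nth Y 0 = 0" by (simp add: Y_def fps_mult_nth_0)
  have DY: "D * Y ^ r = fps_const ((s * x * y) ^ r) * (fps_X ^ (2 * r) * (fps_negpow (a + real r) x * fps_negpow (a + real r) y))" for r
  proof -
    have "D * Y ^ r = fps_const (s * x * y) ^ r * (fps_X ^ 2) ^ r *
       ((fps_negpow a x * fps_negpow 1 x ^ r) * (fps_negpow a y * fps_negpow 1 y ^ r))"
      by (simp add: D_def Y_def power_mult_distrib mult_ac)
    thus ?thesis unfolding power_mult[of fps_X 2 r] by (simp only: fps_negpow_mult_power fps_const_power mult_ac)
  qed
  have T: "pochhammer a r / fact r * fps_nth (D * Y ^ r) k = (\<Sum>i\<le>k. T r i)" for r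
  proof (cases "2 * r \<le> k")
    case False
    have "T r i = 0" if "i \<le> k" for i using False that by (auto simp: T_def binomial_eq_0_iff)
    thus ?thesis using False by (simp add: DY fps_X_power_mult_nth)
  next
    case True
    \<comment> \<open>A nonzero term needs \<open>r \<le> i\<close> and
      \<open>r \<le> k - i\<close>. Taking \<open>r\<close> off both parts of \<open>k\<close>
      leaves the convolution of two series with exponent \<open>a + r\<close>.\<close>
    have "(\<Sum>i\<le>k. T r i) = (\<Sum>i\<in>{r..k - r}. T r i)"
      by (rule sum.mono_neutral_right) (auto simp: T_def binomial_eq_0_iff)
    also have "\<dots> = (\<Sum>p = 0..k - 2 * r. T r (p + r))"
      by (rule sum.reindex_bij_witness[of _ "\<lambda>p. p + r" "\<lambda>i. i - r"]) (use True in auto)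
    also have "\<dots> = (\<Sum>p = 0..k - 2 * r. pochhammer a r / fact r * (s * x * y) ^ r *
       (pochhammer (a + real r) p / fact p * x ^ p * (pochhammer (a + real r) (k - 2 * r - p) / fact (k - 2 * r - p) * y ^ (k - 2 * r - p))))"
    proof (intro sum.cong refl)
      fix p assume "p \<in> {0..k - 2 * r}"
      then obtain q where q: "k = p + q + 2 * r"
        using True by (metis atLeastAtMost_iff le_add_diff_inverse le_add_diff_inverse2)
      have kq: "k - (p + r) = q + r" "k - 2 * r - p = q" using q by auto
      have b: "real ((u + r) choose r) = fact (u + r) / (fact r * fact u)" for u
        by (subst binomial_fact) (auto simp: field_simps)
      have pp: "pochhammer a (u + r) = pochhammer a r * pochhammer (a + real r) u" for u
        by (subst add.commute) (rule pochhammer_product')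
      show "T r (p + r) = pochhammer a r / fact r * (s * x * y) ^ r *
       (pochhammer (a + real r) p / fact p * x ^ p * (pochhammer (a + real r) (k - 2 * r - p) / fact (k - 2 * r - p) * y ^ (k - 2 * r - p)))"
        unfolding T_def kq b pp using pa[of r] by (simp add: field_simps power_add power_mult_distrib)
    qed
    also have "\<dots> = pochhammer a r / fact r * fps_nth (D * Y ^ r) k"
    proof -
      have "fps_nth (D * Y ^ r) k = (s * x * y) ^ r * fps_nth (fps_negpow (a + real r) x * fps_negpow (a + real r) y) (k - 2 * r)"
        unfolding DY fps_mult_left_const_nth fps_X_power_mult_nth using True by simp
      thus ?thesis unfolding fps_mult_nth[of "fps_negpow (a + real r) x"] by (simp add: sum_distrib_left mult_ac)
    qed
    finally show ?thesis by simp
  qed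
  have "(\<Sum>i\<le>k. pochhammer a i / fact i * (pochhammer a (k - i) / fact (k - i)) * l ^ i * m ^ (k - i)) = fps_nth (fps_negpow a l * fps_negpow a m) k"
    by (simp add: fps_mult_nth atMost_atLeast0 mult_ac)
  also have "\<dots> = fps_nth (D * (fps_negpow a 1 oo Y)) k"
    unfolding D_def Y_def by (subst fps_negpow_product[OF sum prod]) simp
  also have "\<dots> = (\<Sum>r\<le>k. \<Sum>i\<le>k. T r i)"
    unfolding fps_mult_compose_nth[OF Y0] by (simp flip: T)
  also have "\<dots> = (\<Sum>i\<le>k. \<Sum>r\<le>k. T r i)" by (rule sum.swap)
  also have "\<dots> = (\<Sum>i\<le>k. \<Sum>r\<le>i. T r i)"
    by (intro sum.cong refl sum.mono_neutral_right) (auto simp: T_def binomial_eq_0_iff)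
  finally show ?thesis by (simp add: T_def sum_distrib_left sum_distrib_right mult_ac)
qed

text \<open>Uniform in the sample point: the bound that dominates difference quotients at 0.
  Boundedness is included so that the notion is closed under products and can be verified by
  introduction rules.\<close>

definition (in prob_space) lipschitz_at_0 :: "(real \<Rightarrow> 'a \<Rightarrow> real) \<Rightarrow> bool" where
  "lipschitz_at_0 f \<longleftrightarrow> (\<exists>K\<ge>0. \<forall>\<tau>. \<forall>\<omega>\<in>space M. \<bar>f \<tau> \<omega>\<bar> \<le> K \<and> \<bar>f \<tau> \<omega> - f 0 \<omega>\<bar> \<le> K * \<bar>\<tau>\<bar>)"

context prob_space
begin

lemma lipschitz_at_0_const:
  assumes "\<And>\<omega>. \<omega> \<in> space M \<Longrightarrow> \<bar>X \<omega>\<bar> \<le> K"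
  shows "lipschitz_at_0 (\<lambda>\<tau>. X)"
  unfolding lipschitz_at_0_def
proof (intro exI[of _ "max K 0"] conjI allI ballI)
  fix \<omega> assume "\<omega> \<in> space M"
  from assms[OF this] show "\<bar>X \<omega>\<bar> \<le> max K 0" by linarith
qed auto

lemma lipschitz_at_0_add:
  assumes "lipschitz_at_0 f" "lipschitz_at_0 g"
  shows "lipschitz_at_0 (\<lambda>\<tau> \<omega>. f \<tau> \<omega> + g \<tau> \<omega>)"
proof -
  obtain K L where K: "K \<ge> 0" "\<And>\<tau> \<omega>. \<omega> \<in> space M \<Longrightarrow> \<bar>f \<tau> \<omega>\<bar> \<le> K \<and> \<bar>f \<tau> \<omega> - f 0 \<omega>\<bar> \<le> K * \<bar>\<tau>\<bar>"
    and L: "L \<ge> 0" "\<And>\<tau> \<omega>. \<omega> \<in> space M \<Longrightarrow> \<bar>g \<tau> \<omega>\<bar> \<le> L \<and> \<bar>g \<tau> \<omega> - g 0 \<omega>\<bar> \<le> L * \<bar>\<tau>\<bar>"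
    using assms unfolding lipschitz_at_0_def by metis
  show ?thesis unfolding lipschitz_at_0_def
  proof (intro exI[of _ "K + L"] conjI allI ballI)
    fix \<tau> \<omega> assume w: "\<omega> \<in> space M"
    show "\<bar>f \<tau> \<omega> + g \<tau> \<omega>\<bar> \<le> K + L" using K(2)[OF w, of \<tau>] L(2)[OF w, of \<tau>] by linarith
    show "\<bar>f \<tau> \<omega> + g \<tau> \<omega> - (f 0 \<omega> + g 0 \<omega>)\<bar> \<le> (K + L) * \<bar>\<tau>\<bar>"
      using K(2)[OF w, of \<tau>] L(2)[OF w, of \<tau>] unfolding distrib_right by linarith
  qed (use K L in simp)
qed

lemma lipschitz_at_0_mult:
  assumes "lipschitz_at_0 f" "lipschitz_at_0 g"
  shows "lipschitz_at_0 (\<lambda>\<tau> \<omega>. f \<tau> \<omega> * g \<tau> \<omega>)"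
proof -
  obtain K L where K: "K \<ge> 0" "\<And>\<tau> \<omega>. \<omega> \<in> space M \<Longrightarrow> \<bar>f \<tau> \<omega>\<bar> \<le> K \<and> \<bar>f \<tau> \<omega> - f 0 \<omega>\<bar> \<le> K * \<bar>\<tau>\<bar>"
    and L: "L \<ge> 0" "\<And>\<tau> \<omega>. \<omega> \<in> space M \<Longrightarrow> \<bar>g \<tau> \<omega>\<bar> \<le> L \<and> \<bar>g \<tau> \<omega> - g 0 \<omega>\<bar> \<le> L * \<bar>\<tau>\<bar>"
    using assms unfolding lipschitz_at_0_def by metis
  show ?thesis unfolding lipschitz_at_0_def
  proof (intro exI[of _ "2 * K * L"] conjI allI ballI)
    fix \<tau> \<omega> assume w: "\<omega> \<in> space M"
    have "\<bar>f \<tau> \<omega> * g \<tau> \<omega>\<bar> \<le> K * L" unfolding abs_mult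
      using K(2)[OF w, of \<tau>] L(2)[OF w, of \<tau>] K(1) by (intro mult_mono) auto
    thus "\<bar>f \<tau> \<omega> * g \<tau> \<omega>\<bar> \<le> 2 * K * L" using mult_nonneg_nonneg[OF K(1) L(1)] by linarith
    have "\<bar>f \<tau> \<omega> * g \<tau> \<omega> - f 0 \<omega> * g 0 \<omega>\<bar> = \<bar>f \<tau> \<omega> * (g \<tau> \<omega> - g 0 \<omega>) + (f \<tau> \<omega> - f 0 \<omega>) * g 0 \<omega>\<bar>"
      by (simp add: algebra_simps)
    also have "\<dots> \<le> \<bar>f \<tau> \<omega>\<bar> * \<bar>g \<tau> \<omega> - g 0 \<omega>\<bar> + \<bar>f \<tau> \<omega> - f 0 \<omega>\<bar> * \<bar>g 0 \<omega>\<bar>"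
      by (metis abs_mult abs_triangle_ineq)
    also have "\<dots> \<le> K * (L * \<bar>\<tau>\<bar>) + (K * \<bar>\<tau>\<bar>) * L"
      using K(2)[OF w, of \<tau>] L(2)[OF w, of \<tau>] L(2)[OF w, of 0] K(1) by (intro add_mono mult_mono) auto
    finally show "\<bar>f \<tau> \<omega> * g \<tau> \<omega> - f 0 \<omega> * g 0 \<omega>\<bar> \<le> 2 * K * L * \<bar>\<tau>\<bar>" by (simp add: algebra_simps)
  qed (use K L in simp)
qed

lemma lipschitz_at_0_power: "lipschitz_at_0 f \<Longrightarrow> lipschitz_at_0 (\<lambda>\<tau> \<omega>. f \<tau> \<omega> ^ n)"
proof (induction n)
  case 0
  show ?case unfolding power_0 by (rule lipschitz_at_0_const[of _ 1]) simp
next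
  case (Suc n)
  thus ?case unfolding power_Suc by (intro lipschitz_at_0_mult)
qed

lemma lipschitz_at_0_sin: "lipschitz_at_0 (\<lambda>\<tau> \<omega>. sin \<tau>)"
  unfolding lipschitz_at_0_def using abs_sin_x_le_abs_x by (intro exI[of _ 1]) simp

lemma lipschitz_at_0_cos: "lipschitz_at_0 (\<lambda>\<tau> \<omega>. cos \<tau>)"
proof -
  have "\<bar>cos \<tau> - 1\<bar> \<le> \<bar>\<tau>\<bar>" for \<tau> :: real
  proof -
    have "cos \<tau> - 1 = - 2 * (sin (\<tau> / 2))\<^sup>2" using cos_double_sin[of "\<tau> / 2"] by simp
    hence "\<bar>cos \<tau> - 1\<bar> = 2 * \<bar>sin (\<tau> / 2)\<bar> * \<bar>sin (\<tau> / 2)\<bar>" by (simp add: power2_eq_square abs_mult)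
    also have "\<dots> \<le> 2 * \<bar>sin (\<tau> / 2)\<bar> * 1" by (intro mult_left_mono) auto
    also have "\<dots> \<le> \<bar>\<tau>\<bar>" using abs_sin_x_le_abs_x[of "\<tau> / 2"] by simp
    finally show ?thesis .
  qed
  thus ?thesis unfolding lipschitz_at_0_def by (intro exI[of _ 1]) auto
qed

text \<open>Dominated convergence of the difference quotients along \<open>1 / (n + 1)\<close>,
  dominated by the Lipschitz constant; each quotient has expectation 0. Measurability of
  \<open>D\<close> comes from the same limit.\<close>

lemma expectation_derivative_eq_0:
  assumes meas: "\<And>\<tau>. f \<tau> \<in> borel_measurable M" and lip: "lipschitz_at_0 f"
    and const: "\<And>\<tau>. expectation (f \<tau>) = c"
    and D: "\<And>\<omega>. \<omega> \<in> space M \<Longrightarrow> ((\<lambda>\<tau>. f \<tau> \<omega>) has_real_derivative D \<omega>) (at 0)"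
  shows "expectation D = 0"
proof -
  obtain K where K: "K \<ge> 0" "\<And>\<tau> \<omega>. \<omega> \<in> space M \<Longrightarrow> \<bar>f \<tau> \<omega>\<bar> \<le> K \<and> \<bar>f \<tau> \<omega> - f 0 \<omega>\<bar> \<le> K * \<bar>\<tau>\<bar>"
    using lip unfolding lipschitz_at_0_def by metis
  have int: "integrable M (f \<tau>)" for \<tau>
    by (rule integrable_const_bound[where B = K]) (use K meas in auto)
  define h where "h n = 1 / real (Suc n)" for n
  have h: "h \<longlonglongrightarrow> 0" "h n > 0" for n
    unfolding h_def by (rule LIMSEQ_Suc[OF lim_1_over_n]) simp
  define s where "s n \<omega> = (f (h n) \<omega> - f 0 \<omega>) / h n" for n \<omega>
  have lim: "(\<lambda>n. s n \<omega>) \<longlonglongrightarrow> D \<omega>" if "\<omega> \<in> space M" for \<omega>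
  proof -
    have "((\<lambda>\<tau>. (f \<tau> \<omega> - f 0 \<omega>) / \<tau>) \<longlongrightarrow> D \<omega>) (at 0)"
      using D[OF that] by (simp add: has_field_derivative_iff)
    moreover have "filterlim h (at 0) sequentially"
      using h by (auto simp: filterlim_at less_imp_neq[symmetric])
    ultimately show ?thesis unfolding s_def by (rule filterlim_compose)
  qed
  have s_meas: "s n \<in> borel_measurable M" for n unfolding s_def using meas by measurable
  have D_meas: "D \<in> borel_measurable M"
    by (rule borel_measurable_LIMSEQ_real[of _ s]) (use lim s_meas in auto)
  have "(\<lambda>n. expectation (s n)) \<longlonglongrightarrow> expectation D"
  proof (rule integral_dominated_convergence[where w = "\<lambda>_. K"])
    show "AE \<omega> in M. norm (s n \<omega>) \<le> K" for n
    proof (rule AE_I2)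
      fix \<omega> assume "\<omega> \<in> space M"
      from K(2)[OF this, of "h n"] have "\<bar>f (h n) \<omega> - f 0 \<omega>\<bar> \<le> K * h n" using h(2)[of n] by auto
      thus "norm (s n \<omega>) \<le> K" using h(2)[of n] by (simp add: s_def divide_le_eq)
    qed
  qed (use lim D_meas s_meas in auto)
  moreover have "expectation (s n) = 0" for n
    unfolding s_def using int const by simp
  ultimately show ?thesis by (simp add: LIMSEQ_const_iff)
qed

end

text \<open>An abstraction of a point \<open>U\<close> of a rank-one idempotent matrix or of a sphere: \<open>u q\<close> stands for the
  diagonal entries, and \<open>w q\<close> for the real part of the entry at position \<open>(0, q)\<close>. The parameter
  \<open>\<delta>\<close> is the real dimension of the off-diagonal entries.\<close>

locale jordan_frame = prob_space M for M :: "'w measure" +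
  fixes N \<delta> :: nat and u w :: "nat \<Rightarrow> 'w \<Rightarrow> real"
  assumes N: "N \<ge> 2" and \<delta>: "\<delta> \<ge> 1"
    and u_meas [measurable]: "\<And>q. q < N \<Longrightarrow> u q \<in> borel_measurable M"
    and w_meas [measurable]: "\<And>q. q \<ge> 1 \<Longrightarrow> q < N \<Longrightarrow> w q \<in> borel_measurable M"
    and u_bound: "\<And>q \<omega>. q < N \<Longrightarrow> \<omega> \<in> space M \<Longrightarrow> \<bar>u q \<omega>\<bar> \<le> 1"
    and w_bound: "\<And>q \<omega>. q \<ge> 1 \<Longrightarrow> q < N \<Longrightarrow> \<omega> \<in> space M \<Longrightarrow> \<bar>w q \<omega>\<bar> \<le> 1"
    and u_sum: "\<And>\<omega>. \<omega> \<in> space M \<Longrightarrow> (\<Sum>q<N. u q \<omega>) = 1"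
    and w_square: "\<And>q i j. q \<ge> 1 \<Longrightarrow> q < N \<Longrightarrow>
       real \<delta> * expectation (\<lambda>\<omega>. (w q \<omega>)\<^sup>2 * u 0 \<omega> ^ i * u 1 \<omega> ^ j) = expectation (\<lambda>\<omega>. u 0 \<omega> ^ Suc i * u q \<omega> * u 1 \<omega> ^ j)"
    and rotation: "\<And>q C S (F :: real \<times> real \<times> real \<times> real \<Rightarrow> real). q \<ge> 1 \<Longrightarrow> q < N \<Longrightarrow> C\<^sup>2 + S\<^sup>2 = 1 \<Longrightarrow> F \<in> borel_measurable borel \<Longrightarrow>
       expectation (\<lambda>\<omega>. F (u 0 \<omega>, u q \<omega>, w q \<omega>, u 1 \<omega>)) =
       expectation (\<lambda>\<omega>. F (C\<^sup>2 * u 0 \<omega> + S\<^sup>2 * u q \<omega> + 2 * C * S * w q \<omega>,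
          S\<^sup>2 * u 0 \<omega> + C\<^sup>2 * u q \<omega> - 2 * C * S * w q \<omega>,
          C * S * (u 0 \<omega> - u q \<omega>) - (C\<^sup>2 - S\<^sup>2) * w q \<omega>,
          if q = 1 then S\<^sup>2 * u 0 \<omega> + C\<^sup>2 * u q \<omega> - 2 * C * S * w q \<omega> else u 1 \<omega>))"
begin

definition "m i j = expectation (\<lambda>\<omega>. u 0 \<omega> ^ i * u 1 \<omega> ^ j)"

lemma u01 [measurable]: "u 0 \<in> borel_measurable M" "u 1 \<in> borel_measurable M" "u (Suc 0) \<in> borel_measurable M"
  "w 1 \<in> borel_measurable M" "w (Suc 0) \<in> borel_measurable M"
  using N u_meas w_meas by auto

lemma integrable_bounded:
  assumes "X \<in> borel_measurable M" "lipschitz_at_0 (\<lambda>_. X)"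
  shows "integrable M X"
proof -
  obtain K where "\<And>\<omega>. \<omega> \<in> space M \<Longrightarrow> \<bar>X \<omega>\<bar> \<le> K" using assms(2) unfolding lipschitz_at_0_def by metis
  thus ?thesis using assms(1) by (intro integrable_const_bound[where B = K]) auto
qed

lemma lip_u: "q < N \<Longrightarrow> lipschitz_at_0 (\<lambda>_. u q)" and lip_w: "q \<ge> 1 \<Longrightarrow> q < N \<Longrightarrow> lipschitz_at_0 (\<lambda>_. w q)"
  using u_bound w_bound by (auto intro: lipschitz_at_0_const[of _ 1])

lemma lip_u01: "lipschitz_at_0 (\<lambda>_. u 0)" "lipschitz_at_0 (\<lambda>_. u 1)"
  using N by (intro lip_u; simp)+

lemma lip_real: "lipschitz_at_0 (\<lambda>_ _. r)"
  by (rule lipschitz_at_0_const[of _ "\<bar>r\<bar>"]) simp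

lemmas lip_intros = lipschitz_at_0_add lipschitz_at_0_mult lipschitz_at_0_power lipschitz_at_0_sin
  lipschitz_at_0_cos lip_real lip_u01

text \<open>The test function contains a single factor \<open>w q\<close>, odd under a change of
  sign, so that its derivative in the angle contains only even powers of \<open>w q\<close>, and
  \<open>w_square\<close> eliminates these. The entry \<open>u 1\<close> is carried along in the
  invariance because it is itself moved when \<open>q = 1\<close>.\<close>

lemma rotation_derivative:
  assumes q: "q \<ge> 1" "q < N"
  shows "expectation (\<lambda>\<omega>. u 0 \<omega> ^ Suc i * u 1 \<omega> ^ j) - expectation (\<lambda>\<omega>. u 0 \<omega> ^ i * u q \<omega> * u 1 \<omega> ^ j)
     = 2 / real \<delta> * (real i * expectation (\<lambda>\<omega>. u 0 \<omega> ^ i * u q \<omega> * u 1 \<omega> ^ j)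
        - (if q = 1 then real j * m (Suc i) j else 0))"
proof -
  note [measurable] = u_meas[OF q(2)] w_meas[OF q]
  define uC where "uC \<tau> \<omega> = (cos \<tau>)\<^sup>2 * u 0 \<omega> + (sin \<tau>)\<^sup>2 * u q \<omega> + 2 * cos \<tau> * sin \<tau> * w q \<omega>" for \<tau> \<omega>
  define vC where "vC \<tau> \<omega> = (if q = 1 then (sin \<tau>)\<^sup>2 * u 0 \<omega> + (cos \<tau>)\<^sup>2 * u q \<omega> + (- 2) * cos \<tau> * sin \<tau> * w q \<omega> else u 1 \<omega>)" for \<tau> \<omega>
  define wC where "wC \<tau> \<omega> = cos \<tau> * sin \<tau> * (u 0 \<omega> + (- 1) * u q \<omega>) + (- 1) * ((cos \<tau>)\<^sup>2 + (- 1) * (sin \<tau>)\<^sup>2) * w q \<omega>" for \<tau> \<omega>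
  define f where "f \<tau> \<omega> = wC \<tau> \<omega> * uC \<tau> \<omega> ^ i * vC \<tau> \<omega> ^ j" for \<tau> \<omega>
  define D where "D \<omega> = (u 0 \<omega> - u q \<omega>) * u 0 \<omega> ^ i * u 1 \<omega> ^ j
      - 2 * real i * ((w q \<omega>)\<^sup>2 * u 0 \<omega> ^ (i - 1) * u 1 \<omega> ^ j)
      + (if q = 1 then 2 * real j * ((w q \<omega>)\<^sup>2 * u 0 \<omega> ^ i * u 1 \<omega> ^ (j - 1)) else 0)" for \<omega>
  note lips = lip_intros lip_u[OF q(2)] lip_w[OF q]
  have lv: "lipschitz_at_0 vC"
  proof (cases "q = 1")
    case True show ?thesis unfolding vC_def if_P[OF True] by (intro lips)
  next
    case False show ?thesis unfolding vC_def if_not_P[OF False] by (intro lips)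
  qed
  have mv: "vC \<tau> \<in> borel_measurable M" for \<tau>
  proof (cases "q = 1")
    case True show ?thesis unfolding vC_def if_P[OF True] by measurable
  next
    case False show ?thesis unfolding vC_def if_not_P[OF False] by measurable
  qed
  have "expectation D = 0"
  proof (rule expectation_derivative_eq_0)
    show "f \<tau> \<in> borel_measurable M" for \<tau> unfolding f_def wC_def uC_def using mv by measurable
    show "lipschitz_at_0 f" unfolding f_def wC_def uC_def by (intro lips lv)
    define F :: "real \<times> real \<times> real \<times> real \<Rightarrow> real" where "F = (\<lambda>p. fst (snd (snd p)) * fst p ^ i * snd (snd (snd p)) ^ j)"
    have "F \<in> borel_measurable borel" unfolding F_def by (intro borel_measurable_continuous_onI continuous_intros)
    moreover have "f \<tau> \<omega> = F ((cos \<tau>)\<^sup>2 * u 0 \<omega> + (sin \<tau>)\<^sup>2 * u q \<omega> + 2 * cos \<tau> * sin \<tau> * w q \<omega>,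
          (sin \<tau>)\<^sup>2 * u 0 \<omega> + (cos \<tau>)\<^sup>2 * u q \<omega> - 2 * cos \<tau> * sin \<tau> * w q \<omega>,
          cos \<tau> * sin \<tau> * (u 0 \<omega> - u q \<omega>) - ((cos \<tau>)\<^sup>2 - (sin \<tau>)\<^sup>2) * w q \<omega>,
          if q = 1 then (sin \<tau>)\<^sup>2 * u 0 \<omega> + (cos \<tau>)\<^sup>2 * u q \<omega> - 2 * cos \<tau> * sin \<tau> * w q \<omega> else u 1 \<omega>)" for \<tau> \<omega>
      by (simp add: F_def f_def uC_def vC_def wC_def algebra_simps)
    ultimately show "expectation (f \<tau>) = expectation (\<lambda>\<omega>. F (u 0 \<omega>, u q \<omega>, w q \<omega>, u 1 \<omega>))" for \<tau>
      using rotation[OF q sin_cos_squared_add2, of F \<tau>] by presburger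
    fix \<omega> assume "\<omega> \<in> space M"
    have 1: "((\<lambda>\<tau>. uC \<tau> \<omega>) has_real_derivative 2 * w q \<omega>) (at 0)"
      unfolding uC_def by (auto intro!: derivative_eq_intros)
    have 2: "((\<lambda>\<tau>. vC \<tau> \<omega>) has_real_derivative (if q = 1 then - 2 * w q \<omega> else 0)) (at 0)"
      unfolding vC_def by (cases "q = 1") (auto intro!: derivative_eq_intros)
    have 3: "((\<lambda>\<tau>. wC \<tau> \<omega>) has_real_derivative (u 0 \<omega> - u q \<omega>)) (at 0)"
      unfolding wC_def by (auto intro!: derivative_eq_intros)
    \<comment> \<open>At angle 0 the map is not the identity but the reflection that changes the
      sign of \<open>w q\<close>.\<close>
    have 0: "uC 0 \<omega> = u 0 \<omega>" "vC 0 \<omega> = u 1 \<omega>" "wC 0 \<omega> = - w q \<omega>"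
      by (auto simp: uC_def vC_def wC_def)
    show "((\<lambda>\<tau>. f \<tau> \<omega>) has_real_derivative D \<omega>) (at 0)"
      unfolding f_def
      by (rule derivative_eq_intros 1 2 3 refl)+ (auto simp: 0 D_def power2_eq_square algebra_simps)
  qed
  moreover have "expectation D = (expectation (\<lambda>\<omega>. u 0 \<omega> ^ Suc i * u 1 \<omega> ^ j) - expectation (\<lambda>\<omega>. u 0 \<omega> ^ i * u q \<omega> * u 1 \<omega> ^ j))
      - 2 * real i * expectation (\<lambda>\<omega>. (w q \<omega>)\<^sup>2 * u 0 \<omega> ^ (i - 1) * u 1 \<omega> ^ j)
      + (if q = 1 then 2 * real j * expectation (\<lambda>\<omega>. (w q \<omega>)\<^sup>2 * u 0 \<omega> ^ i * u 1 \<omega> ^ (j - 1)) else 0)"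
  proof -
    have I: "integrable M (\<lambda>\<omega>. u 0 \<omega> ^ Suc i * u 1 \<omega> ^ j)" "integrable M (\<lambda>\<omega>. u 0 \<omega> ^ i * u q \<omega> * u 1 \<omega> ^ j)"
      "integrable M (\<lambda>\<omega>. (w q \<omega>)\<^sup>2 * u 0 \<omega> ^ (i - 1) * u 1 \<omega> ^ j)"
      "integrable M (\<lambda>\<omega>. (w q \<omega>)\<^sup>2 * u 0 \<omega> ^ i * u 1 \<omega> ^ (j - 1))"
      by (intro integrable_bounded lips; measurable)+
    have D: "D = (\<lambda>\<omega>. u 0 \<omega> ^ Suc i * u 1 \<omega> ^ j - u 0 \<omega> ^ i * u q \<omega> * u 1 \<omega> ^ j
      - 2 * real i * ((w q \<omega>)\<^sup>2 * u 0 \<omega> ^ (i - 1) * u 1 \<omega> ^ j)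
      + (if q = 1 then 2 * real j * ((w q \<omega>)\<^sup>2 * u 0 \<omega> ^ i * u 1 \<omega> ^ (j - 1)) else 0))"
      by (rule ext) (simp add: D_def algebra_simps)
    show ?thesis unfolding D using I by (cases "q = 1") simp_all
  qed
  \<comment> \<open>The truncated exponent \<open>i - 1\<close> at \<open>i = 0\<close> does no harm
    since the factor \<open>real i\<close> is then 0; likewise for \<open>j\<close> below.\<close>
  moreover have "real i * expectation (\<lambda>\<omega>. (w q \<omega>)\<^sup>2 * u 0 \<omega> ^ (i - 1) * u 1 \<omega> ^ j)
      = real i * expectation (\<lambda>\<omega>. u 0 \<omega> ^ i * u q \<omega> * u 1 \<omega> ^ j) / real \<delta>"
    using w_square[OF q, of "i - 1" j] \<delta> by (cases i) (auto simp: field_simps)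
  moreover have "real j * expectation (\<lambda>\<omega>. (w q \<omega>)\<^sup>2 * u 0 \<omega> ^ i * u 1 \<omega> ^ (j - 1))
      = real j * m (Suc i) j / real \<delta>" if "q = 1"
    using w_square[OF q, of i "j - 1"] \<delta> that unfolding m_def
    by (cases j) (auto simp: field_simps)
  ultimately show ?thesis
  proof -
    have arith: "A - B = 2 / d * (i' * B - (if b then j' * R else 0))"
      if "e = 0" "e = (A - B) - 2 * i' * P + (if b then 2 * j' * Q else 0)" "i' * P = i' * B / d" "b \<Longrightarrow> j' * Q = j' * R / d"
      for e A B i' P j' Q R d :: real and b
    proof -
      have "A - B = 2 * (i' * P) - (if b then 2 * (j' * Q) else 0)" using that(1,2) by (auto split: if_splits)
      thus ?thesis using that(4) unfolding that(3) by (auto simp: algebra_simps diff_divide_distrib)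
    qed
    show ?thesis by (rule arith) fact+
  qed
qed

definition "a = real \<delta> / 2"
definition "c = real N * a"

lemma a_pos: "a > 0" using \<delta> by (simp add: a_def)
lemma c_pos: "c > 0" using a_pos N by (simp add: c_def)

lemma m_swap: "(a + real i) * m i (Suc j) = (a + real j) * m (Suc i) j"
proof -
  have "expectation (\<lambda>\<omega>. u 0 \<omega> ^ i * u 1 \<omega> * u 1 \<omega> ^ j) = m i (Suc j)"
    by (simp add: m_def mult_ac)
  hence "m (Suc i) j - m i (Suc j) = 2 / real \<delta> * (real i * m i (Suc j) - real j * m (Suc i) j)"
    using rotation_derivative[of 1 i j] N unfolding m_def[of "Suc i" j, symmetric] by simp
  thus ?thesis using \<delta> by (simp add: a_def field_simps)
qed

lemma m_other:
  assumes "q \<ge> 2" "q < N"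
  shows "(a + real i) * expectation (\<lambda>\<omega>. u 0 \<omega> ^ i * u q \<omega> * u 1 \<omega> ^ j) = a * m (Suc i) j"
proof -
  have "m (Suc i) j - expectation (\<lambda>\<omega>. u 0 \<omega> ^ i * u q \<omega> * u 1 \<omega> ^ j) =
      2 / real \<delta> * (real i * expectation (\<lambda>\<omega>. u 0 \<omega> ^ i * u q \<omega> * u 1 \<omega> ^ j))"
    using rotation_derivative[of q i j] assms unfolding m_def by simp
  thus ?thesis using \<delta> by (simp add: a_def field_simps)
qed

text \<open>Inserting the sum 1 of all diagonal entries closes the recursion. After multiplication
  by \<open>a + i\<close>, the entries 0 and 1 contribute \<open>a + i\<close> and
  \<open>a + j\<close> times \<open>m (Suc i) j\<close>, each of the other \<open>N - 2\<close>
  contributes \<open>a\<close> times it, and the total is \<open>c + i + j\<close>.\<close>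

lemma m_Suc_left: "(c + real (i + j)) * m (Suc i) j = (a + real i) * m i j"
proof -
  let ?e = "\<lambda>q. expectation (\<lambda>\<omega>. u 0 \<omega> ^ i * u q \<omega> * u 1 \<omega> ^ j)"
  have "m i j = expectation (\<lambda>\<omega>. \<Sum>q<N. u 0 \<omega> ^ i * u q \<omega> * u 1 \<omega> ^ j)"
    unfolding m_def
    by (rule Bochner_Integration.integral_cong) (simp_all add: u_sum mult_ac flip: sum_distrib_left sum_distrib_right)
  also have "\<dots> = (\<Sum>q<N. ?e q)"
    by (rule Bochner_Integration.integral_sum) (intro integrable_bounded lip_intros lip_u; measurable; auto)
  also have "{..<N} = {0, 1} \<union> {2..<N}" using N by auto
  also have "(\<Sum>q\<in>{0, 1} \<union> {2..<N}. ?e q) = (\<Sum>q\<in>{0,1}. ?e q) + (\<Sum>q\<in>{2..<N}. ?e q)"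
    by (rule sum.union_disjoint) auto
  also have "(\<Sum>q\<in>{0,1}. ?e q) = m (Suc i) j + m i (Suc j)"
    by (simp add: m_def mult_ac)
  finally have "(a + real i) * m i j = (a + real i) * m (Suc i) j + (a + real i) * m i (Suc j) + (\<Sum>q\<in>{2..<N}. (a + real i) * ?e q)"
    by (simp add: algebra_simps sum_distrib_left)
  also have "(\<Sum>q\<in>{2..<N}. (a + real i) * ?e q) = (\<Sum>q\<in>{2..<N}. a * m (Suc i) j)"
    by (intro sum.cong refl m_other) auto
  also have "\<dots> = (real N - 2) * a * m (Suc i) j" using N by (simp add: of_nat_diff)
  finally show ?thesis unfolding m_swap by (simp add: c_def algebra_simps)
qed

lemma m_Suc_right: "(c + real (i + j)) * m i (Suc j) = (a + real j) * m i j"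
proof -
  have "(a + real i) * ((c + real (i + j)) * m i (Suc j)) = (a + real j) * ((c + real (i + j)) * m (Suc i) j)"
    using m_swap[of i j] by (simp add: mult.left_commute)
  also have "\<dots> = (a + real i) * ((a + real j) * m i j)"
    unfolding m_Suc_left by simp
  finally show ?thesis using a_pos by simp
qed

lemma m_eq: "m i j = pochhammer a i * pochhammer a j / pochhammer c (i + j)"
proof -
  have pc: "pochhammer c n > 0" for n using c_pos by (rule pochhammer_pos)
  have m0: "m i 0 = pochhammer a i / pochhammer c i" for i
  proof (induction i)
    case 0 show ?case by (simp add: m_def prob_space)
  next
    case (Suc i)
    have "(c + real i) * m (Suc i) 0 = (a + real i) * m i 0" using m_Suc_left[of i 0] by simp
    moreover have "c + real i > 0" using c_pos by simp
    ultimately have "m (Suc i) 0 = (a + real i) / (c + real i) * m i 0" by (simp add: field_simps)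
    thus ?case by (simp add: Suc pochhammer_Suc mult.commute)
  qed
  show ?thesis
  proof (induction j)
    case 0 show ?case by (simp add: m0)
  next
    case (Suc j)
    have "c + real (i + j) > 0" using c_pos by simp
    hence "m i (Suc j) = (a + real j) / (c + real (i + j)) * m i j"
      using m_Suc_right[of i j] by (simp add: field_simps del: of_nat_add)
    thus ?case by (simp add: Suc pochhammer_Suc mult_ac)
  qed
qed

text \<open>In homogeneous coordinates \<open>x u_0 + t\<close> is a quadratic form in the first two
  of them, with matrix entries \<open>x + s\<close>, \<open>1 - s\<close> and off-diagonal
  \<open>sqrt (s (1 - s))\<close>. Its power \<open>k\<close> packs all mixed moments of total
  degree \<open>k\<close> into one polynomial in \<open>x\<close>.\<close>

lemma joint_moment:
  fixes s :: real
  assumes s: "0 \<le> s" "s \<le> 1"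
  defines "t \<equiv> (\<lambda>\<omega>. s * u 0 \<omega> + (1 - s) * u 1 \<omega> + 2 * sqrt (s * (1 - s)) * w 1 \<omega>)"
  shows "expectation (\<lambda>\<omega>. u 0 \<omega> ^ i * t \<omega> ^ j) = jmoment a c s i j"
proof -
  define k where "k = i + j"
  have pc: "pochhammer c n > 0" for n using c_pos by (rule pochhammer_pos)
  have t_meas [measurable]: "t \<in> borel_measurable M" unfolding t_def by measurable
  have lt: "lipschitz_at_0 (\<lambda>_. t)" unfolding t_def using N by (intro lip_intros lip_w) auto
  have main: "expectation (\<lambda>\<omega>. (x * u 0 \<omega> + t \<omega>) ^ k) =
      (\<Sum>i\<le>k. (real (k choose i) * jmoment a c s i (k - i)) * x ^ i)" for x
  proof -
    define b where "b = sqrt (s * (1 - s))"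
    have b2: "b\<^sup>2 = s * (1 - s)" using s by (simp add: b_def)
    \<comment> \<open>Polar form of half the difference of the diagonal entries and of the
      off-diagonal entry: the eigenvalues are \<open>(x + 1) / 2\<close> plus and minus
      \<open>R\<close>, and the angle \<open>\<phi> / 2\<close> diagonalises the form.\<close>
    obtain R \<phi> where R: "(x + s - (1 - s)) / 2 = R * cos \<phi>" "b = R * sin \<phi>" using polar_Ex by blast
    define l where "l = (x + 1) / 2 + R"
    define l' where "l' = (x + 1) / 2 - R"
    define C where "C = cos (\<phi> / 2)"
    define S where "S = sin (\<phi> / 2)"
    have CS: "C\<^sup>2 + S\<^sup>2 = 1" by (simp add: C_def S_def)
    have cd: "cos \<phi> = C\<^sup>2 - S\<^sup>2" "sin \<phi> = 2 * S * C"
      using cos_double[of "\<phi> / 2"] sin_double[of "\<phi> / 2"] by (simp_all add: C_def S_def)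
    have R2: "R\<^sup>2 = ((x + s - (1 - s)) / 2)\<^sup>2 + b\<^sup>2"
    proof -
      have "R\<^sup>2 = R\<^sup>2 * ((cos \<phi>)\<^sup>2 + (sin \<phi>)\<^sup>2)" by simp
      thus ?thesis unfolding R power_mult_distrib distrib_left .
    qed
    have sum: "l + l' = x + 1" by (simp add: l_def l'_def)
    \<comment> \<open>The determinant. The factor 1 is the second coefficient:
      \<open>elliptic_moment_identity\<close> is used with \<open>y = 1\<close>.\<close>
    have prod: "l * l' = x * 1 * (1 - s)"
    proof -
      have "l * l' = ((x + 1) / 2)\<^sup>2 - R\<^sup>2" by (simp add: l_def l'_def power2_eq_square algebra_simps)
      also have "\<dots> = x * 1 * (1 - s)" unfolding R2 b2 by (simp add: power2_eq_square field_simps)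
      finally show ?thesis .
    qed
    have e1: "l * C\<^sup>2 + l' * S\<^sup>2 = x + s"
    proof -
      have "l * C\<^sup>2 + l' * S\<^sup>2 = (x + 1) / 2 * (C\<^sup>2 + S\<^sup>2) + R * (C\<^sup>2 - S\<^sup>2)"
        by (simp add: l_def l'_def algebra_simps add_divide_distrib)
      thus ?thesis using R(1) by (simp add: CS cd[symmetric] field_simps)
    qed
    have e2: "l * S\<^sup>2 + l' * C\<^sup>2 = 1 - s"
    proof -
      have "l * S\<^sup>2 + l' * C\<^sup>2 = (x + 1) / 2 * (C\<^sup>2 + S\<^sup>2) - R * (C\<^sup>2 - S\<^sup>2)"
        by (simp add: l_def l'_def algebra_simps add_divide_distrib)
      thus ?thesis using R(1) by (simp add: CS cd[symmetric] field_simps)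
    qed
    have e3: "C * S * (l - l') = b"
      using R(2) cd by (simp add: l_def l'_def)
    define F :: "real \<times> real \<times> real \<times> real \<Rightarrow> real" where "F = (\<lambda>p. (l * fst p + l' * fst (snd p)) ^ k)"
    have "F \<in> borel_measurable borel" unfolding F_def by (intro borel_measurable_continuous_onI continuous_intros)
    have "expectation (\<lambda>\<omega>. (l * u 0 \<omega> + l' * u 1 \<omega>) ^ k) =
       expectation (\<lambda>\<omega>. (l * (C\<^sup>2 * u 0 \<omega> + S\<^sup>2 * u 1 \<omega> + 2 * C * S * w 1 \<omega>) + l' * (S\<^sup>2 * u 0 \<omega> + C\<^sup>2 * u 1 \<omega> - 2 * C * S * w 1 \<omega>)) ^ k)"
      using rotation[OF _ _ CS \<open>F \<in> borel_measurable borel\<close>, of 1] N by (simp add: F_def)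
    also have "\<dots> = expectation (\<lambda>\<omega>. (x * u 0 \<omega> + t \<omega>) ^ k)"
    proof (rule Bochner_Integration.integral_cong[OF refl])
      fix \<omega>
      have "l * (C\<^sup>2 * u 0 \<omega> + S\<^sup>2 * u 1 \<omega> + 2 * C * S * w 1 \<omega>) + l' * (S\<^sup>2 * u 0 \<omega> + C\<^sup>2 * u 1 \<omega> - 2 * C * S * w 1 \<omega>)
         = (l * C\<^sup>2 + l' * S\<^sup>2) * u 0 \<omega> + (l * S\<^sup>2 + l' * C\<^sup>2) * u 1 \<omega> + 2 * (C * S * (l - l')) * w 1 \<omega>"
        by (simp add: algebra_simps)
      also have "\<dots> = x * u 0 \<omega> + t \<omega>" unfolding e1 e2 e3 by (simp add: t_def b_def algebra_simps)
      finally show "(l * (C\<^sup>2 * u 0 \<omega> + S\<^sup>2 * u 1 \<omega> + 2 * C * S * w 1 \<omega>) + l' * (S\<^sup>2 * u 0 \<omega> + C\<^sup>2 * u 1 \<omega> - 2 * C * S * w 1 \<omega>)) ^ k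
         = (x * u 0 \<omega> + t \<omega>) ^ k" by simp
    qed
    finally have "expectation (\<lambda>\<omega>. (x * u 0 \<omega> + t \<omega>) ^ k) = expectation (\<lambda>\<omega>. (l * u 0 \<omega> + l' * u 1 \<omega>) ^ k)" by simp
    also have "\<dots> = expectation (\<lambda>\<omega>. \<Sum>i\<le>k. real (k choose i) * l ^ i * l' ^ (k - i) * (u 0 \<omega> ^ i * u 1 \<omega> ^ (k - i)))"
      by (simp add: binomial_ring power_mult_distrib mult_ac)
    also have "\<dots> = (\<Sum>i\<le>k. real (k choose i) * l ^ i * l' ^ (k - i) * m i (k - i))"
    proof -
      have "integrable M (\<lambda>\<omega>. u 0 \<omega> ^ i * u 1 \<omega> ^ j)" for i j
        by (intro integrable_bounded lip_intros; measurable)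
      thus ?thesis unfolding m_def by simp
    qed
    also have "\<dots> = fact k / pochhammer c k * (\<Sum>i\<le>k. pochhammer a i / fact i * (pochhammer a (k - i) / fact (k - i)) * l ^ i * l' ^ (k - i))"
      unfolding sum_distrib_left by (intro sum.cong refl) (simp add: m_eq binomial_fact mult_ac)
    also have "\<dots> = (\<Sum>i\<le>k. (real (k choose i) * jmoment a c s i (k - i)) * x ^ i)"
      unfolding elliptic_moment_identity[OF a_pos sum prod]
    proof (subst sum_distrib_left, intro sum.cong refl)
      fix i assume "i \<in> {..k}"
      hence b: "real (k choose i) = fact k / (fact i * fact (k - i))" by (simp add: binomial_fact)
      show "fact k / pochhammer c k * (pochhammer a i / fact i * (pochhammer a (k - i) / fact (k - i)) *
          (\<Sum>r\<le>i. real (i choose r) * real (k - i choose r) * fact r / pochhammer a r * s ^ r) * x ^ i * 1 ^ (k - i))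
        = real (k choose i) * jmoment a c s i (k - i) * x ^ i"
        unfolding jmoment_def b using \<open>i \<in> {..k}\<close> by (simp add: mult_ac)
    qed
    finally show ?thesis .
  qed
  have "expectation (\<lambda>\<omega>. (x * u 0 \<omega> + t \<omega>) ^ k) =
      (\<Sum>i\<le>k. (real (k choose i) * expectation (\<lambda>\<omega>. u 0 \<omega> ^ i * t \<omega> ^ (k - i))) * x ^ i)" for x
  proof -
    have "expectation (\<lambda>\<omega>. (x * u 0 \<omega> + t \<omega>) ^ k) =
      expectation (\<lambda>\<omega>. \<Sum>i\<le>k. real (k choose i) * x ^ i * (u 0 \<omega> ^ i * t \<omega> ^ (k - i)))"
      by (simp add: binomial_ring power_mult_distrib mult_ac)
    also have "\<dots> = (\<Sum>i\<le>k. real (k choose i) * x ^ i * expectation (\<lambda>\<omega>. u 0 \<omega> ^ i * t \<omega> ^ (k - i)))"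
    proof -
      have "integrable M (\<lambda>\<omega>. u 0 \<omega> ^ i * t \<omega> ^ j)" for i j
        by (intro integrable_bounded lip_intros lt; measurable)
      thus ?thesis by simp
    qed
    finally show ?thesis by (simp add: mult_ac)
  qed
  hence "\<forall>x. (\<Sum>i\<le>k. (real (k choose i) * expectation (\<lambda>\<omega>. u 0 \<omega> ^ i * t \<omega> ^ (k - i))) * x ^ i)
      = (\<Sum>i\<le>k. (real (k choose i) * jmoment a c s i (k - i)) * x ^ i)"
    using main by simp
  \<comment> \<open>Both polynomials agree for every real \<open>x\<close>, hence coefficient by
    coefficient; only the one with \<open>k - i = j\<close> is kept.\<close>
  hence "\<forall>i\<le>k. real (k choose i) * expectation (\<lambda>\<omega>. u 0 \<omega> ^ i * t \<omega> ^ (k - i)) = real (k choose i) * jmoment a c s i (k - i)"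
    by (simp only: polyfun_eq_coeffs)
  moreover have "i \<le> k" "k - i = j" by (simp_all add: k_def)
  moreover have "real (k choose i) \<noteq> 0" by (simp add: k_def)
  ultimately show ?thesis by fastforce
qed

text \<open>Here \<open>u 0\<close> and \<open>t\<close> are the diagonal values of the random point
  at two points whose mutual value is \<open>s\<close>. Expanding both polynomials leaves the double
  contraction of \<open>jmoment\<close>, and its constant is what \<open>jacobi_a\<close> normalises
  away.\<close>

theorem jacobi_product_formula:
  fixes s :: real
  assumes s: "0 \<le> s" "s \<le> 1" and c1: "c > 1" and \<beta>: "\<beta> = a - 1" and \<alpha>: "\<alpha> = c - a - 1"
  defines "t \<equiv> (\<lambda>\<omega>. s * u 0 \<omega> + (1 - s) * u 1 \<omega> + 2 * sqrt (s * (1 - s)) * w 1 \<omega>)"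
  shows "(jacobi_a \<alpha> \<beta> n)\<^sup>2 * expectation (\<lambda>\<omega>. jacobiP \<alpha> \<beta> n (2 * u 0 \<omega> - 1) * jacobiP \<alpha> \<beta> n (2 * t \<omega> - 1))
    = jacobiP \<alpha> \<beta> n (2 * s - 1)"
proof -
  let ?j = "jcoeff a c n"
  have t_meas [measurable]: "t \<in> borel_measurable M" unfolding t_def by measurable
  have lt: "lipschitz_at_0 (\<lambda>_. t)" unfolding t_def using N by (intro lip_intros lip_w) auto
  have ab: "\<beta> + 1 = a" "\<alpha> + \<beta> + 2 = c" "\<beta> > -1" using \<alpha> \<beta> a_pos by auto
  have J: "jacobiP \<alpha> \<beta> n (2 * x - 1) = (\<Sum>i\<le>n. ?j i * x ^ i)" for x
    using jacobiP_jcoeff[OF ab(3)] ab by simp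
  have "expectation (\<lambda>\<omega>. jacobiP \<alpha> \<beta> n (2 * u 0 \<omega> - 1) * jacobiP \<alpha> \<beta> n (2 * t \<omega> - 1))
      = expectation (\<lambda>\<omega>. \<Sum>i\<le>n. \<Sum>j\<le>n. ?j i * ?j j * (u 0 \<omega> ^ i * t \<omega> ^ j))"
    unfolding J sum_product by (simp add: mult_ac)
  also have "\<dots> = (\<Sum>i\<le>n. \<Sum>j\<le>n. ?j i * ?j j * expectation (\<lambda>\<omega>. u 0 \<omega> ^ i * t \<omega> ^ j))"
  proof -
    have "integrable M (\<lambda>\<omega>. u 0 \<omega> ^ i * t \<omega> ^ j)" for i j
      by (intro integrable_bounded lip_intros lt; measurable)
    thus ?thesis by simp
  qed
  also have "\<dots> = (\<Sum>i\<le>n. \<Sum>j\<le>n. ?j i * ?j j * jmoment a c s i j)"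
    unfolding t_def joint_moment[OF s] ..
  also have "\<dots> = pochhammer (real n + c - 1) n * pochhammer a n / pochhammer c (2 * n) * jacobiP \<alpha> \<beta> n (2 * s - 1)"
    unfolding jcoeff_jmoment_double[OF a_pos c_pos] J ..
  finally have "(jacobi_a \<alpha> \<beta> n)\<^sup>2 * expectation (\<lambda>\<omega>. jacobiP \<alpha> \<beta> n (2 * u 0 \<omega> - 1) * jacobiP \<alpha> \<beta> n (2 * t \<omega> - 1)) =
      (jacobi_a \<alpha> \<beta> n)\<^sup>2 * (pochhammer (real n + c - 1) n * pochhammer a n / pochhammer c (2 * n)) * jacobiP \<alpha> \<beta> n (2 * s - 1)"
    by (simp only: mult.assoc)
  thus ?thesis
    unfolding jacobi_a_square(1)[OF a_pos c1 \<beta> \<alpha>, of n] by simp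
qed

end

definition cd_elem :: "nat \<Rightarrow> (nat \<Rightarrow> real) \<Rightarrow> bool" where
  "cd_elem k x \<longleftrightarrow> (\<forall>c \<ge> 2 ^ k. x c = 0)"

section \<open>Cayley-Dickson algebras\<close>

definition cd_inner :: "nat \<Rightarrow> (nat \<Rightarrow> real) \<Rightarrow> (nat \<Rightarrow> real) \<Rightarrow> real" where
  "cd_inner k x y = (\<Sum>c<2 ^ k. x c * y c)"

definition cd_unit :: "nat \<Rightarrow> nat \<Rightarrow> real" where
  "cd_unit c = (\<lambda>i. if i = c then 1 else 0)"

lemma cd_elem_mult [simp, intro]: "cd_elem k (cd_mult k x y)"
  by (cases k) (auto simp: cd_elem_def Let_def)

lemma cd_conj_alt: "cd_elem k x \<Longrightarrow> cd_conj k x = (\<lambda>i. 2 * x 0 * cd_unit 0 i - x i)"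
  by (rule ext) (auto simp: cd_conj_def cd_elem_def cd_unit_def)

lemma cd_conj_add: "cd_conj k (\<lambda>i. x i + y i) = (\<lambda>i. cd_conj k x i + cd_conj k y i)"
  by (rule ext) (simp add: cd_conj_def)

lemma cd_conj_scale: "cd_conj k (\<lambda>i. r * x i) = (\<lambda>i. r * cd_conj k x i)"
  by (rule ext) (simp add: cd_conj_def)

lemma cd_mult_add:
  "cd_mult k (\<lambda>i. x i + y i) z = (\<lambda>i. cd_mult k x z i + cd_mult k y z i)"
  "cd_mult k z (\<lambda>i. x i + y i) = (\<lambda>i. cd_mult k z x i + cd_mult k z y i)"
proof (induction k arbitrary: x y z)
  case 0
  { case 1 show ?case by (rule ext) (simp add: algebra_simps) }
  { case 2 show ?case by (rule ext) (simp add: algebra_simps) }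
next
  case (Suc k)
  have s: "(\<lambda>i. if i < h then p i + q i else 0) = (\<lambda>i. (if i < h then p i else 0) + (if i < h then q i else 0))"
    for h :: nat and p q :: "nat \<Rightarrow> real" by auto
  { case 1 show ?case by (rule ext) (simp add: Let_def s cd_conj_add Suc algebra_simps) }
  { case 2 show ?case by (rule ext) (simp add: Let_def s cd_conj_add Suc algebra_simps) }
qed

lemma cd_mult_scale:
  "cd_mult k (\<lambda>i. r * x i) z = (\<lambda>i. r * cd_mult k x z i)"
  "cd_mult k z (\<lambda>i. r * x i) = (\<lambda>i. r * cd_mult k z x i)"
proof (induction k arbitrary: x z)
  case 0
  { case 1 show ?case by (rule ext) (simp add: algebra_simps) }
  { case 2 show ?case by (rule ext) (simp add: algebra_simps) }
next
  case (Suc k)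
  have s: "(\<lambda>i. if i < h then r * p i else 0) = (\<lambda>i. r * (if i < h then p i else 0))"
    for h :: nat and p :: "nat \<Rightarrow> real" by auto
  { case 1 show ?case by (rule ext) (simp add: Let_def s cd_conj_scale Suc algebra_simps) }
  { case 2 show ?case by (rule ext) (simp add: Let_def s cd_conj_scale Suc algebra_simps) }
qed

lemma cd_mult_zero: "cd_mult k (\<lambda>i. 0) z = (\<lambda>i. 0)" "cd_mult k z (\<lambda>i. 0) = (\<lambda>i. 0)"
  using cd_mult_scale(1)[of k 0 z z] cd_mult_scale(2)[of k z 0 z] by simp_all

lemma cd_mult_diff:
  "cd_mult k (\<lambda>i. x i - y i) z = (\<lambda>i. cd_mult k x z i - cd_mult k y z i)"
  "cd_mult k z (\<lambda>i. x i - y i) = (\<lambda>i. cd_mult k z x i - cd_mult k z y i)"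
  using cd_mult_add(1)[of k x "\<lambda>i. (-1) * y i" z] cd_mult_scale(1)[of k "-1" y z]
    cd_mult_add(2)[of k z x "\<lambda>i. (-1) * y i"] cd_mult_scale(2)[of k z "-1" y] by simp_all

lemma cd_mult_sum:
  "finite A \<Longrightarrow> cd_mult k (\<lambda>i. \<Sum>l\<in>A. f l i) z = (\<lambda>i. \<Sum>l\<in>A. cd_mult k (f l) z i)"
  "finite A \<Longrightarrow> cd_mult k z (\<lambda>i. \<Sum>l\<in>A. f l i) = (\<lambda>i. \<Sum>l\<in>A. cd_mult k z (f l) i)"
  by (induction A rule: finite_induct) (simp_all add: cd_mult_zero cd_mult_add)

lemma cd_mult_one:
  "cd_elem k x \<Longrightarrow> cd_mult k (cd_unit 0) x = x"
  "cd_elem k x \<Longrightarrow> cd_mult k x (cd_unit 0) = x"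
proof (induction k arbitrary: x)
  case 0
  { case 1 thus ?case by (auto simp: cd_elem_def cd_unit_def fun_eq_iff) }
  { case 2 thus ?case by (auto simp: cd_elem_def cd_unit_def fun_eq_iff) }
next
  case (Suc k)
  have u: "(\<lambda>i. if i < 2 ^ k then cd_unit 0 i else 0) = cd_unit 0"
    "(\<lambda>i. if i < 2 ^ k then cd_unit 0 (i + 2 ^ k) else 0) = (\<lambda>i. 0)" "cd_conj k (cd_unit 0) = cd_unit 0"
    "cd_conj k (\<lambda>i. 0) = (\<lambda>i. 0)"
    by (auto simp: cd_unit_def cd_conj_def fun_eq_iff)
  have e: "cd_elem k (\<lambda>i. if i < 2 ^ k then y i else 0)" for y by (auto simp: cd_elem_def)
  { case 1 thus ?case
      by (auto simp: Let_def u cd_mult_zero Suc.IH e cd_elem_def fun_eq_iff) }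
  { case 2 thus ?case
      by (auto simp: Let_def u cd_mult_zero Suc.IH e cd_elem_def fun_eq_iff) }
qed

lemma cd_mult_1: "cd_mult (Suc 0) x y = (\<lambda>i. if i = 0 then x 0 * y 0 - x 1 * y 1 else if i = 1 then x 0 * y 1 + x 1 * y 0 else 0)"
  by (auto simp: fun_eq_iff Let_def cd_conj_def)

lemma cd_mult_2: "cd_mult (Suc (Suc 0)) x y = (\<lambda>i. 
    if i = 0 then x 0 * y 0 - x 1 * y 1 - x 2 * y 2 - x 3 * y 3
    else if i = 1 then x 0 * y 1 + x 1 * y 0 + x 2 * y 3 - x 3 * y 2
    else if i = 2 then x 0 * y 2 - x 1 * y 3 + x 2 * y 0 + x 3 * y 1
    else if i = 3 then x 0 * y 3 + x 1 * y 2 - x 2 * y 1 + x 3 * y 0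
    else 0)"
  by (subst cd_mult.simps, unfold cd_mult_1) (auto simp: fun_eq_iff Let_def cd_conj_def eval_nat_numeral)

lemma cd_mult_assoc:
  assumes "k \<le> 2"
  shows "cd_mult k (cd_mult k x y) z = cd_mult k x (cd_mult k y z)"
proof -
  consider "k = 0" | "k = Suc 0" | "k = Suc (Suc 0)" using assms by linarith
  thus ?thesis
    by cases (simp_all add: cd_mult_1 cd_mult_2 fun_eq_iff algebra_simps del: cd_mult.simps(2))
qed

lemma cd_mult_3: "cd_mult (Suc (Suc (Suc 0))) x y = (\<lambda>i.
    if i = 0 then x 0 * y 0 - x 1 * y 1 - x 2 * y 2 - x 3 * y 3 - x 4 * y 4 - x 5 * y 5 - x 6 * y 6 - x 7 * y 7
    else if i = 1 then x 0 * y 1 + x 1 * y 0 + x 2 * y 3 - x 3 * y 2 + x 4 * y 5 - x 5 * y 4 - x 6 * y 7 + x 7 * y 6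
    else if i = 2 then x 0 * y 2 - x 1 * y 3 + x 2 * y 0 + x 3 * y 1 + x 4 * y 6 + x 5 * y 7 - x 6 * y 4 - x 7 * y 5
    else if i = 3 then x 0 * y 3 + x 1 * y 2 - x 2 * y 1 + x 3 * y 0 + x 4 * y 7 - x 5 * y 6 + x 6 * y 5 - x 7 * y 4
    else if i = 4 then x 0 * y 4 - x 1 * y 5 - x 2 * y 6 - x 3 * y 7 + x 4 * y 0 + x 5 * y 1 + x 6 * y 2 + x 7 * y 3
    else if i = 5 then x 0 * y 5 + x 1 * y 4 - x 2 * y 7 + x 3 * y 6 - x 4 * y 1 + x 5 * y 0 - x 6 * y 3 + x 7 * y 2
    else if i = 6 then x 0 * y 6 + x 1 * y 7 + x 2 * y 4 - x 3 * y 5 - x 4 * y 2 + x 5 * y 3 + x 6 * y 0 - x 7 * y 1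
    else if i = 7 then x 0 * y 7 - x 1 * y 6 + x 2 * y 5 + x 3 * y 4 - x 4 * y 3 - x 5 * y 2 + x 6 * y 1 + x 7 * y 0
    else 0)"
  by (subst cd_mult.simps, unfold cd_mult_2) (auto simp: fun_eq_iff Let_def cd_conj_def eval_nat_numeral)

text \<open>A polynomial identity in the coordinates, checked on the multiplication tables: the
  product identities for sums of one, two, four and eight squares.\<close>

lemma cd_inner_mult_self:
  assumes "k \<le> 3"
  shows "cd_inner k (cd_mult k x y) (cd_mult k x y) = cd_inner k x x * cd_inner k y y"
proof -
  have r: "{..<(2::nat) ^ 0} = {0}" "{..<(2::nat)} = {0, 1}" "{..<(2::nat) ^ Suc 0} = {0, 1}" "{..<(2::nat) ^ Suc (Suc 0)} = {0, 1, 2, 3}"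
    "{..<(2::nat) ^ Suc (Suc (Suc 0))} = {0, 1, 2, 3, 4, 5, 6, 7}"
    by auto
  consider "k = 0" | "k = Suc 0" | "k = Suc (Suc 0)" | "k = Suc (Suc (Suc 0))" using assms by linarith
  thus ?thesis
    by cases (simp_all add: cd_mult_1 cd_mult_2 cd_mult_3 cd_inner_def r algebra_simps del: cd_mult.simps(2) power_Suc)
qed

lemma cd_inner_commute: "cd_inner k x y = cd_inner k y x"
  by (simp add: cd_inner_def mult.commute)

lemma cd_inner_add:
  "cd_inner k (\<lambda>i. x i + y i) z = cd_inner k x z + cd_inner k y z"
  "cd_inner k z (\<lambda>i. x i + y i) = cd_inner k z x + cd_inner k z y"
  by (simp_all add: cd_inner_def algebra_simps sum.distrib)

lemma cd_inner_diff:
  "cd_inner k (\<lambda>i. x i - y i) z = cd_inner k x z - cd_inner k y z"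
  "cd_inner k z (\<lambda>i. x i - y i) = cd_inner k z x - cd_inner k z y"
  by (simp_all add: cd_inner_def algebra_simps sum_subtractf)

lemma cd_inner_scale:
  "cd_inner k (\<lambda>i. r * x i) z = r * cd_inner k x z"
  "cd_inner k z (\<lambda>i. r * x i) = r * cd_inner k z x"
  by (simp_all add: cd_inner_def sum_distrib_left mult_ac)

lemma cd_inner_unit: "c < 2 ^ k \<Longrightarrow> cd_inner k x (cd_unit c) = x c"
  "c < 2 ^ k \<Longrightarrow> cd_inner k (cd_unit c) x = x c"
  by (simp_all add: cd_inner_def cd_unit_def if_distrib[of "\<lambda>r. _ * r"] if_distrib[of "\<lambda>r. r * _"] cong: if_cong)

lemma cd_inner_nonneg: "cd_inner k x x \<ge> 0"
  by (simp add: cd_inner_def sum_nonneg)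

lemma cd_inner_self_eq_0: "cd_elem k x \<Longrightarrow> cd_inner k x x = 0 \<Longrightarrow> x = (\<lambda>i. 0)"
  by (rule ext) (auto simp: cd_inner_def cd_elem_def sum_nonneg_eq_0_iff, metis lessThan_iff not_le_imp_less)

lemma cd_elem_arith [intro]:
  "cd_elem k x \<Longrightarrow> cd_elem k y \<Longrightarrow> cd_elem k (\<lambda>i. x i + y i)"
  "cd_elem k x \<Longrightarrow> cd_elem k y \<Longrightarrow> cd_elem k (\<lambda>i. x i - y i)"
  "cd_elem k x \<Longrightarrow> cd_elem k (\<lambda>i. r * x i)"
  "c < 2 ^ k \<Longrightarrow> cd_elem k (cd_unit c)"
  by (auto simp: cd_elem_def cd_unit_def)

lemma cd_elem_conj [simp, intro]: "cd_elem k (cd_conj k x)"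
  by (auto simp: cd_elem_def cd_conj_def)

lemma cd_eqI:
  assumes "cd_elem k x" "cd_elem k y" "\<And>z. cd_elem k z \<Longrightarrow> cd_inner k x z = cd_inner k y z"
  shows "x = y"
proof
  fix c
  show "x c = y c"
  proof (cases "c < 2 ^ k")
    case True
    have "cd_elem k (cd_unit c)" using True by (rule cd_elem_arith)
    from assms(3)[OF this] show ?thesis using True by (simp add: cd_inner_unit)
  next
    case False thus ?thesis using assms by (simp add: cd_elem_def)
  qed
qed

lemma cd_conj_conj: "cd_elem k x \<Longrightarrow> cd_conj k (cd_conj k x) = x"
  by (rule ext) (auto simp: cd_conj_def cd_elem_def)

lemma cd_conj_0 [simp]: "cd_conj k x 0 = x 0"
  by (simp add: cd_conj_def)

lemma cd_inner_conj: "cd_inner k (cd_conj k x) (cd_conj k y) = cd_inner k x y"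
  unfolding cd_inner_def by (rule sum.cong) (auto simp: cd_conj_def)

lemma cd_inner_conj_left: "cd_inner k (cd_conj k x) y = cd_inner k x (cd_conj k y)"
  unfolding cd_inner_def by (rule sum.cong) (auto simp: cd_conj_def)

lemma cd_conj_diff: "cd_conj k (\<lambda>i. x i - y i) = (\<lambda>i. cd_conj k x i - cd_conj k y i)"
  by (rule ext) (simp add: cd_conj_def)

text \<open>For a unit \<open>u\<close> this is the product \<open>u p u\<close>.\<close>

definition cd_sandwich :: "nat \<Rightarrow> (nat \<Rightarrow> real) \<Rightarrow> (nat \<Rightarrow> real) \<Rightarrow> nat \<Rightarrow> real" where
  "cd_sandwich k u p = (\<lambda>i. 2 * cd_inner k p (cd_conj k u) * u i - cd_conj k p i)"

text \<open>Everything below uses only that the norm is multiplicative, so it applies to the octonions.\<close>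

context
  fixes k :: nat
  assumes k: "k \<le> 3"
begin

lemma cd_inner_mult_left: "cd_inner k (cd_mult k x y) (cd_mult k x z) = cd_inner k x x * cd_inner k y z"
  using cd_inner_mult_self[OF k, of x "\<lambda>i. y i + z i"] cd_inner_mult_self[OF k, of x y] cd_inner_mult_self[OF k, of x z]
  by (simp add: cd_mult_add cd_inner_add algebra_simps cd_inner_commute[of k z y]
      cd_inner_commute[of k "cd_mult k x z" "cd_mult k x y"])

lemma cd_inner_mult_right: "cd_inner k (cd_mult k x y) (cd_mult k z y) = cd_inner k x z * cd_inner k y y"
  using cd_inner_mult_self[OF k, of "\<lambda>i. x i + z i" y] cd_inner_mult_self[OF k, of x y] cd_inner_mult_self[OF k, of z y]
  by (simp add: cd_mult_add cd_inner_add algebra_simps cd_inner_commute[of k z x]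
      cd_inner_commute[of k "cd_mult k z y" "cd_mult k x y"])

text \<open>The composition law polarised in both factors. Setting one argument to the unit makes
  conjugation appear and yields the adjoints of the left and right multiplications.\<close>

lemma cd_inner_exchange:
  "cd_inner k (cd_mult k x y) (cd_mult k z w) + cd_inner k (cd_mult k z y) (cd_mult k x w)
     = 2 * cd_inner k x z * cd_inner k y w"
  using cd_inner_mult_right[of x "\<lambda>i. y i + w i" z] cd_inner_mult_right[of x y z] cd_inner_mult_right[of x w z]
  by (simp add: cd_mult_add cd_inner_add algebra_simps cd_inner_commute[of k w y]
      cd_inner_commute[of k "cd_mult k x w" "cd_mult k z y"])

lemma cd_inner_mult_adjoint_left:
  assumes "cd_elem k x" "cd_elem k y" "cd_elem k z"
  shows "cd_inner k (cd_mult k x y) z = cd_inner k y (cd_mult k (cd_conj k x) z)"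
  using cd_inner_exchange[of x y "cd_unit 0" z] assms
  by (simp add: cd_mult_one cd_conj_alt cd_mult_diff cd_inner_diff cd_mult_scale cd_inner_scale cd_inner_unit)

lemma cd_inner_mult_adjoint_right:
  assumes "cd_elem k x" "cd_elem k y" "cd_elem k z"
  shows "cd_inner k (cd_mult k x y) z = cd_inner k x (cd_mult k z (cd_conj k y))"
proof -
  have "cd_mult k z (cd_conj k y) = (\<lambda>i. (2 * y 0) * z i - cd_mult k z y i)"
    using assms by (simp add: cd_conj_alt cd_mult_diff cd_mult_scale cd_mult_one)
  thus ?thesis
    using cd_inner_exchange[of x y z "cd_unit 0"] assms
    by (simp only: cd_inner_diff cd_inner_scale cd_mult_one) (simp add: cd_inner_unit cd_inner_commute[of k "cd_mult k z y" x] algebra_simps)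
qed

lemma cd_conj_mult:
  assumes "cd_elem k x" "cd_elem k y"
  shows "cd_conj k (cd_mult k x y) = cd_mult k (cd_conj k y) (cd_conj k x)"
proof (rule cd_eqI)
  fix z assume z: "cd_elem k z"
  have "cd_inner k (cd_conj k (cd_mult k x y)) z = cd_inner k (cd_mult k (cd_conj k x) (cd_conj k z)) y"
    unfolding cd_inner_conj_left by (subst cd_inner_mult_adjoint_left) (use assms in \<open>auto simp: cd_inner_commute\<close>)
  also have "\<dots> = cd_inner k (cd_conj k x) (cd_mult k y z)"
    using assms z by (simp add: cd_inner_mult_adjoint_right cd_conj_conj)
  also have "\<dots> = cd_inner k (cd_mult k (cd_conj k y) (cd_conj k x)) z"
    using assms z by (simp add: cd_inner_mult_adjoint_left cd_conj_conj)
  finally show "cd_inner k (cd_conj k (cd_mult k x y)) z = cd_inner k (cd_mult k (cd_conj k y) (cd_conj k x)) z" .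
qed auto

lemma cd_conj_mult_cancel:
  assumes "cd_elem k x" "cd_elem k y"
  shows "cd_mult k (cd_conj k x) (cd_mult k x y) = (\<lambda>i. cd_inner k x x * y i)"
proof (rule cd_eqI)
  fix z assume z: "cd_elem k z"
  show "cd_inner k (cd_mult k (cd_conj k x) (cd_mult k x y)) z = cd_inner k (\<lambda>i. cd_inner k x x * y i) z"
    using assms z cd_inner_mult_left[of x y z]
    by (simp add: cd_inner_mult_adjoint_left cd_conj_conj cd_inner_scale)
qed (use assms in auto)

lemma cd_mult_conj_cancel:
  assumes "cd_elem k x" "cd_elem k y"
  shows "cd_mult k (cd_mult k y x) (cd_conj k x) = (\<lambda>i. cd_inner k x x * y i)"
proof (rule cd_eqI)
  fix z assume z: "cd_elem k z"
  show "cd_inner k (cd_mult k (cd_mult k y x) (cd_conj k x)) z = cd_inner k (\<lambda>i. cd_inner k x x * y i) z"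
    using assms z cd_inner_mult_right[of y x z]
    by (simp add: cd_inner_mult_adjoint_right cd_conj_conj cd_inner_scale)
qed (use assms in auto)

lemma cd_mult_conj_self:
  assumes "cd_elem k x"
  shows "cd_mult k x (cd_conj k x) = (\<lambda>i. cd_inner k x x * cd_unit 0 i)"
  using cd_mult_conj_cancel[OF assms, of "cd_unit 0"] assms by (simp add: cd_mult_one cd_elem_arith)

text \<open>\<open>cd_conj_mult_cancel\<close> polarised in its first argument; it replaces
  reassociation in \<open>cd_sandwich_mult\<close>.\<close>

lemma cd_conj_mult_linearized:
  assumes "cd_elem k x" "cd_elem k w" "cd_elem k y"
  shows "(\<lambda>i. cd_mult k (cd_conj k x) (cd_mult k w y) i + cd_mult k (cd_conj k w) (cd_mult k x y) i)
      = (\<lambda>i. 2 * cd_inner k x w * y i)"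
proof -
  have "cd_mult k (cd_conj k (\<lambda>i. x i + w i)) (cd_mult k (\<lambda>i. x i + w i) y) =
     (\<lambda>i. cd_inner k (\<lambda>i. x i + w i) (\<lambda>i. x i + w i) * y i)"
    using assms by (intro cd_conj_mult_cancel) auto
  thus ?thesis
    using cd_conj_mult_cancel[of x y] cd_conj_mult_cancel[of w y] assms
    by (simp add: cd_conj_add cd_mult_add cd_inner_add cd_inner_commute[of k w x] fun_eq_iff algebra_simps)
qed

lemma cd_elem_sandwich [simp, intro]: "cd_elem k u \<Longrightarrow> cd_elem k (cd_sandwich k u p)"
  by (auto simp: cd_sandwich_def)

lemma cd_sandwich_eq:
  assumes "cd_elem k u" "cd_elem k p" "cd_inner k u u = 1"
  shows "cd_mult k u (cd_mult k p u) = cd_sandwich k u p"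
proof (rule cd_eqI)
  fix z assume z: "cd_elem k z"
  have cu: "cd_mult k (cd_conj k u) u = cd_unit 0"
    using cd_conj_mult_cancel[of u "cd_unit 0"] assms by (simp add: cd_mult_one cd_elem_arith)
  have e: "cd_elem k (cd_unit 0)" by (rule cd_elem_arith) simp
  have "cd_inner k (cd_mult k u (cd_mult k p u)) z = cd_inner k (cd_mult k p u) (cd_mult k (cd_conj k u) z)"
    using assms z by (simp add: cd_inner_mult_adjoint_left)
  also have "\<dots> = 2 * cd_inner k p (cd_conj k u) * cd_inner k u z - cd_inner k (cd_unit 0) (cd_mult k p z)"
    using cd_inner_exchange[of p u "cd_conj k u" z] cu by simp
  also have "cd_inner k (cd_unit 0) (cd_mult k p z) = cd_inner k (cd_conj k p) z"
    using cd_inner_mult_adjoint_left[of "cd_conj k p" "cd_unit 0" z] assms z e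
    by (simp add: cd_conj_conj cd_mult_one)
  finally show "cd_inner k (cd_mult k u (cd_mult k p u)) z = cd_inner k (cd_sandwich k u p) z"
    by (simp add: cd_sandwich_def cd_inner_diff cd_inner_scale)
qed (use assms in auto)

text \<open>The middle Moufang identity \<open>(u p) (q u) = u (p q) u\<close>. It governs a product
  of entries whose outer indices are the two twisted ones.\<close>

lemma cd_Moufang:
  assumes u: "cd_elem k u" "cd_inner k u u = 1" and p: "cd_elem k p" and q: "cd_elem k q"
  shows "cd_mult k (cd_mult k u p) (cd_mult k q u) = cd_sandwich k u (cd_mult k p q)"
proof (rule cd_eqI)
  fix z assume z: "cd_elem k z"
  \<comment> \<open>This is the conjugate of \<open>q u\<close>, the factor that reaches
    \<open>z\<close> under the adjoint. Since \<open>u w\<close> is the conjugate of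
    \<open>q\<close>, \<open>cd_inner_exchange\<close> swaps \<open>u\<close> with
    \<open>z\<close>.\<close>
  define w where "w = cd_mult k (cd_conj k u) (cd_conj k q)"
  have w: "cd_elem k w" by (simp add: w_def)
  have uw: "cd_mult k u w = cd_conj k q"
    using cd_conj_mult_cancel[of "cd_conj k u" "cd_conj k q"] u by (simp add: w_def cd_conj_conj cd_inner_conj)
  have "cd_inner k (cd_mult k (cd_mult k u p) (cd_mult k q u)) z = cd_inner k (cd_mult k u p) (cd_mult k z w)"
    using u p q z by (simp add: cd_inner_mult_adjoint_right cd_conj_mult w_def)
  also have "\<dots> = 2 * cd_inner k u z * cd_inner k p w - cd_inner k (cd_mult k z p) (cd_conj k q)"
    using cd_inner_exchange[of u p z w] uw by simp
  also have "cd_inner k p w = cd_inner k (cd_mult k p q) (cd_conj k u)"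
    using p q u by (simp add: w_def cd_inner_mult_adjoint_right)
  also have "cd_inner k (cd_mult k z p) (cd_conj k q) = cd_inner k (cd_conj k (cd_mult k p q)) z"
    unfolding cd_conj_mult[OF p q]
    by (subst cd_inner_mult_adjoint_right) (use p q z in \<open>auto simp: cd_inner_commute\<close>)
  finally show "cd_inner k (cd_mult k (cd_mult k u p) (cd_mult k q u)) z = cd_inner k (cd_sandwich k u (cd_mult k p q)) z"
    by (simp add: cd_sandwich_def cd_inner_diff cd_inner_scale)
qed (use u in auto)

text \<open>The left Moufang identity \<open>(u p u) r = u (p (u r))\<close> at
  \<open>r = conj u q\<close>. By the formula for the sandwich it is a rearrangement of the
  linearised cancellation law.\<close>

lemma cd_sandwich_mult:
  assumes u: "cd_elem k u" "cd_inner k u u = 1" and p: "cd_elem k p" and q: "cd_elem k q"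
  shows "cd_mult k (cd_sandwich k u p) (cd_mult k (cd_conj k u) q) = cd_mult k u (cd_mult k p q)"
proof -
  have 1: "cd_mult k u (cd_mult k (cd_conj k u) q) = q"
    using cd_conj_mult_cancel[of "cd_conj k u" q] u q by (simp add: cd_conj_conj cd_inner_conj)
  have "(\<lambda>i. cd_mult k (cd_conj k p) (cd_mult k (cd_conj k u) q) i + cd_mult k u (cd_mult k p q) i)
      = (\<lambda>i. 2 * cd_inner k p (cd_conj k u) * q i)"
    using cd_conj_mult_linearized[of p "cd_conj k u" q] u p q by (simp add: cd_conj_conj)
  thus ?thesis
    unfolding cd_sandwich_def cd_mult_diff cd_mult_scale 1 by (simp add: fun_eq_iff algebra_simps)
qed

lemma cd_conj_sandwich:
  assumes "cd_elem k u" "cd_elem k p"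
  shows "cd_conj k (cd_sandwich k u p) = cd_sandwich k (cd_conj k u) (cd_conj k p)"
  unfolding cd_sandwich_def cd_inner_conj cd_conj_diff cd_conj_scale ..

lemma cd_sandwich_cancel:
  assumes "cd_elem k u" "cd_inner k u u = 1" "cd_elem k p"
  shows "cd_sandwich k (cd_conj k u) (cd_sandwich k u p) = p"
proof -
  have "cd_inner k (cd_sandwich k u p) u = cd_inner k p (cd_conj k u)"
    using assms by (simp add: cd_sandwich_def cd_inner_diff cd_inner_scale cd_inner_conj_left)
  thus ?thesis
    using assms cd_conj_sandwich[of u p]
    by (simp add: cd_sandwich_def[of k "cd_conj k u" "cd_sandwich k u p"] cd_conj_conj)
       (simp add: cd_sandwich_def cd_inner_conj cd_conj_conj cd_inner_conj_left fun_eq_iff)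
qed

lemma cd_inner_sandwich:
  assumes "cd_elem k u" "cd_inner k u u = 1" "cd_elem k p" "cd_elem k q"
  shows "cd_inner k (cd_sandwich k u p) (cd_sandwich k u q) = cd_inner k p q"
  using assms by (simp flip: cd_sandwich_eq add: cd_inner_mult_left cd_inner_mult_right)

end

lemma cd_inner_sum:
  "cd_inner k (\<lambda>c. \<Sum>l\<in>A. f l c) z = (\<Sum>l\<in>A. cd_inner k (f l) z)"
  "cd_inner k z (\<lambda>c. \<Sum>l\<in>A. f l c) = (\<Sum>l\<in>A. cd_inner k z (f l))"
  unfolding cd_inner_def sum_distrib_right sum_distrib_left by (rule sum.swap)+

section \<open>Two-point homogeneity of projective spaces\<close>

text \<open>Three coordinates ensure that any two indices leave another one for the compensating
  phase. Over the octonions \<open>N = 3\<close>, so that no triple of distinct indices can avoid a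
  twisted one.\<close>

locale cd_projective =
  fixes k N :: nat
  assumes k: "k \<le> 3" and N: "N \<ge> 3" and assoc: "k \<le> 2 \<or> N = 3"
begin

lemma proj_supported: "P \<in> proj_pts k N \<Longrightarrow> supported k N P"
  unfolding proj_pts_def by blast

lemma proj_elem: "P \<in> proj_pts k N \<Longrightarrow> cd_elem k (P a b)"
  using proj_supported by (auto simp: supported_def cd_elem_def)

lemma proj_zero: "P \<in> proj_pts k N \<Longrightarrow> a \<ge> N \<or> b \<ge> N \<Longrightarrow> P a b = (\<lambda>c. 0)"
  using proj_supported by (auto simp: supported_def)

lemma proj_conj: "P \<in> proj_pts k N \<Longrightarrow> cd_conj k (P a b) = P b a"
  unfolding proj_pts_def mem_Collect_eq by metis

lemma proj_trace: "P \<in> proj_pts k N \<Longrightarrow> (\<Sum>a<N. P a a 0) = 1"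
  unfolding proj_pts_def by blast

lemma proj_idem: "P \<in> proj_pts k N \<Longrightarrow> (\<lambda>c. \<Sum>l<N. cd_mult k (P a l) (P l b) c) = P a b"
  unfolding proj_pts_def by blast

lemma hermitian_diag:
  assumes "\<And>a b. P b a = cd_conj k (P a b)"
  shows "P a a = (\<lambda>c. P a a 0 * cd_unit 0 c)"
proof
  fix c
  have "P a a c = cd_conj k (P a a) c" by (rule fun_cong[OF assms])
  thus "P a a c = P a a 0 * cd_unit 0 c" by (auto simp: cd_conj_def cd_unit_def split: if_splits)
qed

lemma proj_diag: "P \<in> proj_pts k N \<Longrightarrow> P a a = (\<lambda>c. P a a 0 * cd_unit 0 c)"
  by (rule hermitian_diag) (simp add: proj_conj)

lemma proj_norm_swap: "P \<in> proj_pts k N \<Longrightarrow> cd_inner k (P b a) (P b a) = cd_inner k (P a b) (P a b)"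
  by (metis proj_conj cd_inner_conj)

lemma proj_diag_eq_sum:
  assumes P: "P \<in> proj_pts k N"
  shows "P a a 0 = (\<Sum>l<N. cd_inner k (P a l) (P a l))"
proof -
  have "P a a 0 = (\<Sum>l<N. cd_mult k (P a l) (P l a) 0)"
    using fun_cong[OF proj_idem[OF P, of a a], of 0] by simp
  also have "\<dots> = (\<Sum>l<N. cd_inner k (P a l) (P a l))"
    using cd_mult_conj_self[OF k proj_elem[OF P]] proj_conj[OF P]
    by (intro sum.cong refl) (metis cd_unit_def mult.right_neutral)
  finally show ?thesis .
qed

lemma proj_diag_nonneg: "P \<in> proj_pts k N \<Longrightarrow> P a a 0 \<ge> 0"
  by (simp add: proj_diag_eq_sum sum_nonneg cd_inner_nonneg)

lemma proj_diag_le_1: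
  assumes P: "P \<in> proj_pts k N"
  shows "P a a 0 \<le> 1"
proof (cases "a < N")
  case True
  have "P a a 0 \<le> (\<Sum>a<N. P a a 0)"
    using True proj_diag_nonneg[OF P] by (intro member_le_sum) auto
  thus ?thesis using proj_trace[OF P] by simp
qed (use proj_zero[OF P] in simp)

text \<open>The summands are the squared 2 by 2 minors through the index \<open>b\<close>. In the
  expansion the norm of a product splits, and the adjoint of right multiplication turns the cross
  terms into an entry of \<open>P P = P\<close> without reassociating three factors.\<close>

lemma proj_defect:
  assumes P: "P \<in> proj_pts k N"
  shows "(\<Sum>m<N. cd_inner k (\<lambda>c. P b b 0 * P a m c - cd_mult k (P a b) (P b m) c)
                      (\<lambda>c. P b b 0 * P a m c - cd_mult k (P a b) (P b m) c))
       = P b b 0 * (P a a 0 * P b b 0 - cd_inner k (P a b) (P a b))"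
proof -
  note e = proj_elem[OF P]
  have cross: "(\<Sum>m<N. cd_inner k (P a m) (cd_mult k (P a b) (P b m))) = cd_inner k (P a b) (P a b)"
  proof -
    have "cd_inner k (P a m) (cd_mult k (P a b) (P b m)) = cd_inner k (P a b) (cd_mult k (P a m) (P m b))" for m
      using cd_inner_mult_adjoint_right[OF k e e e, of a b b m a m] proj_conj[OF P]
      by (metis cd_inner_commute)
    thus ?thesis using proj_idem[OF P, of a b] by (simp flip: cd_inner_sum)
  qed
  have "cd_inner k (\<lambda>c. P b b 0 * P a m c - cd_mult k (P a b) (P b m) c)
           (\<lambda>c. P b b 0 * P a m c - cd_mult k (P a b) (P b m) c)
      = (P b b 0)\<^sup>2 * cd_inner k (P a m) (P a m) - 2 * P b b 0 * cd_inner k (P a m) (cd_mult k (P a b) (P b m))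
         + cd_inner k (P a b) (P a b) * cd_inner k (P b m) (P b m)" for m
    unfolding cd_inner_diff cd_inner_scale cd_inner_mult_self[OF k]
    by (simp add: power2_eq_square cd_inner_commute[of k "cd_mult k (P a b) (P b m)"] algebra_simps)
  hence "(\<Sum>m<N. cd_inner k (\<lambda>c. P b b 0 * P a m c - cd_mult k (P a b) (P b m) c)
                      (\<lambda>c. P b b 0 * P a m c - cd_mult k (P a b) (P b m) c))
     = (P b b 0)\<^sup>2 * P a a 0 - 2 * P b b 0 * cd_inner k (P a b) (P a b) + cd_inner k (P a b) (P a b) * P b b 0"
    by (simp add: sum.distrib sum_subtractf cross proj_diag_eq_sum[OF P, of a] proj_diag_eq_sum[OF P, of b] flip: sum_distrib_left)
  thus ?thesis by (simp add: power2_eq_square algebra_simps)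
qed

text \<open>The Cauchy-Schwarz defects are nonnegative and their sum vanishes because the trace is 1: rank one.\<close>

lemma proj_norm_entry:
  assumes P: "P \<in> proj_pts k N"
  shows "cd_inner k (P a b) (P a b) = P a a 0 * P b b 0"
proof -
  have le: "cd_inner k (P a b) (P a b) \<le> P a a 0 * P b b 0" for a b
  proof (cases "P b b 0 = 0")
    case True
    show ?thesis
    proof (cases "a < N")
      case aN: True
      have "cd_inner k (P b a) (P b a) \<le> (\<Sum>l<N. cd_inner k (P b l) (P b l))"
        by (rule member_le_sum) (use aN cd_inner_nonneg in auto)
      thus ?thesis using True proj_diag_eq_sum[OF P, of b] proj_norm_swap[OF P, of a b] by simp
    next
      case False
      thus ?thesis using proj_zero[OF P, of a b] proj_zero[OF P, of a a] by (simp add: cd_inner_def)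
    qed
  next
    case False
    hence "P b b 0 > 0" using proj_diag_nonneg[OF P, of b] by simp
    moreover have "P b b 0 * (P a a 0 * P b b 0 - cd_inner k (P a b) (P a b)) \<ge> 0"
      unfolding proj_defect[OF P, symmetric] by (intro sum_nonneg cd_inner_nonneg)
    ultimately show ?thesis by (simp add: zero_le_mult_iff)
  qed
  have "(\<Sum>a<N. \<Sum>b<N. P a a 0 * P b b 0 - cd_inner k (P a b) (P a b)) = (\<Sum>a<N. P a a 0) * (\<Sum>b<N. P b b 0) - (\<Sum>a<N. P a a 0)"
    by (simp add: sum_subtractf sum_product flip: proj_diag_eq_sum[OF P])
  also have "\<dots> = 0" by (simp add: proj_trace[OF P])
  finally have z: "(\<Sum>a<N. \<Sum>b<N. P a a 0 * P b b 0 - cd_inner k (P a b) (P a b)) = 0" .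
  show ?thesis
  proof (cases "a < N \<and> b < N")
    case True
    have "\<forall>a\<in>{..<N}. (\<Sum>b<N. P a a 0 * P b b 0 - cd_inner k (P a b) (P a b)) = 0"
      using z by (subst (asm) sum_nonneg_eq_0_iff) (auto intro!: sum_nonneg simp: le)
    hence "(\<Sum>b<N. P a a 0 * P b b 0 - cd_inner k (P a b) (P a b)) = 0" using True by simp
    hence "\<forall>b\<in>{..<N}. P a a 0 * P b b 0 - cd_inner k (P a b) (P a b) = 0"
      by (subst (asm) sum_nonneg_eq_0_iff) (auto simp: le)
    thus ?thesis using True by simp
  next
    case False
    thus ?thesis using proj_zero[OF P, of a b] proj_zero[OF P, of a a] proj_zero[OF P, of b b] by (auto simp: cd_inner_def)
  qed
qed

text \<open>With the norms of the entries known, the sum of squares in \<open>proj_defect\<close> is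
  0, hence each minor vanishes. This takes the place of writing the entries as products of
  homogeneous coordinates.\<close>

lemma proj_minors: 
  assumes P: "P \<in> proj_pts k N"
  shows "cd_mult k (P a b) (P b l) = (\<lambda>c. P b b 0 * P a l c)"
proof (cases "l < N")
  case True
  note e = proj_elem[OF P]
  have "(\<Sum>m<N. cd_inner k (\<lambda>c. P b b 0 * P a m c - cd_mult k (P a b) (P b m) c)
      (\<lambda>c. P b b 0 * P a m c - cd_mult k (P a b) (P b m) c)) = 0"
    unfolding proj_defect[OF P] proj_norm_entry[OF P] by simp
  hence "\<forall>m\<in>{..<N}. cd_inner k (\<lambda>c. P b b 0 * P a m c - cd_mult k (P a b) (P b m) c)
      (\<lambda>c. P b b 0 * P a m c - cd_mult k (P a b) (P b m) c) = 0"
    by (subst (asm) sum_nonneg_eq_0_iff) (auto simp: cd_inner_nonneg)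
  hence "(\<lambda>c. P b b 0 * P a l c - cd_mult k (P a b) (P b l) c) = (\<lambda>c. 0)"
    using True by (intro cd_inner_self_eq_0[of k] cd_elem_arith(2) cd_elem_arith(3) e cd_elem_mult) blast
  thus ?thesis by (auto simp: fun_eq_iff)
next
  case False
  thus ?thesis using proj_zero[OF P] by (simp add: cd_mult_zero)
qed

text \<open>Converse of \<open>proj_minors\<close>: summing the vanishing minors over the middle
  index multiplies an entry by the trace, which is 1. Membership thus becomes a condition on triples
  of indices.\<close>

lemma proj_ptsI:
  assumes "supported k N P" "\<And>a b. P b a = cd_conj k (P a b)" "(\<Sum>a<N. P a a 0) = 1"
    and "\<And>a b l. a < N \<Longrightarrow> b < N \<Longrightarrow> l < N \<Longrightarrow> cd_mult k (P a b) (P b l) = (\<lambda>c. P b b 0 * P a l c)"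
  shows "P \<in> proj_pts k N"
proof -
  have z: "P a b = (\<lambda>c. 0)" if "a \<ge> N \<or> b \<ge> N" for a b using that assms(1) by (auto simp: supported_def)
  have "(\<lambda>c. \<Sum>l<N. cd_mult k (P a l) (P l b) c) = P a b" for a b
  proof (cases "a < N \<and> b < N")
    case True
    have "(\<Sum>l<N. cd_mult k (P a l) (P l b) c) = (\<Sum>l<N. P l l 0) * P a b c" for c
      unfolding sum_distrib_right by (intro sum.cong refl) (use True assms(4) in auto)
    thus ?thesis using assms(3) by simp
  next
    case False
    thus ?thesis using z[of a b] z[of a] z[of _ b] by (auto simp: cd_mult_zero)
  qed
  thus ?thesis using assms(1-3) unfolding proj_pts_def by blast
qed

definition rank_one :: "(nat \<Rightarrow> real) \<Rightarrow> pt" where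
  "rank_one v = (\<lambda>a b c. if a < N \<and> b < N \<and> c = 0 then v a * v b else 0)"

lemma rank_one_mem:
  assumes "(\<Sum>a<N. (v a)\<^sup>2) = 1"
  shows "rank_one v \<in> proj_pts k N"
proof (rule proj_ptsI)
  have e: "rank_one v a b = (\<lambda>c. (v a * v b) * cd_unit 0 c)" if "a < N" "b < N" for a b
    using that by (auto simp: rank_one_def cd_unit_def fun_eq_iff)
  have u: "cd_elem k (cd_unit 0)" by (rule cd_elem_arith) simp
  show "cd_mult k (rank_one v a b) (rank_one v b l) = (\<lambda>c. rank_one v b b 0 * rank_one v a l c)"
    if "a < N" "b < N" "l < N" for a b l
    using that u by (simp add: e cd_mult_scale cd_mult_one mult_ac) (simp add: cd_unit_def mult_ac)
  show "(\<Sum>a<N. rank_one v a a 0) = 1" using assms by (simp add: rank_one_def power2_eq_square)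
qed (auto simp: supported_def rank_one_def cd_conj_def fun_eq_iff)

lemma frob_rank_one:
  "frob k N (rank_one v) Q = (\<Sum>a<N. \<Sum>b<N. v a * v b * Q a b 0)"
proof -
  have "(\<Sum>c<2 ^ k. rank_one v a b c * Q a b c) = v a * v b * Q a b 0" if "a < N" "b < N" for a b
  proof -
    have "(\<Sum>c<2 ^ k. rank_one v a b c * Q a b c) = (\<Sum>c\<in>{0}. rank_one v a b c * Q a b c)"
      by (rule sum.mono_neutral_right) (auto simp: rank_one_def)
    thus ?thesis using that by (simp add: rank_one_def)
  qed
  thus ?thesis by (simp add: frob_def)
qed

lemma rank_oneI:
  assumes P: "P \<in> proj_pts k N"
    and "\<And>a b. a < N \<Longrightarrow> b < N \<Longrightarrow> P a b = (\<lambda>c. v a * v b * cd_unit 0 c)"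
  shows "P = rank_one v"
proof (intro ext)
  fix a b c
  show "P a b c = rank_one v a b c"
  proof (cases "a < N \<and> b < N")
    case True thus ?thesis using assms(2)[of a b] by (simp add: rank_one_def cd_unit_def)
  next
    case False thus ?thesis using proj_zero[OF P, of a b] by (auto simp: rank_one_def)
  qed
qed

text \<open>Phrased with \<open>frob\<close> instead of the distance: the bounds 0 and 1 on
  \<open>frob\<close>, which make arccos invertible in \<open>proj_dist\<close>, are themselves
  obtained by applying such maps in \<open>proj_two_point\<close>.\<close>

definition proj_iso :: "(pt \<Rightarrow> pt) \<Rightarrow> bool" where
  "proj_iso g \<longleftrightarrow> g ` proj_pts k N = proj_pts k N
     \<and> (\<forall>P\<in>proj_pts k N. \<forall>Q\<in>proj_pts k N. frob k N (g P) (g Q) = frob k N P Q)"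

lemma proj_iso_isometry: "proj_iso g \<Longrightarrow> isometry_of (proj_pts k N) (proj_dist k N) g"
  by (simp add: proj_iso_def isometry_of_def proj_dist_def)

lemma proj_iso_mem: "proj_iso g \<Longrightarrow> P \<in> proj_pts k N \<Longrightarrow> g P \<in> proj_pts k N"
  by (auto simp: proj_iso_def)

lemma proj_iso_comp: "proj_iso g \<Longrightarrow> proj_iso h \<Longrightarrow> proj_iso (\<lambda>P. g (h P))"
proof -
  assume g: "proj_iso g" and h: "proj_iso h"
  have "(\<lambda>P. g (h P)) ` proj_pts k N = g ` h ` proj_pts k N" by (simp add: image_image)
  thus ?thesis using g h proj_iso_mem[OF h] unfolding proj_iso_def by auto
qed

lemma proj_iso_id: "proj_iso (\<lambda>P. P)"
  by (simp add: proj_iso_def)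

lemma proj_isoI:
  assumes "\<And>P. P \<in> proj_pts k N \<Longrightarrow> g P \<in> proj_pts k N" "\<And>P. P \<in> proj_pts k N \<Longrightarrow> h P \<in> proj_pts k N"
    "\<And>P. P \<in> proj_pts k N \<Longrightarrow> g (h P) = P"
    "\<And>P Q. P \<in> proj_pts k N \<Longrightarrow> Q \<in> proj_pts k N \<Longrightarrow> frob k N (g P) (g Q) = frob k N P Q"
  shows "proj_iso g"
proof -
  have "P \<in> g ` proj_pts k N" if "P \<in> proj_pts k N" for P
    using assms(2,3)[OF that] by (intro image_eqI[of _ _ "h P"]) auto
  thus ?thesis unfolding proj_iso_def using assms(1,4) by blast
qed

end

lemma cd_conj_sum: "cd_conj k (\<lambda>c. \<Sum>l\<in>A. f l c) = (\<lambda>c. \<Sum>l\<in>A. cd_conj k (f l) c)"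
  by (rule ext) (simp add: cd_conj_def sum_negf)

lemma sum_rotate: "(\<Sum>a\<in>A. \<Sum>i\<in>I. \<Sum>j\<in>J. f a i j) = (\<Sum>i\<in>I. \<Sum>j\<in>J. \<Sum>a\<in>A. f a i j)"
proof -
  have "(\<Sum>a\<in>A. \<Sum>i\<in>I. \<Sum>j\<in>J. f a i j) = (\<Sum>i\<in>I. \<Sum>a\<in>A. \<Sum>j\<in>J. f a i j)" by (rule sum.swap)
  also have "\<dots> = (\<Sum>i\<in>I. \<Sum>j\<in>J. \<Sum>a\<in>A. f a i j)" by (intro sum.cong refl sum.swap)
  finally show ?thesis .
qed

section \<open>Conjugation by real reflections and by diagonal phases\<close>

context cd_projective
begin

text \<open>A reflection of the plane of \<open>p\<close> and \<open>q\<close> rather than a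
  rotation: the matrix is symmetric and its own inverse, so conjugation by it is an involution and
  bijectivity comes for free.\<close>

definition refl_mat :: "nat \<Rightarrow> nat \<Rightarrow> real \<Rightarrow> real \<Rightarrow> nat \<Rightarrow> nat \<Rightarrow> real" where
  "refl_mat p q C S a b = (if a = p \<and> b = p then C else if a = q \<and> b = q then - C
     else if a = p \<and> b = q \<or> a = q \<and> b = p then S
     else if a = b then 1 else 0)"

context
  fixes p q :: nat and C S :: real
  assumes pq: "p < N" "q < N" "p \<noteq> q" and CS: "C\<^sup>2 + S\<^sup>2 = 1"
begin

abbreviation "H \<equiv> refl_mat p q C S"

lemma refl_mat_sym: "H a b = H b a"
  by (auto simp: refl_mat_def)

lemma sum_refl_mat:
  "(\<Sum>i<N. H a i * f i) = (if a = p then C * f p + S * f q else if a = q then S * f p - C * f q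
     else if a < N then f a else 0)"
proof -
  have "(\<Sum>i<N. H a i * f i) = (\<Sum>i\<in>(if a = p \<or> a = q then {p, q} else if a < N then {a} else {}). H a i * f i)"
    by (rule sum.mono_neutral_right) (use pq in \<open>auto simp: refl_mat_def\<close>)
  thus ?thesis using pq by (auto simp: refl_mat_def)
qed

lemma sum_refl_mat_mat: "a < N \<Longrightarrow> (\<Sum>i<N. H a i * H i b) = (if a = b then 1 else 0)"
  using CS pq unfolding sum_refl_mat by (auto simp: refl_mat_def power2_eq_square algebra_simps)

lemma refl_mat_contract:
  "(\<Sum>a<N. (\<Sum>i<N. H a i * x i) * (\<Sum>i<N. H a i * y i)) = (\<Sum>i<N. x i * y i)"
proof -
  have "(\<Sum>a<N. (\<Sum>i<N. H a i * x i) * (\<Sum>i<N. H a i * y i)) = (\<Sum>a<N. \<Sum>i<N. \<Sum>j<N. H a i * H a j * (x i * y j))"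
    by (simp add: sum_product mult_ac)
  also have "\<dots> = (\<Sum>i<N. \<Sum>j<N. (\<Sum>a<N. H i a * H a j) * (x i * y j))"
    by (subst sum_rotate) (simp add: sum_distrib_right sum_distrib_left refl_mat_sym mult_ac)
  also have "\<dots> = (\<Sum>i<N. \<Sum>j<N. if i = j then x i * y j else 0)"
    by (intro sum.cong refl) (simp add: sum_refl_mat_mat)
  finally show ?thesis by simp
qed

text \<open>Orthogonality of \<open>H\<close> cancels the two copies that meet at the middle index
  of a matrix product. Its entries are real and pass through the products, over the octonions as
  well.\<close>

lemma refl_mat_contract_mult:
  "(\<lambda>c. \<Sum>l<N. cd_mult k (\<lambda>c. \<Sum>i<N. H l i * x i c) (\<lambda>c. \<Sum>j<N. H l j * y j c) c)
     = (\<lambda>c. \<Sum>i<N. cd_mult k (x i) (y i) c)"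
proof
  fix c
  have "(\<Sum>l<N. cd_mult k (\<lambda>c. \<Sum>i<N. H l i * x i c) (\<lambda>c. \<Sum>j<N. H l j * y j c) c)
     = (\<Sum>l<N. \<Sum>i<N. \<Sum>j<N. H l i * H l j * cd_mult k (x i) (y j) c)"
    by (simp only: cd_mult_sum cd_mult_scale finite_lessThan sum_distrib_left) (simp only: mult_ac)
  also have "\<dots> = (\<Sum>i<N. \<Sum>j<N. (\<Sum>l<N. H i l * H l j) * cd_mult k (x i) (y j) c)"
    by (subst sum_rotate) (simp add: sum_distrib_right sum_distrib_left refl_mat_sym mult_ac)
  also have "\<dots> = (\<Sum>i<N. \<Sum>j<N. if i = j then cd_mult k (x i) (y j) c else 0)"
    by (intro sum.cong refl) (simp add: sum_refl_mat_mat)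
  finally show "(\<Sum>l<N. cd_mult k (\<lambda>c. \<Sum>i<N. H l i * x i c) (\<lambda>c. \<Sum>j<N. H l j * y j c) c)
     = (\<Sum>i<N. cd_mult k (x i) (y i) c)" by simp
qed

definition refl_pt :: "pt \<Rightarrow> pt" where
  "refl_pt P = (\<lambda>a b c. \<Sum>i<N. H a i * (\<Sum>j<N. H b j * P i j c))"

lemma refl_pt_swap: "refl_pt P a b c = (\<Sum>j<N. H b j * (\<Sum>i<N. H a i * P i j c))"
  unfolding refl_pt_def sum_distrib_left by (subst sum.swap) (simp add: mult_ac)

lemma refl_pt_refl_pt:
  assumes "P \<in> proj_pts k N"
  shows "refl_pt (refl_pt P) = P"
proof (intro ext)
  fix a b c
  have 1: "(\<Sum>i<N. H a i * (\<Sum>j<N. H i j * f j)) = (if a < N then f a else 0)" for f a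
  proof -
    have "(\<Sum>i<N. H a i * (\<Sum>j<N. H i j * f j)) = (\<Sum>j<N. (\<Sum>i<N. H a i * H i j) * f j)"
      unfolding sum_distrib_left sum_distrib_right by (subst sum.swap) (simp add: mult_ac)
    also have "\<dots> = (if a < N then f a else 0)"
    proof (cases "a < N")
      case True
      have "(\<Sum>j<N. (\<Sum>i<N. H a i * H i j) * f j) = (\<Sum>j<N. if a = j then f j else 0)"
        by (intro sum.cong refl) (simp add: sum_refl_mat_mat True)
      thus ?thesis using True by simp
    next
      case False
      thus ?thesis unfolding sum_refl_mat using pq by auto
    qed
    finally show ?thesis .
  qed
  have "refl_pt (refl_pt P) a b c = (\<Sum>i<N. H a i * (\<Sum>j<N. H b j * (\<Sum>j'<N. H j j' * (\<Sum>i'<N. H i i' * P i' j' c))))"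
    by (subst refl_pt_def) (simp add: refl_pt_swap)
  also have "\<dots> = (if a < N \<and> b < N then P a b c else 0)"
    unfolding 1 by (cases "b < N") (simp_all add: 1)
  finally show "refl_pt (refl_pt P) a b c = P a b c"
    using proj_zero[OF assms, of a b] by auto
qed

lemma refl_pt_mem:
  assumes P: "P \<in> proj_pts k N"
  shows "refl_pt P \<in> proj_pts k N"
proof -
  have supp: "supported k N (refl_pt P)"
    unfolding supported_def
  proof (intro allI impI)
    fix a b c :: nat assume "\<not> (a < N \<and> b < N \<and> c < 2 ^ k)"
    moreover have "P i j c = 0" if "c \<ge> 2 ^ k" for i j c :: nat using proj_elem[OF P] that by (simp add: cd_elem_def)
    moreover have "refl_pt P a b c = 0" if "a \<ge> N" using that pq unfolding refl_pt_def sum_refl_mat by auto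
    moreover have "refl_pt P a b c = 0" if "b \<ge> N" using that pq unfolding refl_pt_swap sum_refl_mat by auto
    ultimately show "refl_pt P a b c = 0" by (auto simp: refl_pt_def not_less)
  qed
  have herm: "refl_pt P b a = cd_conj k (refl_pt P a b)" for a b
  proof -
    have "cd_conj k (refl_pt P a b) = (\<lambda>c. \<Sum>i<N. H a i * (\<Sum>j<N. H b j * cd_conj k (P i j) c))"
      unfolding refl_pt_def by (simp add: cd_conj_sum cd_conj_scale)
    also have "\<dots> = refl_pt P b a"
      using proj_conj[OF P] by (simp add: refl_pt_swap fun_eq_iff)
    finally show ?thesis by simp
  qed
  have idem: "(\<lambda>c. \<Sum>l<N. cd_mult k (refl_pt P a l) (refl_pt P l b) c) = refl_pt P a b" for a b
  proof -
    have "(\<lambda>c. \<Sum>l<N. cd_mult k (refl_pt P a l) (refl_pt P l b) c)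
       = (\<lambda>c. \<Sum>l<N. cd_mult k (\<lambda>c. \<Sum>j<N. H l j * (\<Sum>i<N. H a i * P i j c)) (\<lambda>c. \<Sum>i<N. H l i * (\<Sum>j<N. H b j * P i j c)) c)"
    proof -
      have L: "refl_pt P a l = (\<lambda>c. \<Sum>j<N. H l j * (\<Sum>i<N. H a i * P i j c))" for l
        by (rule ext) (rule refl_pt_swap)
      have R: "refl_pt P l b = (\<lambda>c. \<Sum>i<N. H l i * (\<Sum>j<N. H b j * P i j c))" for l
        by (simp add: refl_pt_def)
      show ?thesis unfolding L R ..
    qed
    also have "\<dots> = (\<lambda>c. \<Sum>l<N. cd_mult k (\<lambda>c. \<Sum>i<N. H a i * P i l c) (\<lambda>c. \<Sum>j<N. H b j * P l j c) c)"
      by (rule refl_mat_contract_mult)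
    also have "\<dots> = (\<lambda>c. \<Sum>l<N. \<Sum>i<N. H a i * (\<Sum>j<N. H b j * cd_mult k (P i l) (P l j) c))"
      by (simp add: cd_mult_sum cd_mult_scale)
    also have "\<dots> = (\<lambda>c. \<Sum>i<N. H a i * (\<Sum>j<N. H b j * (\<Sum>l<N. cd_mult k (P i l) (P l j) c)))"
      unfolding sum_distrib_left by (rule ext) (rule sum_rotate)
    also have "\<dots> = refl_pt P a b"
      unfolding refl_pt_def using proj_idem[OF P] by (simp add: fun_eq_iff)
    finally show ?thesis .
  qed
  have tr: "(\<Sum>a<N. refl_pt P a a 0) = 1"
  proof -
    have "(\<Sum>a<N. refl_pt P a a 0) = (\<Sum>a<N. \<Sum>i<N. \<Sum>j<N. H a i * H a j * P i j 0)"
      by (simp add: refl_pt_def sum_distrib_left mult_ac)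
    also have "\<dots> = (\<Sum>i<N. \<Sum>j<N. (\<Sum>a<N. H i a * H a j) * P i j 0)"
      by (subst sum_rotate) (simp add: sum_distrib_right sum_distrib_left refl_mat_sym mult_ac)
    also have "\<dots> = (\<Sum>i<N. \<Sum>j<N. if i = j then P i j 0 else 0)"
      by (intro sum.cong refl) (simp add: sum_refl_mat_mat)
    finally show ?thesis using proj_trace[OF P] by simp
  qed
  show ?thesis using supp herm idem tr unfolding proj_pts_def by blast
qed

lemma refl_pt_frob: "frob k N (refl_pt P) (refl_pt Q) = frob k N P Q"
proof -
  have frob: "frob k N X Y = (\<Sum>c<2 ^ k. \<Sum>i<N. \<Sum>j<N. X i j c * Y i j c)" for X Y
    unfolding frob_def by (rule sum_rotate[symmetric])
  have "frob k N (refl_pt P) (refl_pt Q) = (\<Sum>c<2 ^ k. \<Sum>b<N. \<Sum>a<N. refl_pt P a b c * refl_pt Q a b c)"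
    unfolding frob by (intro sum.cong refl sum.swap)
  also have "\<dots> = (\<Sum>c<2 ^ k. \<Sum>b<N. \<Sum>i<N. (\<Sum>j<N. H b j * P i j c) * (\<Sum>j<N. H b j * Q i j c))"
    unfolding refl_pt_def refl_mat_contract ..
  also have "\<dots> = (\<Sum>c<2 ^ k. \<Sum>i<N. \<Sum>b<N. (\<Sum>j<N. H b j * P i j c) * (\<Sum>j<N. H b j * Q i j c))"
    by (intro sum.cong refl sum.swap)
  also have "\<dots> = (\<Sum>c<2 ^ k. \<Sum>i<N. \<Sum>j<N. P i j c * Q i j c)"
    unfolding refl_mat_contract ..
  also have "\<dots> = frob k N P Q"
    unfolding frob ..
  finally show ?thesis .
qed

lemma refl_pt_iso: "proj_iso refl_pt"
  using refl_pt_mem refl_pt_refl_pt refl_pt_frob by (intro proj_isoI[of _ refl_pt]) auto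

lemma refl_pt_entries:
  assumes P: "P \<in> proj_pts k N"
  shows "refl_pt P p p 0 = C\<^sup>2 * P p p 0 + S\<^sup>2 * P q q 0 + 2 * C * S * P p q 0"
    "refl_pt P q q 0 = S\<^sup>2 * P p p 0 + C\<^sup>2 * P q q 0 - 2 * C * S * P p q 0"
    "refl_pt P p q 0 = C * S * (P p p 0 - P q q 0) - (C\<^sup>2 - S\<^sup>2) * P p q 0"
    "m \<noteq> p \<Longrightarrow> m \<noteq> q \<Longrightarrow> refl_pt P m m 0 = P m m 0"
proof -
  have s: "P q p 0 = P p q 0" using proj_conj[OF P, of p q] by (metis cd_conj_0)
  show "refl_pt P p p 0 = C\<^sup>2 * P p p 0 + S\<^sup>2 * P q q 0 + 2 * C * S * P p q 0"
    "refl_pt P q q 0 = S\<^sup>2 * P p p 0 + C\<^sup>2 * P q q 0 - 2 * C * S * P p q 0"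
    "refl_pt P p q 0 = C * S * (P p p 0 - P q q 0) - (C\<^sup>2 - S\<^sup>2) * P p q 0"
    using pq unfolding refl_pt_def sum_refl_mat by (simp_all add: s power2_eq_square algebra_simps)
  show "refl_pt P m m 0 = P m m 0" if "m \<noteq> p" "m \<noteq> q"
    using that proj_zero[OF P, of m m] unfolding refl_pt_def sum_refl_mat by auto
qed

lemma refl_pt_fixes:
  assumes "p \<noteq> r" "q \<noteq> r" "r < N"
  shows "refl_pt (rank_one (\<lambda>a. if a = r then 1 else 0)) = rank_one (\<lambda>a. if a = r then 1 else 0)"
proof (intro ext)
  fix a b c
  have e: "rank_one (\<lambda>a. if a = r then 1 else 0) i j c = (if i = r then (if j = r then (if c = 0 then 1 else 0) else 0) else 0)" for i j
    using assms(3) by (auto simp: rank_one_def)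
  have Hr: "H x r = (if x = r then 1 else 0)" for x using assms by (auto simp: refl_mat_def)
  have "refl_pt (rank_one (\<lambda>a. if a = r then 1 else 0)) a b c = H a r * (H b r * (if c = 0 then 1 else 0))"
  proof -
    have 1: "(\<Sum>j<N. H b j * (if i = r then (if j = r then (if c = 0 then 1 else 0) else 0) else 0))
        = (if i = r then H b r * (if c = 0 then 1 else 0) else 0)" for i
      using assms(3) by (cases "i = r") (simp_all add: if_distrib[of "\<lambda>x. _ * x"] cong: if_cong)
    show ?thesis
      unfolding refl_pt_def e 1 using assms(3) by (simp add: if_distrib[of "\<lambda>x. _ * x"] cong: if_cong)
  qed
  thus "refl_pt (rank_one (\<lambda>a. if a = r then 1 else 0)) a b c = rank_one (\<lambda>a. if a = r then 1 else 0) a b c"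
    unfolding Hr e by simp
qed

end

text \<open>Conjugation by the diagonal matrix with entries \<open>u\<close> and \<open>conj u\<close> at the positions \<open>i\<close> and \<open>j\<close>.
  With both positions twisted, this preserves the octonionic projective plane too.\<close>

definition phase_pt :: "nat \<Rightarrow> nat \<Rightarrow> (nat \<Rightarrow> real) \<Rightarrow> pt \<Rightarrow> pt" where
  "phase_pt i j u P a b =
    (if a = i \<and> b = j then cd_sandwich k u (P a b)
     else if a = j \<and> b = i then cd_sandwich k (cd_conj k u) (P a b)
     else if a = b then P a b
     else if a = i then cd_mult k u (P a b)
     else if a = j then cd_mult k (cd_conj k u) (P a b)
     else if b = i then cd_mult k (P a b) (cd_conj k u)
     else if b = j then cd_mult k (P a b) u
     else P a b)"

definition unit_elem :: "(nat \<Rightarrow> real) \<Rightarrow> bool" where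
  "unit_elem u \<longleftrightarrow> cd_elem k u \<and> cd_inner k u u = 1"

lemma unit_elem_conj: "unit_elem u \<Longrightarrow> unit_elem (cd_conj k u)"
  by (simp add: unit_elem_def cd_inner_conj)

lemma phase_pt_swap:
  assumes "unit_elem u" "i \<noteq> j"
  shows "phase_pt j i (cd_conj k u) = phase_pt i j u"
  using assms by (intro ext) (auto simp: phase_pt_def unit_elem_def cd_conj_conj)

lemma phase_pt_diag: "i \<noteq> j \<Longrightarrow> phase_pt i j u P a a = P a a"
  by (auto simp: phase_pt_def)

lemma phase_pt_elem:
  assumes "unit_elem u" "P \<in> proj_pts k N"
  shows "cd_elem k (phase_pt i j u P a b)"
proof -
  have if_elem: "cd_elem k (if c then x else y)" if "cd_elem k x" "cd_elem k y" for c x y using that by simp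
  have "cd_elem k u" using assms by (simp add: unit_elem_def)
  thus ?thesis unfolding phase_pt_def
    by (intro if_elem cd_elem_mult cd_elem_sandwich[OF k] cd_elem_conj proj_elem[OF assms(2)])
qed

lemma phase_pt_conj:
  assumes u: "unit_elem u" and ij: "i \<noteq> j" and P: "P \<in> proj_pts k N"
  shows "phase_pt i j u P b a = cd_conj k (phase_pt i j u P a b)"
  using u ij
  by (simp add: phase_pt_def unit_elem_def proj_elem[OF P] cd_conj_sandwich[OF k] cd_conj_mult[OF k] cd_conj_conj proj_conj[OF P])

lemma phase_pt_inner:
  assumes u: "unit_elem u" and P: "P \<in> proj_pts k N" and Q: "Q \<in> proj_pts k N"
  shows "cd_inner k (phase_pt i j u P a b) (phase_pt i j u Q a b) = cd_inner k (P a b) (Q a b)"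
  using u
  by (simp add: phase_pt_def unit_elem_def proj_elem[OF P] proj_elem[OF Q] cd_inner_sandwich[OF k] cd_inner_mult_left[OF k] cd_inner_mult_right[OF k] cd_inner_conj)

lemma phase_pt_cancel:
  assumes u: "unit_elem u" and ij: "i \<noteq> j" and P: "P \<in> proj_pts k N"
  shows "phase_pt i j (cd_conj k u) (phase_pt i j u P) = P"
proof (intro ext)
  fix a b c
  have u': "cd_elem k u" "cd_inner k u u = 1" using u by (auto simp: unit_elem_def)
  note e = proj_elem[OF P]
  have 1: "cd_mult k (cd_conj k u) (cd_mult k u x) = x" "cd_mult k u (cd_mult k (cd_conj k u) x) = x"
    "cd_mult k (cd_mult k x u) (cd_conj k u) = x" "cd_mult k (cd_mult k x (cd_conj k u)) u = x"
    "cd_sandwich k (cd_conj k u) (cd_sandwich k u x) = x" "cd_sandwich k u (cd_sandwich k (cd_conj k u) x) = x"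
    if "cd_elem k x" for x
    using that u' cd_conj_mult_cancel[OF k, of u x] cd_conj_mult_cancel[OF k, of "cd_conj k u" x]
      cd_mult_conj_cancel[OF k, of u x] cd_mult_conj_cancel[OF k, of "cd_conj k u" x]
      cd_sandwich_cancel[OF k, of u x] cd_sandwich_cancel[OF k, of "cd_conj k u" x]
    by (simp_all add: cd_conj_conj cd_inner_conj)
  show "phase_pt i j (cd_conj k u) (phase_pt i j u P) a b c = P a b c"
    using ij by (simp add: phase_pt_def cd_conj_conj u' 1 e)
qed

text \<open>Reversing the order of the product by conjugation, and exchanging the roles of
  \<open>i\<close> and \<open>j\<close> together with \<open>u\<close> and its conjugate, reduces
  all triples of distinct indices that meet \<open>i\<close> or \<open>j\<close> to the four
  situations in \<open>one_i\<close>. Those involving both \<open>i\<close> and \<open>j\<close> are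
  Moufang identities; the others force a fourth index.\<close>

lemma phase_pt_minor:
  assumes u: "unit_elem u" and ij: "i \<noteq> j" and P: "P \<in> proj_pts k N"
    and ijN: "i < N" "j < N" and abl: "a < N" "b < N" "l < N"
  shows "cd_mult k (phase_pt i j u P a b) (phase_pt i j u P b l) = (\<lambda>c. P b b 0 * phase_pt i j u P a l c)"
proof -
  note e = proj_elem[OF P] and mi = proj_minors[OF P]
  have reversed: "cd_mult k (phase_pt i j u P a b) (phase_pt i j u P b l) = (\<lambda>c. P b b 0 * phase_pt i j u P a l c)"
    if "unit_elem u" "i \<noteq> j" "cd_mult k (phase_pt i j u P l b) (phase_pt i j u P b a) = (\<lambda>c. P b b 0 * phase_pt i j u P l a c)"
    for u i j a b l
  proof -
    have "cd_mult k (phase_pt i j u P a b) (phase_pt i j u P b l) = cd_conj k (cd_mult k (phase_pt i j u P l b) (phase_pt i j u P b a))"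
      unfolding cd_conj_mult[OF k phase_pt_elem[OF that(1) P] phase_pt_elem[OF that(1) P]]
      by (simp flip: phase_pt_conj[OF that(1,2) P])
    also have "\<dots> = (\<lambda>c. P b b 0 * phase_pt i j u P a l c)"
      unfolding that(3) cd_conj_scale by (simp flip: phase_pt_conj[OF that(1,2) P])
    finally show ?thesis .
  qed
  have one_i: "cd_mult k (phase_pt i j u P a b) (phase_pt i j u P b l) = (\<lambda>c. P b b 0 * phase_pt i j u P a l c)"
    if u: "unit_elem u" and ij: "i \<noteq> j" and d: "a \<noteq> b" "b \<noteq> l" "a \<noteq> l" and abl: "a < N" "b < N" "l < N"
      and c: "a = i \<and> b = j \<or> a = i \<and> l = j \<or> (a = i \<or> b = i) \<and> j \<noteq> a \<and> j \<noteq> b \<and> j \<noteq> l" "i < N" "j < N"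
    for u i j a b l
  proof -
    have u': "cd_elem k u" "cd_inner k u u = 1" using u by (auto simp: unit_elem_def)
    consider "a = i" "b = j" | "a = i" "l = j" | "a = i" "j \<noteq> a" "j \<noteq> b" "j \<noteq> l" | "b = i" "j \<noteq> a" "j \<noteq> b" "j \<noteq> l"
      using c by blast
    thus ?thesis
    proof cases
      case 1
      thus ?thesis using d ij cd_sandwich_mult[OF k u' e e, of a b b l]
        by (simp add: phase_pt_def mi cd_mult_scale)
    next
      case 2
      have "cd_sandwich k u (\<lambda>c. P b b 0 * P a l c) = (\<lambda>c. P b b 0 * cd_sandwich k u (P a l) c)"
        unfolding cd_sandwich_def cd_inner_scale cd_conj_scale by (simp add: algebra_simps)
      thus ?thesis using 2 d ij cd_Moufang[OF k u' e e, of a b b l]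
        by (simp add: phase_pt_def mi)
    next
      case 3
      \<comment> \<open>Here \<open>a\<close>, \<open>b\<close>, \<open>l\<close> and
        \<open>j\<close> are four different indices, which excludes the octonionic plane, so
        multiplication is associative.\<close>
      have k2: "k \<le> 2"
      proof (rule ccontr)
        assume "\<not> k \<le> 2"
        hence "N = 3" using assoc by simp
        thus False using 3 d abl c(2,3) by auto
      qed
      thus ?thesis using 3 d ij by (simp add: phase_pt_def mi cd_mult_assoc cd_mult_scale)
    next
      case 4
      have k2: "k \<le> 2"
      proof (rule ccontr)
        assume "\<not> k \<le> 2"
        hence "N = 3" using assoc by simp
        thus False using 4 d abl c(2,3) by auto
      qed
      have "cd_mult k (cd_mult k (P a i) (cd_conj k u)) (cd_mult k u (P i l)) = cd_mult k (P a i) (cd_mult k (cd_conj k u) (cd_mult k u (P i l)))"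
        by (rule cd_mult_assoc[OF k2])
      also have "\<dots> = cd_mult k (P a i) (P i l)"
        using cd_conj_mult_cancel[OF k u'(1) e, of i l] u' by simp
      finally show ?thesis using 4 d ij by (simp add: phase_pt_def mi)
    qed
  qed
  have diag: "phase_pt i j u P m m = (\<lambda>c. P m m 0 * cd_unit 0 c)" for m
    unfolding phase_pt_diag[OF ij] by (rule proj_diag[OF P])
  note pe = phase_pt_elem[OF u P]
  show ?thesis
  proof (cases "a \<noteq> b \<and> b \<noteq> l \<and> a \<noteq> l")
    case True
    hence d: "a \<noteq> b" "b \<noteq> l" "a \<noteq> l" by auto
    note u2 = unit_elem_conj[OF u] and ji = ij[symmetric] and sw = phase_pt_swap[OF u ij]
    consider "a = i" | "a = j" | "l = i" | "l = j" | "a \<noteq> i" "a \<noteq> j" "l \<noteq> i" "l \<noteq> j" by blast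
    thus ?thesis
    proof cases
      case 1
      show ?thesis by (rule one_i[OF u ij d abl _ ijN]) (use 1 ij in blast)
    next
      case 2
      show ?thesis using one_i[OF u2 ji d abl _ ijN(2,1)] 2 ij unfolding sw by blast
    next
      case 3
      show ?thesis
        by (rule reversed[OF u ij], rule one_i[OF u ij d(2,1)[symmetric] d(3)[symmetric] abl(3,2,1) _ ijN])
          (use 3 ij in blast)
    next
      case 4
      show ?thesis
        by (rule reversed[OF u ij])
          (use one_i[OF u2 ji d(2,1)[symmetric] d(3)[symmetric] abl(3,2,1) _ ijN(2,1)] 4 ij in \<open>unfold sw, blast\<close>)
    next
      case 5
      consider "b = i" | "b = j" | "b \<noteq> i" "b \<noteq> j" by blast
      thus ?thesis
      proof cases
        case 1
        show ?thesis by (rule one_i[OF u ij d abl _ ijN]) (use 1 5 ij in blast)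
      next
        case 2
        show ?thesis using one_i[OF u2 ji d abl _ ijN(2,1)] 2 5 ij unfolding sw by blast
      next
        case 3
        thus ?thesis using 5 d by (simp add: phase_pt_def mi)
      qed
    qed
  next
    case False
    then consider "a = b" | "b = l" | "a \<noteq> b" "a = l" by blast
    thus ?thesis
    proof cases
      case 1
      thus ?thesis by (simp add: diag cd_mult_scale cd_mult_one[OF pe])
    next
      case 2
      thus ?thesis by (simp add: diag cd_mult_scale cd_mult_one[OF pe])
    next
      case 3
      \<comment> \<open>An entry times its conjugate is its squared norm, which the phases preserve
        and \<open>proj_norm_entry\<close> evaluates.\<close>
      have "cd_mult k (phase_pt i j u P a b) (phase_pt i j u P b a) = (\<lambda>c. cd_inner k (P a b) (P a b) * cd_unit 0 c)"
        using cd_mult_conj_self[OF k pe, of i j a b] phase_pt_conj[OF u ij P, of b a] phase_pt_inner[OF u P P, of i j a b] by simp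
      thus ?thesis using 3 diag[of a] by (simp add: proj_norm_entry[OF P] fun_eq_iff)
    qed
  qed
qed

end

context cd_projective
begin

lemma phase_pt_mem:
  assumes u: "unit_elem u" and ij: "i \<noteq> j" "i < N" "j < N" and P: "P \<in> proj_pts k N"
  shows "phase_pt i j u P \<in> proj_pts k N"
proof (rule proj_ptsI)
  have z: "phase_pt i j u P a b = (\<lambda>c. 0)" if "a \<ge> N \<or> b \<ge> N" for a b
    using that ij proj_zero[OF P, of a b] by (auto simp: phase_pt_def cd_mult_zero)
  show "supported k N (phase_pt i j u P)"
    unfolding supported_def
  proof (intro allI impI)
    fix a b c :: nat assume "\<not> (a < N \<and> b < N \<and> c < 2 ^ k)"
    thus "phase_pt i j u P a b c = 0"
      using z[of a b] phase_pt_elem[OF u P, of i j a b] by (auto simp: cd_elem_def not_less)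
  qed
  show "phase_pt i j u P b a = cd_conj k (phase_pt i j u P a b)" for a b
    by (rule phase_pt_conj[OF u ij(1) P])
  show "(\<Sum>a<N. phase_pt i j u P a a 0) = 1"
    using proj_trace[OF P] by (simp add: phase_pt_diag[OF ij(1)])
  show "cd_mult k (phase_pt i j u P a b) (phase_pt i j u P b l) = (\<lambda>c. phase_pt i j u P b b 0 * phase_pt i j u P a l c)"
    if "a < N" "b < N" "l < N" for a b l
    using phase_pt_minor[OF u ij(1) P ij(2,3) that] by (simp add: phase_pt_diag[OF ij(1)])
qed

lemma phase_pt_iso:
  assumes u: "unit_elem u" and ij: "i \<noteq> j" "i < N" "j < N"
  shows "proj_iso (phase_pt i j u)"
proof (rule proj_isoI[of _ "phase_pt i j (cd_conj k u)"])
  note u' = unit_elem_conj[OF u]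
  have uu: "cd_conj k (cd_conj k u) = u" using u by (simp add: unit_elem_def cd_conj_conj)
  show "phase_pt i j u P \<in> proj_pts k N" "phase_pt i j (cd_conj k u) P \<in> proj_pts k N" if "P \<in> proj_pts k N" for P
    using phase_pt_mem[OF u ij that] phase_pt_mem[OF u' ij that] .
  show "phase_pt i j u (phase_pt i j (cd_conj k u) P) = P" if "P \<in> proj_pts k N" for P
    using phase_pt_cancel[OF u' ij(1) that] uu by simp
  show "frob k N (phase_pt i j u P) (phase_pt i j u Q) = frob k N P Q"
    if "P \<in> proj_pts k N" "Q \<in> proj_pts k N" for P Q
    using phase_pt_inner[OF u that, of i j] by (simp add: frob_def cd_inner_def)
qed

lemma phase_pt_fixes:
  assumes "i \<noteq> j"
  shows "phase_pt i j u (rank_one (\<lambda>a. if a = r then 1 else 0)) = rank_one (\<lambda>a. if a = r then 1 else 0)"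
proof (intro ext)
  fix a b c
  have z: "rank_one (\<lambda>a. if a = r then 1 else 0) a b = (\<lambda>c. 0)" if "a \<noteq> b" for a b
    using that by (auto simp: rank_one_def fun_eq_iff)
  have s: "cd_sandwich k u (\<lambda>c. 0) = (\<lambda>c. 0)" for u
    by (auto simp: cd_sandwich_def cd_inner_def cd_conj_def fun_eq_iff)
  show "phase_pt i j u (rank_one (\<lambda>a. if a = r then 1 else 0)) a b c = rank_one (\<lambda>a. if a = r then 1 else 0) a b c"
  proof (cases "a = b")
    case True thus ?thesis using phase_pt_diag[OF assms] by simp
  next
    case False thus ?thesis by (simp add: phase_pt_def z s cd_mult_zero)
  qed
qed

section \<open>Normal forms of one and of two points under isometries\<close>

lemma exists_aligning_unit:
  assumes x: "cd_elem k x"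
  obtains u where "unit_elem u" "cd_mult k u x = (\<lambda>c. sqrt (cd_inner k x x) * cd_unit 0 c)"
proof (cases "cd_inner k x x = 0")
  case True
  hence "x = (\<lambda>c. 0)" by (rule cd_inner_self_eq_0[OF x])
  moreover have "unit_elem (cd_unit 0)"
    by (auto simp: unit_elem_def cd_inner_unit cd_elem_arith) (simp add: cd_unit_def)
  ultimately show ?thesis using that[of "cd_unit 0"] True by (simp add: cd_mult_zero)
next
  case False
  hence pos: "cd_inner k x x > 0" using cd_inner_nonneg[of k x] by simp
  define r where "r = 1 / sqrt (cd_inner k x x)"
  have r: "r * sqrt (cd_inner k x x) = 1" "r * cd_inner k x x = sqrt (cd_inner k x x)"
    using pos by (simp_all add: r_def field_simps)
  have "unit_elem (\<lambda>c. r * cd_conj k x c)"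
    using r by (auto simp: unit_elem_def cd_inner_scale cd_inner_conj cd_elem_arith)
  moreover have "cd_mult k (\<lambda>c. r * cd_conj k x c) x = (\<lambda>c. sqrt (cd_inner k x x) * cd_unit 0 c)"
    using cd_mult_conj_self[OF k, of "cd_conj k x"] x r
    by (simp add: cd_mult_scale cd_conj_conj cd_inner_conj mult.assoc[symmetric])
  ultimately show ?thesis by (rule that)
qed

lemma exists_third: "\<exists>j<N. j \<noteq> p \<and> j \<noteq> q"
proof -
  have "\<exists>j<3. j \<noteq> p \<and> j \<noteq> q" by presburger
  thus ?thesis using N by (meson order_less_le_trans)
qed

text \<open>An elimination step. A phase at \<open>p\<close>, compensated at a third index, makes
  the entry \<open>(p, q)\<close> real and nonnegative; by rank one it is the geometric mean of the
  two diagonal entries, and a reflection moves all of their mass to \<open>p\<close>. The last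
  clauses allow such steps to be chained without losing earlier zeros or the base point.\<close>

lemma proj_iso_kill:
  assumes P: "P \<in> proj_pts k N" and pq: "p < N" "q < N" "p \<noteq> q"
  shows "\<exists>g. proj_iso g \<and> g P q q 0 = 0 \<and> (\<forall>m. m \<noteq> p \<longrightarrow> m \<noteq> q \<longrightarrow> g P m m 0 = P m m 0)
     \<and> (\<forall>r<N. r \<noteq> p \<longrightarrow> r \<noteq> q \<longrightarrow> g (rank_one (\<lambda>a. if a = r then 1 else 0)) = rank_one (\<lambda>a. if a = r then 1 else 0))"
proof (cases "P q q 0 = 0")
  case True
  thus ?thesis by (intro exI[of _ "\<lambda>P. P"]) (auto simp: proj_iso_id)
next
  case False
  define x where "x = P p p 0"
  define y where "y = P q q 0"
  have xy: "x \<ge> 0" "y > 0" using proj_diag_nonneg[OF P] False by (auto simp: x_def y_def less_le)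
  obtain j where j: "j < N" "j \<noteq> p" "j \<noteq> q" using exists_third by blast
  obtain u where u: "unit_elem u" "cd_mult k u (P p q) = (\<lambda>c. sqrt (cd_inner k (P p q) (P p q)) * cd_unit 0 c)"
    using exists_aligning_unit[OF proj_elem[OF P]] by blast
  define Q where "Q = phase_pt p j u P"
  have Q: "Q \<in> proj_pts k N" unfolding Q_def using u j pq P by (intro phase_pt_mem) auto
  have Qd: "Q m m = P m m" for m unfolding Q_def using j by (intro phase_pt_diag) auto
  have Qpq: "Q p q 0 = sqrt (x * y)"
    using pq j u(2) unfolding Q_def by (simp add: phase_pt_def proj_norm_entry[OF P] x_def y_def cd_unit_def)
  \<comment> \<open>\<open>(C, S)\<close> is the unit vector along \<open>(sqrt x, sqrt y)\<close>,
    which the reflection sends to the axis of \<open>p\<close>.\<close>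
  define C where "C = sqrt x / sqrt (x + y)"
  define S where "S = sqrt y / sqrt (x + y)"
  have CS: "C\<^sup>2 + S\<^sup>2 = 1" using xy by (simp add: C_def S_def power_divide flip: add_divide_distrib)
  have e: "refl_pt p q C S Q q q 0 = 0"
  proof -
    have "C * S * sqrt (x * y) = x * y / (x + y)"
      using xy by (simp add: C_def S_def real_sqrt_mult) (simp add: field_simps)
    moreover have "S\<^sup>2 * x = x * y / (x + y)" "C\<^sup>2 * y = x * y / (x + y)"
      using xy by (simp_all add: C_def S_def power_divide)
    ultimately show ?thesis
      unfolding refl_pt_entries(2)[OF pq CS Q] Qpq Qd x_def[symmetric] y_def[symmetric] by (simp add: mult.assoc)
  qed
  show ?thesis
  proof (intro exI[of _ "\<lambda>P. refl_pt p q C S (phase_pt p j u P)"] conjI allI impI)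
    show "proj_iso (\<lambda>P. refl_pt p q C S (phase_pt p j u P))"
      by (rule proj_iso_comp[OF refl_pt_iso[OF pq CS] phase_pt_iso[OF u(1)]]) (use j pq in auto)
    show "refl_pt p q C S (phase_pt p j u P) q q 0 = 0" using e by (simp add: Q_def)
    show "refl_pt p q C S (phase_pt p j u P) m m 0 = P m m 0" if "m \<noteq> p" "m \<noteq> q" for m
      using refl_pt_entries(4)[OF pq CS Q that] Qd by (simp add: Q_def)
    show "refl_pt p q C S (phase_pt p j u (rank_one (\<lambda>a. if a = r then 1 else 0))) = rank_one (\<lambda>a. if a = r then 1 else 0)"
      if "r < N" "r \<noteq> p" "r \<noteq> q" for r
      using refl_pt_fixes[OF pq CS _ _ that(1)] that j phase_pt_fixes[of p j] by simp
  qed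
qed

abbreviation "E0 \<equiv> rank_one (\<lambda>a. if a = 0 then 1 else 0)"

text \<open>Elimination with pivot 0 clears all other diagonal entries in turn. Trace 1 makes the
  remaining one equal to 1, and \<open>proj_norm_entry\<close> forces all other entries to
  vanish.\<close>

lemma proj_iso_to_E0:
  assumes P: "P \<in> proj_pts k N"
  shows "\<exists>g. proj_iso g \<and> g P = E0"
proof -
  have "\<exists>g. proj_iso g \<and> (\<forall>m. 1 \<le> m \<longrightarrow> m < r \<longrightarrow> g P m m 0 = 0)" if "r \<le> N" for r
    using that
  proof (induction r)
    case 0 show ?case using proj_iso_id by auto
  next
    case (Suc r)
    then obtain g where g: "proj_iso g" "\<And>m. 1 \<le> m \<Longrightarrow> m < r \<Longrightarrow> g P m m 0 = 0" by auto
    show ?case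
    proof (cases "r = 0")
      case True thus ?thesis using g by auto
    next
      case False
      obtain h where h: "proj_iso h" "h (g P) r r 0 = 0" "\<And>m. m \<noteq> 0 \<Longrightarrow> m \<noteq> r \<Longrightarrow> h (g P) m m 0 = g P m m 0"
        using proj_iso_kill[OF proj_iso_mem[OF g(1) P], of 0 r] False Suc.prems by auto
      have "h (g P) m m 0 = 0" if "1 \<le> m" "m < Suc r" for m
        using h(2,3) g(2) that by (cases "m = r") auto
      thus ?thesis using proj_iso_comp[OF h(1) g(1)] by blast
    qed
  qed
  from this[of N] obtain g where g: "proj_iso g" "\<And>m. 1 \<le> m \<Longrightarrow> m < N \<Longrightarrow> g P m m 0 = 0" by auto
  have Q: "g P \<in> proj_pts k N" by (rule proj_iso_mem[OF g(1) P])
  have "(\<Sum>a<N. g P a a 0) = (\<Sum>a\<in>{0}. g P a a 0)"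
    by (rule sum.mono_neutral_right) (use g(2) N in auto)
  hence one: "g P 0 0 0 = 1" using proj_trace[OF Q] by simp
  have "g P = E0"
  proof (rule rank_oneI[OF Q])
    fix a b assume ab: "a < N" "b < N"
    show "g P a b = (\<lambda>c. (if a = 0 then 1 else 0) * (if b = 0 then 1 else 0) * cd_unit 0 c)"
    proof (cases "a = 0 \<and> b = 0")
      case True thus ?thesis using proj_diag[OF Q, of 0] one by simp
    next
      case False
      hence "cd_inner k (g P a b) (g P a b) = 0"
        using g(2)[of a] g(2)[of b] ab by (auto simp: proj_norm_entry[OF Q])
      from cd_inner_self_eq_0[OF proj_elem[OF Q] this] show ?thesis using False by auto
    qed
  qed
  thus ?thesis using g(1) by blast
qed

definition std_pt :: "real \<Rightarrow> pt" where
  "std_pt s = rank_one (\<lambda>a. if a = 0 then sqrt s else if a = 1 then sqrt (1 - s) else 0)"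

text \<open>The same elimination with pivot 1, so that each step fixes \<open>E0\<close>. What is
  left lives on the first two coordinates, and a phase at 0, compensated at 2, makes its
  off-diagonal entry real.\<close>

lemma proj_iso_to_std:
  assumes P: "P \<in> proj_pts k N"
  shows "\<exists>g s. proj_iso g \<and> g E0 = E0 \<and> 0 \<le> s \<and> s \<le> 1 \<and> g P = std_pt s"
proof -
  have "\<exists>g. proj_iso g \<and> g E0 = E0 \<and> (\<forall>m. 2 \<le> m \<longrightarrow> m < r \<longrightarrow> g P m m 0 = 0)" if "r \<le> N" for r
    using that
  proof (induction r)
    case 0 show ?case using proj_iso_id by auto
  next
    case (Suc r)
    then obtain g where g: "proj_iso g" "g E0 = E0" "\<And>m. 2 \<le> m \<Longrightarrow> m < r \<Longrightarrow> g P m m 0 = 0" by auto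
    show ?case
    proof (cases "r \<le> 1")
      case True thus ?thesis using g by auto
    next
      case False
      obtain h where h: "proj_iso h" "h (g P) r r 0 = 0" "\<And>m. m \<noteq> 1 \<Longrightarrow> m \<noteq> r \<Longrightarrow> h (g P) m m 0 = g P m m 0" "h E0 = E0"
        using proj_iso_kill[OF proj_iso_mem[OF g(1) P], of 1 r] False Suc.prems N by auto
      have "h (g P) m m 0 = 0" if "2 \<le> m" "m < Suc r" for m
        using h(2,3) g(3) that by (cases "m = r") auto
      thus ?thesis using proj_iso_comp[OF h(1) g(1)] h(4) g(2) by auto
    qed
  qed
  from this[of N] obtain g where g: "proj_iso g" "g E0 = E0" "\<And>m. 2 \<le> m \<Longrightarrow> m < N \<Longrightarrow> g P m m 0 = 0" by auto
  have Q: "g P \<in> proj_pts k N" by (rule proj_iso_mem[OF g(1) P])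
  define s where "s = g P 0 0 0"
  have s: "0 \<le> s" "s \<le> 1" using proj_diag_nonneg[OF Q] proj_diag_le_1[OF Q] by (auto simp: s_def)
  have "(\<Sum>a<N. g P a a 0) = (\<Sum>a\<in>{0, 1}. g P a a 0)"
    by (rule sum.mono_neutral_right) (use g(3) N in auto)
  hence s1: "g P 1 1 0 = 1 - s" using proj_trace[OF Q] by (simp add: s_def)
  obtain u where u: "unit_elem u" "cd_mult k u (g P 0 1) = (\<lambda>c. sqrt (cd_inner k (g P 0 1) (g P 0 1)) * cd_unit 0 c)"
    using exists_aligning_unit[OF proj_elem[OF Q]] by blast
  define h where "h = phase_pt 0 2 u"
  have h: "proj_iso h" unfolding h_def using u(1) N by (intro phase_pt_iso) auto
  have R: "h (g P) \<in> proj_pts k N" by (rule proj_iso_mem[OF h Q])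
  have Rd: "h (g P) m m = g P m m" for m unfolding h_def by (rule phase_pt_diag) simp
  have R01: "h (g P) 0 1 = (\<lambda>c. sqrt s * sqrt (1 - s) * cd_unit 0 c)"
    using u(2) s1 unfolding h_def
    by (simp add: phase_pt_def proj_norm_entry[OF Q] flip: s_def) (simp add: real_sqrt_mult)
  have R10: "h (g P) 1 0 = (\<lambda>c. sqrt s * sqrt (1 - s) * cd_unit 0 c)"
  proof -
    have "cd_conj k (cd_unit 0) = cd_unit 0" by (auto simp: cd_conj_def cd_unit_def fun_eq_iff)
    thus ?thesis using R01 unfolding proj_conj[OF R, of 0 1, symmetric] by (simp add: cd_conj_scale)
  qed
  have "h (g P) = std_pt s"
    unfolding std_pt_def
  proof (rule rank_oneI[OF R])
    fix a b assume ab: "a < N" "b < N"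
    consider "a = 0" "b = 0" | "a = 0" "b = 1" | "a = 1" "b = 0" | "a = 1" "b = 1" | "a \<ge> 2 \<or> b \<ge> 2" by linarith
    thus "h (g P) a b = (\<lambda>c. (if a = 0 then sqrt s else if a = 1 then sqrt (1 - s) else 0) *
        (if b = 0 then sqrt s else if b = 1 then sqrt (1 - s) else 0) * cd_unit 0 c)"
    proof cases
      case 1 thus ?thesis using proj_diag[OF R, of 0] s by (simp add: Rd s_def[symmetric])
    next
      case 2 thus ?thesis using R01 by simp
    next
      case 3 thus ?thesis using R10 by (simp add: mult.commute)
    next
      case 4 thus ?thesis using proj_diag[OF R, of 1] s s1 by (simp add: Rd)
    next
      case 5
      hence "cd_inner k (h (g P) a b) (h (g P) a b) = 0"
        using g(3)[of a] g(3)[of b] ab by (auto simp: proj_norm_entry[OF R] Rd)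
      from cd_inner_self_eq_0[OF proj_elem[OF R] this] show ?thesis using 5 by auto
    qed
  qed
  moreover have "h E0 = E0" unfolding h_def by (rule phase_pt_fixes) simp
  ultimately show ?thesis using proj_iso_comp[OF h g(1)] g(2) s by (intro exI[of _ "\<lambda>P. h (g P)"] exI[of _ s]) auto
qed

lemma frob_E0: "frob k N E0 P = P 0 0 0"
proof -
  have "frob k N E0 P = (\<Sum>a<N. \<Sum>b<N. if b = 0 then (if a = 0 then P a b 0 else 0) else 0)"
    unfolding frob_rank_one by (intro sum.cong refl) auto
  also have "\<dots> = (\<Sum>a<N. if a = 0 then P a 0 0 else 0)"
    using N by (intro sum.cong refl) (subst sum.delta, auto)
  finally show ?thesis using N by (simp add: sum.delta)
qed

lemma proj_two_point:
  assumes "P \<in> proj_pts k N" "Q \<in> proj_pts k N"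
  shows "\<exists>g. proj_iso g \<and> g P = E0 \<and> g Q = std_pt (frob k N P Q) \<and> 0 \<le> frob k N P Q \<and> frob k N P Q \<le> 1"
proof -
  obtain g where g: "proj_iso g" "g P = E0" using proj_iso_to_E0[OF assms(1)] by blast
  obtain h s where h: "proj_iso h" "h E0 = E0" "0 \<le> s" "s \<le> 1" "h (g Q) = std_pt s"
    using proj_iso_to_std[OF proj_iso_mem[OF g(1) assms(2)]] by blast
  have hg: "proj_iso (\<lambda>P. h (g P))" by (rule proj_iso_comp[OF h(1) g(1)])
  have "frob k N P Q = frob k N (h (g P)) (h (g Q))" using hg assms by (simp add: proj_iso_def)
  also have "\<dots> = std_pt s 0 0 0" unfolding g(2) h(2,5) by (rule frob_E0)
  also have "\<dots> = s" using h(3) N by (simp add: std_pt_def rank_one_def)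
  finally show ?thesis using hg g(2) h by (intro exI[of _ "\<lambda>P. h (g P)"]) auto
qed

lemma cos_proj_dist:
  assumes "P \<in> proj_pts k N" "Q \<in> proj_pts k N"
  shows "cos (proj_dist k N P Q) = 2 * frob k N P Q - 1"
  using proj_two_point[OF assms] unfolding proj_dist_def by (auto intro!: cos_arccos)

end

lemma space_metric_sigma [simp]: "space (metric_sigma M \<rho>) = M"
  unfolding metric_sigma_def by (rule space_measure_of) auto

section \<open>The product formula\<close>

lemma sets_metric_sigma: "sets (metric_sigma M \<rho>) = sigma_sets M {{y \<in> M. \<rho> x y < r} | x r. x \<in> M}"
  unfolding metric_sigma_def by (rule sets_measure_of) auto

lemma measurable_dist_metric_sigma:
  "x \<in> M \<Longrightarrow> \<rho> x \<in> borel_measurable (metric_sigma M \<rho>)"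
  unfolding borel_measurable_iff_less by (auto simp: sets_metric_sigma)

lemma isometry_measurable:
  assumes "isometry_of M \<rho> g"
  shows "g \<in> measurable (metric_sigma M \<rho>) (metric_sigma M \<rho>)"
proof (rule measurable_sigma_sets[OF sets_metric_sigma])
  show "g \<in> space (metric_sigma M \<rho>) \<rightarrow> M" using assms by (auto simp: isometry_of_def)
  fix A assume "A \<in> {{y \<in> M. \<rho> x y < r} | x r. x \<in> M}"
  then obtain x r where A: "A = {y \<in> M. \<rho> x y < r}" "x \<in> M" by auto
  have "x \<in> g ` M" using A(2) assms by (simp add: isometry_of_def)
  then obtain x' where x': "x' \<in> M" "x = g x'" by blast
  have "g -` A \<inter> M = {y \<in> M. \<rho> x' y < r}"
    using assms x' unfolding A isometry_of_def by auto
  thus "g -` A \<inter> space (metric_sigma M \<rho>) \<in> sets (metric_sigma M \<rho>)"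
    using x' by (auto simp: sets_metric_sigma)
qed auto

lemma uniform_elem_isometry:
  fixes h :: "'a \<Rightarrow> real"
  assumes "prob_space Pr" and U: "uniform_elem Pr M \<rho> U" and g: "isometry_of M \<rho> g"
    and h: "h \<in> borel_measurable (metric_sigma M \<rho>)"
  shows "(LINT \<omega>|Pr. h (g (U \<omega>))) = (LINT \<omega>|Pr. h (U \<omega>))"
proof -
  interpret prob_space Pr by fact
  let ?MS = "metric_sigma M \<rho>"
  note [measurable] = isometry_measurable[OF g] h
  have Um [measurable]: "U \<in> measurable Pr ?MS" using U by (simp add: uniform_elem_def)
  have gU: "(\<lambda>\<omega>. g (U \<omega>)) \<in> measurable Pr ?MS" by measurable
  have "distr Pr ?MS (\<lambda>\<omega>. g (U \<omega>)) = distr Pr ?MS U"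
  proof (rule measure_eqI)
    fix A assume "A \<in> sets (distr Pr ?MS (\<lambda>\<omega>. g (U \<omega>)))"
    hence A: "A \<in> sets ?MS" by simp
    have "(\<lambda>\<omega>. g (U \<omega>)) -` A \<inter> space Pr = {\<omega> \<in> space Pr. g (U \<omega>) \<in> A}" "U -` A \<inter> space Pr = {\<omega> \<in> space Pr. U \<omega> \<in> A}"
      by auto
    moreover have "measure Pr {\<omega> \<in> space Pr. U \<omega> \<in> A} = measure Pr {\<omega> \<in> space Pr. g (U \<omega>) \<in> A}"
      using U g A by (auto simp: uniform_elem_def)
    ultimately show "emeasure (distr Pr ?MS (\<lambda>\<omega>. g (U \<omega>))) A = emeasure (distr Pr ?MS U) A"
      using A gU by (simp add: emeasure_distr emeasure_eq_measure)
  qed simp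
  moreover have "(LINT \<omega>|Pr. h (g (U \<omega>))) = (LINT y|distr Pr ?MS (\<lambda>\<omega>. g (U \<omega>)). h y)"
    by (rule integral_distr[symmetric]) (use gU h in auto)
  moreover have "(LINT \<omega>|Pr. h (U \<omega>)) = (LINT y|distr Pr ?MS U. h y)"
    by (rule integral_distr[symmetric]) (use Um h in auto)
  ultimately show ?thesis by simp
qed

lemma uniform_elem_mem: "uniform_elem Pr M \<rho> U \<Longrightarrow> \<omega> \<in> space Pr \<Longrightarrow> U \<omega> \<in> M"
  unfolding uniform_elem_def using measurable_space[of U Pr "metric_sigma M \<rho>" \<omega>] by simp

lemma uniform_elem_measurable:
  "uniform_elem Pr M \<rho> U \<Longrightarrow> h \<in> borel_measurable (metric_sigma M \<rho>) \<Longrightarrow> (\<lambda>\<omega>. h (U \<omega>)) \<in> borel_measurable Pr"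
  unfolding uniform_elem_def by (auto intro: measurable_compose)

lemma borel_measurable_jacobiP [measurable]: "jacobiP \<alpha> \<beta> n \<in> borel_measurable borel"
  unfolding jacobiP_def by (intro borel_measurable_continuous_onI continuous_intros) auto

context cd_projective
begin

abbreviation "proj_sigma \<equiv> metric_sigma (proj_pts k N) (proj_dist k N)"

lemma frob_rank_one_support:
  assumes "A \<subseteq> {..<N}" "\<And>a. a \<notin> A \<Longrightarrow> v a = 0"
  shows "frob k N (rank_one v) Q = (\<Sum>a\<in>A. \<Sum>b\<in>A. v a * v b * Q a b 0)"
proof -
  have "frob k N (rank_one v) Q = (\<Sum>a\<in>A. \<Sum>b<N. v a * v b * Q a b 0)"
    unfolding frob_rank_one by (rule sum.mono_neutral_right) (use assms in auto)
  also have "\<dots> = (\<Sum>a\<in>A. \<Sum>b\<in>A. v a * v b * Q a b 0)"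
    by (rule sum.cong[OF refl], rule sum.mono_neutral_right) (use assms in auto)
  finally show ?thesis .
qed

lemma measurable_frob:
  assumes "P \<in> proj_pts k N"
  shows "frob k N P \<in> borel_measurable proj_sigma"
proof -
  have "(\<lambda>Q. (cos (proj_dist k N P Q) + 1) / 2) \<in> borel_measurable proj_sigma"
    using measurable_dist_metric_sigma[OF assms, of "proj_dist k N"] by measurable
  also have "?this \<longleftrightarrow> ?thesis"
    by (rule measurable_cong) (simp add: cos_proj_dist[OF assms])
  finally show ?thesis .
qed

lemma measurable_diag: "q < N \<Longrightarrow> (\<lambda>Q. Q q q 0) \<in> borel_measurable proj_sigma"
proof -
  assume q: "q < N"
  have "(\<Sum>a<N. (if a = q then 1 else 0::real)\<^sup>2) = (\<Sum>a<N. if a = q then 1 else 0)"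
    by (intro sum.cong refl) auto
  hence "rank_one (\<lambda>a. if a = q then 1 else 0) \<in> proj_pts k N"
    using q by (intro rank_one_mem) (simp add: sum.delta)
  moreover have "frob k N (rank_one (\<lambda>a. if a = q then 1 else 0)) = (\<lambda>Q. Q q q 0)"
    by (rule ext) (subst frob_rank_one_support[of "{q}"], use q in auto)
  ultimately show ?thesis using measurable_frob by metis
qed

text \<open>The sigma algebra makes distances measurable, so coordinates must be recovered from
  distances: diagonal entries from the coordinate points, and this one by polarisation, from the
  point with two homogeneous coordinates \<open>1 / sqrt 2\<close>.\<close>

lemma measurable_offdiag:
  assumes q: "0 < q" "q < N"
  shows "(\<lambda>Q. Q 0 q 0) \<in> borel_measurable proj_sigma"
proof -
  define v where "v a = (if a \<in> {0, q} then 1 / sqrt 2 else 0)" for a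
  have "(\<Sum>a<N. (v a)\<^sup>2) = (\<Sum>a\<in>{0, q}. (v a)\<^sup>2)"
    by (rule sum.mono_neutral_right) (use q in \<open>auto simp: v_def\<close>)
  also have "\<dots> = 1" using q by (simp add: v_def power_divide)
  finally have "rank_one v \<in> proj_pts k N" by (rule rank_one_mem)
  note m = measurable_frob[OF this]
  have "(\<lambda>Q. frob k N (rank_one v) Q - (Q 0 0 0 + Q q q 0) / 2) \<in> borel_measurable proj_sigma"
    by (intro borel_measurable_diff borel_measurable_divide borel_measurable_add m measurable_diag borel_measurable_const)
      (use q N in auto)
  also have "?this \<longleftrightarrow> ?thesis"
  proof (rule measurable_cong)
    fix Q assume "Q \<in> space proj_sigma"
    hence "Q q 0 0 = Q 0 q 0" using proj_conj[of Q 0 q] by (metis cd_conj_0 space_metric_sigma)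
    thus "frob k N (rank_one v) Q - (Q 0 0 0 + Q q q 0) / 2 = Q 0 q 0"
      using q frob_rank_one_support[of "{0, q}" v Q] by (simp add: v_def field_simps)
  qed
  finally show ?thesis .
qed

lemma frob_std_pt:
  assumes P: "P \<in> proj_pts k N" and s: "0 \<le> s" "s \<le> 1"
  shows "frob k N (std_pt s) P = s * P 0 0 0 + (1 - s) * P 1 1 0 + 2 * sqrt (s * (1 - s)) * P 0 1 0"
proof -
  have P01: "P 1 0 0 = P 0 1 0" using proj_conj[OF P, of 0 1] by (metis cd_conj_0)
  have N01: "{0, 1} \<subseteq> {..<N}" using N by auto
  have sq: "sqrt s * (sqrt s * z) = s * z" "sqrt (1 - s) * (sqrt (1 - s) * z) = (1 - s) * z" for z
    using s by (simp_all flip: mult.assoc)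
  show ?thesis
    using P01 N01 frob_rank_one_support[of "{0, 1}" "\<lambda>a. if a = 0 then sqrt s else if a = 1 then sqrt (1 - s) else 0" P]
    by (simp add: std_pt_def real_sqrt_mult mult_ac sq)
qed

context
  fixes Pr :: "'w measure" and U :: "'w \<Rightarrow> pt"
  assumes Pr: "prob_space Pr" and U: "uniform_elem Pr (proj_pts k N) (proj_dist k N) U"
begin

lemma U_mem: "\<omega> \<in> space Pr \<Longrightarrow> U \<omega> \<in> proj_pts k N"
  by (rule uniform_elem_mem[OF U])

lemma integral_proj_iso:
  fixes h :: "pt \<Rightarrow> real"
  assumes "proj_iso g" "h \<in> borel_measurable proj_sigma"
  shows "(LINT \<omega>|Pr. h (g (U \<omega>))) = (LINT \<omega>|Pr. h (U \<omega>))"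
  by (rule uniform_elem_isometry[OF Pr U proj_iso_isometry[OF assms(1)] assms(2)])

text \<open>Phases can bring each of the \<open>2 ^ k\<close> components of the entry to the real
  position without touching the diagonal, so all of them have the same weighted second moment. Their
  squares add up to the product of two diagonal entries by rank one.\<close>

lemma offdiag_square:
  assumes q: "q \<ge> 1" "q < N"
  shows "real (2 ^ k) * (LINT \<omega>|Pr. (U \<omega> 0 q 0)\<^sup>2 * U \<omega> 0 0 0 ^ i * U \<omega> 1 1 0 ^ j) =
     (LINT \<omega>|Pr. U \<omega> 0 0 0 ^ Suc i * U \<omega> q q 0 * U \<omega> 1 1 0 ^ j)"
proof -
  interpret prob_space Pr by (rule Pr)
  define h where "h Q = (Q 0 q 0)\<^sup>2 * Q 0 0 0 ^ i * Q 1 1 0 ^ j" for Q :: pt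
  have h: "h \<in> borel_measurable proj_sigma"
    unfolding h_def
    by (intro borel_measurable_times borel_measurable_power measurable_diag measurable_offdiag) (use q N in auto)
  obtain l where l: "l < N" "l \<noteq> 0" "l \<noteq> q" using exists_third by blast
  \<comment> \<open>The compensating phase sits at \<open>l\<close>, away from \<open>q\<close>, so
    the entry \<open>(0, q)\<close> undergoes a plain left multiplication.\<close>
  define g where "g c = phase_pt 0 l (cd_conj k (cd_unit c))" for c
  have unit: "unit_elem (cd_unit c)" if "c < 2 ^ k" for c
    using that by (simp add: unit_elem_def cd_inner_unit cd_elem_arith) (simp add: cd_unit_def)
  have g: "proj_iso (g c)" if "c < 2 ^ k" for c
    unfolding g_def using l by (intro phase_pt_iso unit_elem_conj unit that) auto
  have gh: "h (g c Q) = (Q 0 q c)\<^sup>2 * Q 0 0 0 ^ i * Q 1 1 0 ^ j" if c: "c < 2 ^ k" and Q: "Q \<in> proj_pts k N" for c Q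
  proof -
    have e: "cd_elem k (cd_unit c)" "cd_elem k (cd_unit 0)" using c by (auto intro: cd_elem_arith)
    have "g c Q 0 q 0 = cd_inner k (cd_mult k (cd_conj k (cd_unit c)) (Q 0 q)) (cd_unit 0)"
      using q l by (simp add: g_def phase_pt_def cd_inner_unit)
    also have "\<dots> = cd_inner k (Q 0 q) (cd_unit c)"
      using cd_inner_mult_adjoint_left[OF k _ proj_elem[OF Q] e(2), of "cd_conj k (cd_unit c)" 0 q] e
      by (simp add: cd_conj_conj cd_mult_one)
    finally show ?thesis using c phase_pt_diag[of 0 l] l by (simp add: h_def g_def cd_inner_unit)
  qed
  have int: "integrable Pr (\<lambda>\<omega>. (U \<omega> 0 q c)\<^sup>2 * U \<omega> 0 0 0 ^ i * U \<omega> 1 1 0 ^ j)" if c: "c < 2 ^ k" for c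
  proof (rule integrable_const_bound[where B = 1])
    have "(\<lambda>Q. h (g c Q)) \<in> borel_measurable proj_sigma"
      using isometry_measurable[OF proj_iso_isometry[OF g[OF c]]] h by measurable
    from uniform_elem_measurable[OF U this]
    have "(\<lambda>\<omega>. h (g c (U \<omega>))) \<in> borel_measurable Pr" .
    also have "?this \<longleftrightarrow> (\<lambda>\<omega>. (U \<omega> 0 q c)\<^sup>2 * U \<omega> 0 0 0 ^ i * U \<omega> 1 1 0 ^ j) \<in> borel_measurable Pr"
      by (rule measurable_cong) (simp add: gh[OF c] U_mem)
    finally show "(\<lambda>\<omega>. (U \<omega> 0 q c)\<^sup>2 * U \<omega> 0 0 0 ^ i * U \<omega> 1 1 0 ^ j) \<in> borel_measurable Pr" .
    show "AE \<omega> in Pr. norm ((U \<omega> 0 q c)\<^sup>2 * U \<omega> 0 0 0 ^ i * U \<omega> 1 1 0 ^ j) \<le> 1"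
    proof (rule AE_I2)
      fix \<omega> assume "\<omega> \<in> space Pr"
      note P = U_mem[OF this]
      have "U \<omega> 0 q c * U \<omega> 0 q c \<le> cd_inner k (U \<omega> 0 q) (U \<omega> 0 q)"
        unfolding cd_inner_def by (rule member_le_sum) (use c in auto)
      also have "\<dots> \<le> 1" unfolding proj_norm_entry[OF P]
        using proj_diag_le_1[OF P] proj_diag_nonneg[OF P] by (intro mult_le_one) auto
      finally have "(U \<omega> 0 q c)\<^sup>2 \<le> 1" by (simp add: power2_eq_square)
      moreover have "U \<omega> 0 0 0 ^ i \<le> 1" "U \<omega> 1 1 0 ^ j \<le> 1"
        using proj_diag_le_1[OF P] proj_diag_nonneg[OF P] by (auto intro: power_le_one)
      moreover have "0 \<le> U \<omega> 0 0 0 ^ i" "0 \<le> U \<omega> 1 1 0 ^ j" using proj_diag_nonneg[OF P] by auto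
      ultimately show "norm ((U \<omega> 0 q c)\<^sup>2 * U \<omega> 0 0 0 ^ i * U \<omega> 1 1 0 ^ j) \<le> 1"
        by (simp add: abs_mult mult_le_one)
    qed
  qed
  have "(LINT \<omega>|Pr. U \<omega> 0 0 0 ^ Suc i * U \<omega> q q 0 * U \<omega> 1 1 0 ^ j)
      = (LINT \<omega>|Pr. (\<Sum>c<2 ^ k. (U \<omega> 0 q c)\<^sup>2 * U \<omega> 0 0 0 ^ i * U \<omega> 1 1 0 ^ j))"
  proof (rule Bochner_Integration.integral_cong[OF refl])
    fix \<omega> assume "\<omega> \<in> space Pr"
    note P = U_mem[OF this]
    have "(\<Sum>c<2 ^ k. (U \<omega> 0 q c)\<^sup>2) = U \<omega> 0 0 0 * U \<omega> q q 0"
      using proj_norm_entry[OF P, of 0 q] by (simp add: cd_inner_def power2_eq_square)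
    thus "U \<omega> 0 0 0 ^ Suc i * U \<omega> q q 0 * U \<omega> 1 1 0 ^ j = (\<Sum>c<2 ^ k. (U \<omega> 0 q c)\<^sup>2 * U \<omega> 0 0 0 ^ i * U \<omega> 1 1 0 ^ j)"
      by (simp add: mult_ac flip: sum_distrib_right sum_distrib_left)
  qed
  also have "\<dots> = (\<Sum>c<2 ^ k. (LINT \<omega>|Pr. (U \<omega> 0 q c)\<^sup>2 * U \<omega> 0 0 0 ^ i * U \<omega> 1 1 0 ^ j))"
    by (rule Bochner_Integration.integral_sum) (use int in auto)
  also have "\<dots> = (\<Sum>c<(2::nat) ^ k. (LINT \<omega>|Pr. h (U \<omega>)))"
  proof (intro sum.cong refl)
    fix c :: nat assume "c \<in> {..<2 ^ k}"
    hence c: "c < 2 ^ k" by simp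
    have "(LINT \<omega>|Pr. (U \<omega> 0 q c)\<^sup>2 * U \<omega> 0 0 0 ^ i * U \<omega> 1 1 0 ^ j) = (LINT \<omega>|Pr. h (g c (U \<omega>)))"
      by (rule Bochner_Integration.integral_cong) (simp_all add: gh[OF c] U_mem)
    also have "\<dots> = (LINT \<omega>|Pr. h (U \<omega>))" by (rule integral_proj_iso[OF g[OF c] h])
    finally show "(LINT \<omega>|Pr. (U \<omega> 0 q c)\<^sup>2 * U \<omega> 0 0 0 ^ i * U \<omega> 1 1 0 ^ j) = (LINT \<omega>|Pr. h (U \<omega>))" .
  qed
  finally show ?thesis by (simp add: h_def)
qed

lemma proj_jordan_frame: "jordan_frame Pr N (2 ^ k) (\<lambda>q \<omega>. U \<omega> q q 0) (\<lambda>q \<omega>. U \<omega> 0 q 0)"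
proof -
  interpret prob_space Pr by (rule Pr)
  show ?thesis
  proof
    show "N \<ge> 2" "(2::nat) ^ k \<ge> 1" using N by auto
    show "(\<lambda>\<omega>. U \<omega> q q 0) \<in> borel_measurable Pr" if "q < N" for q
      by (rule uniform_elem_measurable[OF U measurable_diag[OF that]])
    show "(\<lambda>\<omega>. U \<omega> 0 q 0) \<in> borel_measurable Pr" if "1 \<le> q" "q < N" for q
      by (rule uniform_elem_measurable[OF U measurable_offdiag]) (use that in auto)
    show "\<bar>U \<omega> q q 0\<bar> \<le> 1" if "q < N" "\<omega> \<in> space Pr" for q \<omega>
      using proj_diag_le_1[OF U_mem[OF that(2)]] proj_diag_nonneg[OF U_mem[OF that(2)]] by simp
    show "\<bar>U \<omega> 0 q 0\<bar> \<le> 1" if "\<omega> \<in> space Pr" for q \<omega>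
    proof -
      note P = U_mem[OF that]
      have "U \<omega> 0 q 0 * U \<omega> 0 q 0 \<le> cd_inner k (U \<omega> 0 q) (U \<omega> 0 q)"
        unfolding cd_inner_def by (rule member_le_sum) auto
      also have "\<dots> \<le> 1" unfolding proj_norm_entry[OF P]
        using proj_diag_le_1[OF P] proj_diag_nonneg[OF P] by (intro mult_le_one) auto
      finally have "(U \<omega> 0 q 0)\<^sup>2 \<le> 1" by (simp add: power2_eq_square)
      thus ?thesis by (simp only: abs_square_le_1)
    qed
    show "(\<Sum>q<N. U \<omega> q q 0) = 1" if "\<omega> \<in> space Pr" for \<omega>
      by (rule proj_trace[OF U_mem[OF that]])
    show "real (2 ^ k) * expectation (\<lambda>\<omega>. (U \<omega> 0 q 0)\<^sup>2 * U \<omega> 0 0 0 ^ i * U \<omega> 1 1 0 ^ j) =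
     expectation (\<lambda>\<omega>. U \<omega> 0 0 0 ^ Suc i * U \<omega> q q 0 * U \<omega> 1 1 0 ^ j)" if "1 \<le> q" "q < N" for q i j
      by (rule offdiag_square[OF that])
    fix q :: nat and C S :: real and F :: "real \<times> real \<times> real \<times> real \<Rightarrow> real"
    assume q: "1 \<le> q" "q < N" and CS: "C\<^sup>2 + S\<^sup>2 = 1" and F: "F \<in> borel_measurable borel"
    have pq: "0 < N" "q < N" "0 \<noteq> q" using q by auto
    define h where "h Q = F (Q 0 0 0, Q q q 0, Q 0 q 0, Q 1 1 0)" for Q :: pt
    have h: "h \<in> borel_measurable proj_sigma"
      unfolding h_def
      by (rule measurable_compose[OF _ F], intro borel_measurable_Pair measurable_diag measurable_offdiag) (use q N in auto)
    have "expectation (\<lambda>\<omega>. h (refl_pt 0 q C S (U \<omega>))) = expectation (\<lambda>\<omega>. h (U \<omega>))"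
      by (rule integral_proj_iso[OF refl_pt_iso[OF pq CS] h])
    moreover have "expectation (\<lambda>\<omega>. h (refl_pt 0 q C S (U \<omega>))) = expectation (\<lambda>\<omega>. F (C\<^sup>2 * U \<omega> 0 0 0 + S\<^sup>2 * U \<omega> q q 0 + 2 * C * S * U \<omega> 0 q 0,
          S\<^sup>2 * U \<omega> 0 0 0 + C\<^sup>2 * U \<omega> q q 0 - 2 * C * S * U \<omega> 0 q 0,
          C * S * (U \<omega> 0 0 0 - U \<omega> q q 0) - (C\<^sup>2 - S\<^sup>2) * U \<omega> 0 q 0,
          if q = 1 then S\<^sup>2 * U \<omega> 0 0 0 + C\<^sup>2 * U \<omega> q q 0 - 2 * C * S * U \<omega> 0 q 0 else U \<omega> 1 1 0))"
    proof (rule Bochner_Integration.integral_cong[OF refl])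
      fix \<omega> assume "\<omega> \<in> space Pr"
      note P = U_mem[OF this]
      have "refl_pt 0 q C S (U \<omega>) 1 1 0 = (if q = 1 then S\<^sup>2 * U \<omega> 0 0 0 + C\<^sup>2 * U \<omega> q q 0 - 2 * C * S * U \<omega> 0 q 0 else U \<omega> 1 1 0)"
        using refl_pt_entries(2)[OF pq CS P] refl_pt_entries(4)[OF pq CS P, of 1] by auto
      thus "h (refl_pt 0 q C S (U \<omega>)) = F (C\<^sup>2 * U \<omega> 0 0 0 + S\<^sup>2 * U \<omega> q q 0 + 2 * C * S * U \<omega> 0 q 0,
          S\<^sup>2 * U \<omega> 0 0 0 + C\<^sup>2 * U \<omega> q q 0 - 2 * C * S * U \<omega> 0 q 0,
          C * S * (U \<omega> 0 0 0 - U \<omega> q q 0) - (C\<^sup>2 - S\<^sup>2) * U \<omega> 0 q 0,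
          if q = 1 then S\<^sup>2 * U \<omega> 0 0 0 + C\<^sup>2 * U \<omega> q q 0 - 2 * C * S * U \<omega> 0 q 0 else U \<omega> 1 1 0)"
        unfolding h_def refl_pt_entries(1-3)[OF pq CS P] by simp
    qed
    ultimately show "expectation (\<lambda>\<omega>. F (U \<omega> 0 0 0, U \<omega> q q 0, U \<omega> 0 q 0, U \<omega> 1 1 0)) =
       expectation (\<lambda>\<omega>. F (C\<^sup>2 * U \<omega> 0 0 0 + S\<^sup>2 * U \<omega> q q 0 + 2 * C * S * U \<omega> 0 q 0,
          S\<^sup>2 * U \<omega> 0 0 0 + C\<^sup>2 * U \<omega> q q 0 - 2 * C * S * U \<omega> 0 q 0,
          C * S * (U \<omega> 0 0 0 - U \<omega> q q 0) - (C\<^sup>2 - S\<^sup>2) * U \<omega> 0 q 0,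
          if q = 1 then S\<^sup>2 * U \<omega> 0 0 0 + C\<^sup>2 * U \<omega> q q 0 - 2 * C * S * U \<omega> 0 q 0 else U \<omega> 1 1 0))"
      unfolding h_def by simp
  qed
qed

lemma proj_product_formula:
  assumes x: "x1 \<in> proj_pts k N" "x2 \<in> proj_pts k N"
    and \<beta>: "\<beta> = 2 ^ k / 2 - 1" and \<alpha>: "\<alpha> = (real N - 1) * 2 ^ k / 2 - 1"
  shows "(jacobi_a \<alpha> \<beta> n)\<^sup>2 * (LINT \<omega>|Pr. jacobiP \<alpha> \<beta> n (cos (proj_dist k N x1 (U \<omega>))) *
      jacobiP \<alpha> \<beta> n (cos (proj_dist k N x2 (U \<omega>)))) = jacobiP \<alpha> \<beta> n (cos (proj_dist k N x1 x2))"
proof -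
  have N3: "3 \<le> N" by (rule N)
  interpret jordan_frame Pr N "2 ^ k" "\<lambda>q \<omega>. U \<omega> q q 0" "\<lambda>q \<omega>. U \<omega> 0 q 0" by (rule proj_jordan_frame)
  define s where "s = frob k N x1 x2"
  obtain g where g: "proj_iso g" "g x1 = E0" "g x2 = std_pt s" and s: "0 \<le> s" "s \<le> 1"
    using proj_two_point[OF x] unfolding s_def by blast
  have E: "E0 \<in> proj_pts k N" "std_pt s \<in> proj_pts k N" using proj_iso_mem[OF g(1)] x g by metis+
  let ?P = "jacobiP \<alpha> \<beta> n"
  define h where "h Q = ?P (cos (proj_dist k N E0 Q)) * ?P (cos (proj_dist k N (std_pt s) Q))" for Q
  have h: "h \<in> borel_measurable proj_sigma"
    using measurable_dist_metric_sigma[OF E(1), of "proj_dist k N"] measurable_dist_metric_sigma[OF E(2), of "proj_dist k N"]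
    unfolding h_def by measurable
  have d: "proj_dist k N x1 Q = proj_dist k N E0 (g Q)" "proj_dist k N x2 Q = proj_dist k N (std_pt s) (g Q)"
    if "Q \<in> proj_pts k N" for Q
    using g x that by (auto simp: proj_dist_def proj_iso_def)
  have "(LINT \<omega>|Pr. ?P (cos (proj_dist k N x1 (U \<omega>))) * ?P (cos (proj_dist k N x2 (U \<omega>)))) = (LINT \<omega>|Pr. h (g (U \<omega>)))"
    by (rule Bochner_Integration.integral_cong) (simp_all add: d U_mem h_def)
  also have "\<dots> = (LINT \<omega>|Pr. h (U \<omega>))" by (rule integral_proj_iso[OF g(1) h])
  also have "\<dots> = expectation (\<lambda>\<omega>. ?P (2 * U \<omega> 0 0 0 - 1) *
     ?P (2 * (s * U \<omega> 0 0 0 + (1 - s) * U \<omega> 1 1 0 + 2 * sqrt (s * (1 - s)) * U \<omega> 0 1 0) - 1))"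
    by (rule Bochner_Integration.integral_cong)
       (simp_all add: h_def cos_proj_dist E U_mem frob_E0 frob_std_pt s)
  finally have "(jacobi_a \<alpha> \<beta> n)\<^sup>2 * (LINT \<omega>|Pr. ?P (cos (proj_dist k N x1 (U \<omega>))) * ?P (cos (proj_dist k N x2 (U \<omega>))))
     = ?P (2 * s - 1)"
  proof (simp only:, intro jacobi_product_formula s)
    \<comment> \<open>Half of this product is \<open>c\<close>, hence \<open>c\<close> is at least
      3/2.\<close>
    have "3 * 1 \<le> real N * 2 ^ k" using N3 by (intro mult_mono) auto
    thus "1 < c" by (simp add: c_def a_def)
  qed (simp_all add: \<alpha> \<beta> a_def c_def algebra_simps diff_divide_distrib)
  thus ?thesis by (simp add: cos_proj_dist[OF x] s_def)
qed

end

end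

section \<open>The sphere\<close>

locale unit_sphere =
  fixes d :: nat
  assumes d: "d \<ge> 2"
begin

definition ip :: "pt \<Rightarrow> pt \<Rightarrow> real" where
  "ip x y = (\<Sum>i<d + 1. x i 0 0 * y i 0 0)"

definition column :: "pt \<Rightarrow> bool" where
  "column x \<longleftrightarrow> (\<forall>i j c. \<not> (i < d + 1 \<and> j = 0 \<and> c = 0) \<longrightarrow> x i j c = 0)"

definition comb :: "real \<Rightarrow> pt \<Rightarrow> real \<Rightarrow> pt \<Rightarrow> pt" where
  "comb r x t y = (\<lambda>i j c. r * x i j c + t * y i j c)"

abbreviation "S \<equiv> sphere_pts d"
abbreviation "sphere_sigma \<equiv> metric_sigma S (sphere_dist d)"

lemma frob_column:
  assumes "column x"
  shows "frob 0 (d + 1) x y = ip x y"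
proof -
  have "(\<Sum>j<d + 1. \<Sum>c<2 ^ 0. x i j c * y i j c) = (\<Sum>j\<in>{0}. \<Sum>c<2 ^ 0. x i j c * y i j c)" for i
    by (rule sum.mono_neutral_right) (use assms in \<open>auto simp: column_def\<close>)
  thus ?thesis by (simp add: frob_def ip_def)
qed

lemma sphere_iff: "x \<in> S \<longleftrightarrow> column x \<and> ip x x = 1"
proof
  assume x: "x \<in> S"
  have "column x"
    unfolding column_def
  proof (intro allI impI)
    fix i j c :: nat assume "\<not> (i < d + 1 \<and> j = 0 \<and> c = 0)"
    thus "x i j c = 0" using x by (cases "c = 0"; cases "j = 0") (auto simp: sphere_pts_def supported_def)
  qed
  thus "column x \<and> ip x x = 1" using x frob_column[of x x] by (simp add: sphere_pts_def)
next
  assume x: "column x \<and> ip x x = 1"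
  thus "x \<in> S" using frob_column[of x x] by (auto simp: sphere_pts_def supported_def column_def)
qed

lemma column_comb: "column x \<Longrightarrow> column y \<Longrightarrow> column (comb r x t y)"
  by (auto simp: column_def comb_def)

lemma ip_comb: "ip (comb r x t y) z = r * ip x z + t * ip y z" "ip z (comb r x t y) = r * ip z x + t * ip z y"
  by (simp_all add: ip_def comb_def algebra_simps sum.distrib sum_distrib_left)

lemma ip_commute: "ip x y = ip y x"
  by (simp add: ip_def mult.commute)

lemma ip_self_eq_0:
  assumes "column x" "ip x x = 0"
  shows "x = (\<lambda>i j c. 0)"
proof -
  have "\<forall>i\<in>{..<d + 1}. x i 0 0 * x i 0 0 = 0"
    using assms(2) unfolding ip_def by (subst (asm) sum_nonneg_eq_0_iff) auto
  hence "x i 0 0 = 0" if "i < d + 1" for i using that by simp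
  hence "x i j c = 0" for i j c
    using assms(1) unfolding column_def by (cases "i < d + 1 \<and> j = 0 \<and> c = 0") blast+
  thus ?thesis by (intro ext)
qed

lemma abs_ip_le_1:
  assumes "x \<in> S" "y \<in> S"
  shows "\<bar>ip x y\<bar> \<le> 1"
proof -
  have "ip x x = 1" "ip y y = 1" using assms by (auto simp: sphere_iff)
  moreover have "ip (comb 1 x r y) (comb 1 x r y) \<ge> 0" for r
    unfolding ip_def by (intro sum_nonneg) auto
  from this[of 1] this[of "-1"] have "ip x x + 2 * ip x y + ip y y \<ge> 0" "ip x x - 2 * ip x y + ip y y \<ge> 0"
    by (simp_all add: ip_comb ip_commute[of y x])
  ultimately show ?thesis by linarith
qed

lemma sphere_dist_eq: "x \<in> S \<Longrightarrow> sphere_dist d x y = arccos (ip x y)"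
  unfolding sphere_dist_def by (subst frob_column) (auto simp: sphere_iff)

lemma cos_sphere_dist: "x \<in> S \<Longrightarrow> y \<in> S \<Longrightarrow> cos (sphere_dist d x y) = ip x y"
  using abs_ip_le_1[of x y] by (simp add: sphere_dist_eq abs_le_iff)

text \<open>For \<open>ip v v = 0\<close> division by zero makes the coefficient 0 and the map the
  identity, so the reflection along a difference of two points is meaningful also when they
  coincide.\<close>

definition householder :: "pt \<Rightarrow> pt \<Rightarrow> pt" where
  "householder v x = comb 1 x (- 2 * ip x v / ip v v) v"

lemma ip_householder: "ip (householder v x) (householder v y) = ip x y"
proof (cases "ip v v = 0")
  case True thus ?thesis by (simp add: householder_def ip_comb)
next
  case False
  define r where "r = - 2 * ip x v / ip v v"
  define t where "t = - 2 * ip y v / ip v v"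
  have e: "r * ip v v = - 2 * ip x v" "r * ip y v = t * ip x v" using False by (simp_all add: r_def t_def)
  have "ip (householder v x) (householder v y) = ip x y + t * ip x v + (r * ip y v + t * (r * ip v v))"
    unfolding householder_def r_def[symmetric] t_def[symmetric] ip_comb ip_commute[of v y]
    by (simp add: algebra_simps)
  thus ?thesis unfolding e by simp
qed

lemma householder_householder: "householder v (householder v x) = x"
proof (cases "ip v v = 0")
  case True thus ?thesis by (simp add: householder_def comb_def)
next
  case False
  hence "ip (householder v x) v = - ip x v" by (simp add: householder_def ip_comb)
  thus ?thesis
    unfolding householder_def[of v "householder v x"] by (simp add: householder_def comb_def)
qed

lemma householder_mem: "column v \<Longrightarrow> x \<in> S \<Longrightarrow> householder v x \<in> S"
  by (simp add: sphere_iff ip_householder) (simp add: householder_def column_comb)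

lemma householder_isometry:
  assumes "column v"
  shows "isometry_of S (sphere_dist d) (householder v)"
proof -
  have "x \<in> householder v ` S" if "x \<in> S" for x
    by (rule image_eqI[of _ _ "householder v x"]) (use that householder_mem[OF assms] householder_householder in auto)
  moreover have "sphere_dist d (householder v x) (householder v y) = sphere_dist d x y" if "x \<in> S" "y \<in> S" for x y
    using householder_mem[OF assms that(1)] that by (simp add: sphere_dist_eq ip_householder)
  ultimately show ?thesis using householder_mem[OF assms] unfolding isometry_of_def by blast
qed

lemma householder_maps:
  assumes "x \<in> S" "y \<in> S"
  shows "householder (comb 1 x (-1) y) x = y"
proof -
  let ?v = "comb 1 x (-1) y"
  have xy: "ip x x = 1" "ip y y = 1" "column x" "column y" using assms by (auto simp: sphere_iff)
  have e: "ip ?v ?v = 2 - 2 * ip x y" "ip x ?v = 1 - ip x y"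
    using xy by (simp_all add: ip_comb ip_commute[of y x])
  show ?thesis
  proof (cases "ip ?v ?v = 0")
    case True
    hence "?v = (\<lambda>i j c. 0)" using xy by (intro ip_self_eq_0 column_comb)
    hence "x = y" by (simp add: comb_def fun_eq_iff)
    thus ?thesis by (simp add: householder_def comb_def)
  next
    case False
    hence "- 2 * ip x ?v / ip ?v ?v = - 1" unfolding e by (simp add: field_simps)
    thus ?thesis by (simp add: householder_def comb_def)
  qed
qed

definition orthonormal :: "pt \<Rightarrow> pt \<Rightarrow> bool" where
  "orthonormal x b \<longleftrightarrow> x \<in> S \<and> b \<in> S \<and> ip x b = 0"

text \<open>Two reflections: the one along \<open>x - x'\<close> takes \<open>x\<close> to
  \<open>x'\<close>, the one along \<open>b1 - b'\<close> takes the image \<open>b1\<close> of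
  \<open>b\<close> to \<open>b'\<close>. The second fixes \<open>x'\<close>, which is orthogonal to
  both \<open>b1\<close> and \<open>b'\<close>.\<close>

lemma two_frame_transitive:
  assumes "orthonormal x b" "orthonormal x' b'"
  shows "\<exists>g. isometry_of S (sphere_dist d) g \<and> (\<forall>y\<in>S. ip x' (g y) = ip x y \<and> ip b' (g y) = ip b y)"
proof -
  define v where "v = comb 1 x (-1) x'"
  define b1 where "b1 = householder v b"
  define w where "w = comb 1 b1 (-1) b'"
  have xb: "x \<in> S" "b \<in> S" "ip x b = 0" "x' \<in> S" "b' \<in> S" "ip x' b' = 0" using assms by (auto simp: orthonormal_def)
  have v: "column v" unfolding v_def using xb by (auto simp: sphere_iff intro: column_comb)
  have b1: "b1 \<in> S" unfolding b1_def by (rule householder_mem[OF v xb(2)])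
  have w: "column w" unfolding w_def using xb b1 by (auto simp: sphere_iff intro: column_comb)
  have vx: "householder v x = x'" unfolding v_def by (rule householder_maps[OF xb(1,4)])
  have "ip x' b1 = ip x b" unfolding b1_def vx[symmetric] by (rule ip_householder)
  hence "ip x' w = 0" unfolding w_def ip_comb using xb by simp
  hence wx: "householder w x' = x'" by (simp add: householder_def comb_def)
  have wb: "householder w b1 = b'" unfolding w_def by (rule householder_maps[OF b1 xb(5)])
  let ?g = "\<lambda>y. householder w (householder v y)"
  have "isometry_of S (sphere_dist d) ?g"
  proof -
    have "?g ` S = householder w ` householder v ` S" by (simp add: image_image)
    thus ?thesis using householder_isometry[OF v] householder_isometry[OF w] householder_mem[OF v]
      by (simp add: isometry_of_def)
  qed
  moreover have "ip x' (?g y) = ip x y" for y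
    using ip_householder[of w x' "householder v y"] ip_householder[of v x y] by (simp add: wx vx)
  moreover have "ip b' (?g y) = ip b y" for y
    using ip_householder[of w b1 "householder v y"] ip_householder[of v b y] by (simp add: wb flip: b1_def)
  ultimately show ?thesis by blast
qed

definition basis :: "nat \<Rightarrow> pt" where
  "basis m = (\<lambda>i j c. if i = m \<and> j = 0 \<and> c = 0 then 1 else 0)"

lemma ip_basis: "m \<le> d \<Longrightarrow> ip (basis m) y = y m 0 0"
  by (simp add: ip_def basis_def if_distrib[of "\<lambda>r. r * _"] cong: if_cong)

lemma basis_mem: "m \<le> d \<Longrightarrow> basis m \<in> S"
  unfolding sphere_iff using ip_basis[of m "basis m"] by (auto simp: column_def) (auto simp: basis_def)

lemma orthonormal_basis: "m \<le> d \<Longrightarrow> l \<le> d \<Longrightarrow> m \<noteq> l \<Longrightarrow> orthonormal (basis m) (basis l)"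
  by (simp add: orthonormal_def basis_mem ip_basis) (simp add: basis_def)

lemma orthonormal_decomposition:
  assumes "x \<in> S" "y \<in> S"
  obtains b where "orthonormal x b" "y = comb (ip x y) x (sqrt (1 - (ip x y)\<^sup>2)) b"
proof -
  define q where "q = ip x y"
  define z where "z = comb 1 y (- q) x"
  have xy: "ip x x = 1" "ip y y = 1" "column x" "column y" using assms by (auto simp: sphere_iff)
  have q: "q\<^sup>2 \<le> 1" using abs_ip_le_1[OF assms] by (simp add: q_def abs_square_le_1)
  have zz: "ip z z = 1 - q\<^sup>2" "ip x z = 0"
    using xy by (simp_all add: z_def ip_comb ip_commute[of y x] q_def power2_eq_square algebra_simps)
  have cz: "column z" using xy by (simp add: z_def column_comb)
  show ?thesis
  proof (cases "q\<^sup>2 = 1")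
    case True
    \<comment> \<open>Now \<open>y\<close> is \<open>x\<close> or its antipode and any unit vector
      orthogonal to \<open>x\<close> serves: the image of \<open>basis 1\<close> under the
      reflection that takes \<open>basis 0\<close> to \<open>x\<close>.\<close>
    hence "z = (\<lambda>i j c. 0)" using zz cz by (intro ip_self_eq_0) auto
    hence y: "y = comb q x 0 b" for b by (simp add: z_def comb_def fun_eq_iff)
    define v where "v = comb 1 (basis 0) (-1) x"
    have v: "column v" unfolding v_def using xy basis_mem[of 0] by (auto simp: sphere_iff intro: column_comb)
    define b where "b = householder v (basis 1)"
    have vx: "householder v (basis 0) = x" unfolding v_def by (rule householder_maps) (auto simp: basis_mem assms)
    have "b \<in> S" unfolding b_def by (rule householder_mem[OF v basis_mem]) (use d in simp)
    moreover have "ip x b = 0"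
      unfolding b_def vx[symmetric] ip_householder by (subst ip_basis) (auto simp: basis_def)
    ultimately have orth: "orthonormal x b" using assms by (simp add: orthonormal_def)
    have sq: "sqrt (1 - q\<^sup>2) = 0" using True by simp
    have "y = comb q x (sqrt (1 - q\<^sup>2)) b" unfolding sq by (rule y)
    thus ?thesis unfolding q_def by (rule that[OF orth])
  next
    case False
    define r where "r = sqrt (1 - q\<^sup>2)"
    have r: "r > 0" "r\<^sup>2 = 1 - q\<^sup>2" using q False by (auto simp: r_def)
    define b where "b = comb (1 / r) z 0 z"
    have "ip b b = 1" using zz r by (simp add: b_def ip_comb power2_eq_square field_simps)
    moreover have "ip x b = 0" using zz by (simp add: b_def ip_comb)
    ultimately have orth: "orthonormal x b" using assms cz by (simp add: orthonormal_def sphere_iff b_def column_comb)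
    have "y = comb q x r b" using r by (simp add: b_def comb_def z_def fun_eq_iff)
    thus ?thesis unfolding r_def q_def by (rule that[OF orth])
  qed
qed

lemma measurable_ip:
  assumes "x \<in> S"
  shows "ip x \<in> borel_measurable sphere_sigma"
proof -
  have "(\<lambda>y. cos (sphere_dist d x y)) \<in> borel_measurable sphere_sigma"
    using measurable_dist_metric_sigma[OF assms, of "sphere_dist d"] by measurable
  also have "?this \<longleftrightarrow> ?thesis"
    by (rule measurable_cong) (simp add: cos_sphere_dist[OF assms])
  finally show ?thesis .
qed

context
  fixes Pr :: "'w measure" and U :: "'w \<Rightarrow> pt"
  assumes Pr: "prob_space Pr" and U: "uniform_elem Pr S (sphere_dist d) U"
begin

lemma U_mem: "\<omega> \<in> space Pr \<Longrightarrow> U \<omega> \<in> S"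
  by (rule uniform_elem_mem[OF U])

lemma measurable_ip_U: "x \<in> S \<Longrightarrow> (\<lambda>\<omega>. ip x (U \<omega>)) \<in> borel_measurable Pr"
  by (rule uniform_elem_measurable[OF U measurable_ip])

lemma two_frame_law:
  fixes F :: "real \<times> real \<Rightarrow> real"
  assumes xb: "orthonormal x b" and xb': "orthonormal x' b'" and F: "F \<in> borel_measurable borel"
  shows "(LINT \<omega>|Pr. F (ip x (U \<omega>), ip b (U \<omega>))) = (LINT \<omega>|Pr. F (ip x' (U \<omega>), ip b' (U \<omega>)))"
proof -
  obtain g where g: "isometry_of S (sphere_dist d) g" "\<And>y. y \<in> S \<Longrightarrow> ip x' (g y) = ip x y \<and> ip b' (g y) = ip b y"
    using two_frame_transitive[OF xb xb'] by blast
  define h where "h y = F (ip x' y, ip b' y)" for y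
  have h: "h \<in> borel_measurable sphere_sigma"
    unfolding h_def
    by (rule measurable_compose[OF _ F], intro borel_measurable_Pair measurable_ip) (use xb' in \<open>auto simp: orthonormal_def\<close>)
  have "(LINT \<omega>|Pr. F (ip x (U \<omega>), ip b (U \<omega>))) = (LINT \<omega>|Pr. h (g (U \<omega>)))"
    by (rule Bochner_Integration.integral_cong) (simp_all add: h_def g U_mem)
  also have "\<dots> = (LINT \<omega>|Pr. h (U \<omega>))" by (rule uniform_elem_isometry[OF Pr U g(1) h])
  finally show ?thesis by (simp add: h_def)
qed

text \<open>The coordinates along \<open>x\<close> and \<open>b\<close> have the joint law of
  coordinates \<open>0\<close> and \<open>c\<close> for each \<open>c\<close> from 1 to
  \<open>d\<close>. Summing over \<open>c\<close>, the squares add up to 1 minus the square of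
  coordinate 0.\<close>

lemma sphere_second_moment:
  assumes xb: "orthonormal x b"
  shows "real d * (LINT \<omega>|Pr. (ip b (U \<omega>))\<^sup>2 * ((1 + ip x (U \<omega>)) / 2) ^ i * ((1 - ip x (U \<omega>)) / 2) ^ j)
     = (LINT \<omega>|Pr. (1 - (ip x (U \<omega>))\<^sup>2) * ((1 + ip x (U \<omega>)) / 2) ^ i * ((1 - ip x (U \<omega>)) / 2) ^ j)"
proof -
  interpret prob_space Pr by (rule Pr)
  define f where "f y = ((1 + y) / 2) ^ i * ((1 - y) / 2) ^ j" for y :: real
  have f_cont: "continuous_on A f" for A unfolding f_def by (intro continuous_intros) auto
  have F: "(\<lambda>p. (snd p)\<^sup>2 * f (fst p)) \<in> borel_measurable borel"
    by (intro borel_measurable_continuous_onI continuous_intros continuous_on_compose2[OF f_cont[of UNIV]]) auto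
  have G: "(\<lambda>p. (1 - (fst p)\<^sup>2) * f (fst p)) \<in> borel_measurable borel"
    by (intro borel_measurable_continuous_onI continuous_intros continuous_on_compose2[OF f_cont[of UNIV]]) auto
  have f_meas [measurable]: "f \<in> borel_measurable borel" by (rule borel_measurable_continuous_onI[OF f_cont])
  have int: "integrable Pr (\<lambda>\<omega>. (U \<omega> c 0 0)\<^sup>2 * f (U \<omega> 0 0 0))" if c: "c \<le> d" for c
  proof (rule integrable_const_bound[where B = 1])
    have 0: "(0::nat) \<le> d" by simp
    have [measurable]: "(\<lambda>\<omega>. U \<omega> c 0 0) \<in> borel_measurable Pr" "(\<lambda>\<omega>. U \<omega> 0 0 0) \<in> borel_measurable Pr"
      using measurable_ip_U[OF basis_mem[OF c]] measurable_ip_U[OF basis_mem[OF 0]] by (simp_all add: ip_basis c)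
    show "(\<lambda>\<omega>. (U \<omega> c 0 0)\<^sup>2 * f (U \<omega> 0 0 0)) \<in> borel_measurable Pr" by measurable
    show "AE \<omega> in Pr. norm ((U \<omega> c 0 0)\<^sup>2 * f (U \<omega> 0 0 0)) \<le> 1"
    proof (rule AE_I2)
      fix \<omega> assume "\<omega> \<in> space Pr"
      note u = U_mem[OF this]
      have 1: "\<bar>U \<omega> c 0 0\<bar> \<le> 1" "\<bar>U \<omega> 0 0 0\<bar> \<le> 1"
        using abs_ip_le_1[OF basis_mem[OF c] u] abs_ip_le_1[OF basis_mem[OF 0] u] by (simp_all add: ip_basis c)
      have "\<bar>f (U \<omega> 0 0 0)\<bar> \<le> 1"
        unfolding f_def abs_mult power_abs using 1(2) by (intro mult_le_one power_le_one) auto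
      thus "norm ((U \<omega> c 0 0)\<^sup>2 * f (U \<omega> 0 0 0)) \<le> 1"
        using 1(1) by (auto simp: abs_mult abs_square_le_1 intro!: mult_le_one)
    qed
  qed
  have "real d * (LINT \<omega>|Pr. (ip b (U \<omega>))\<^sup>2 * f (ip x (U \<omega>))) = (\<Sum>c\<in>{1..d}. (LINT \<omega>|Pr. (ip b (U \<omega>))\<^sup>2 * f (ip x (U \<omega>))))"
    by simp
  also have "\<dots> = (\<Sum>c\<in>{1..d}. (LINT \<omega>|Pr. (U \<omega> c 0 0)\<^sup>2 * f (U \<omega> 0 0 0)))"
  proof (intro sum.cong refl)
    fix c assume "c \<in> {1..d}"
    hence "orthonormal (basis 0) (basis c)" "c \<le> d" by (auto intro: orthonormal_basis)
    thus "(LINT \<omega>|Pr. (ip b (U \<omega>))\<^sup>2 * f (ip x (U \<omega>))) = (LINT \<omega>|Pr. (U \<omega> c 0 0)\<^sup>2 * f (U \<omega> 0 0 0))"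
      using two_frame_law[OF xb _ F, of "basis 0" "basis c"] by (simp add: ip_basis)
  qed
  also have "\<dots> = (LINT \<omega>|Pr. (\<Sum>c\<in>{1..d}. (U \<omega> c 0 0)\<^sup>2 * f (U \<omega> 0 0 0)))"
    by (rule Bochner_Integration.integral_sum[symmetric]) (use int in auto)
  also have "\<dots> = (LINT \<omega>|Pr. (1 - (U \<omega> 0 0 0)\<^sup>2) * f (U \<omega> 0 0 0))"
  proof (rule Bochner_Integration.integral_cong[OF refl])
    fix \<omega> assume "\<omega> \<in> space Pr"
    from U_mem[OF this] have "(\<Sum>c<d + 1. (U \<omega> c 0 0)\<^sup>2) = 1" by (simp add: sphere_iff ip_def power2_eq_square)
    moreover have "(\<Sum>c<d + 1. (U \<omega> c 0 0)\<^sup>2) = (\<Sum>c\<in>insert 0 {1..d}. (U \<omega> c 0 0)\<^sup>2)"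
      by (rule sum.cong) auto
    moreover have "\<dots> = (U \<omega> 0 0 0)\<^sup>2 + (\<Sum>c\<in>{1..d}. (U \<omega> c 0 0)\<^sup>2)" by simp
    ultimately have "(\<Sum>c\<in>{1..d}. (U \<omega> c 0 0)\<^sup>2) = 1 - (U \<omega> 0 0 0)\<^sup>2" by linarith
    thus "(\<Sum>c\<in>{1..d}. (U \<omega> c 0 0)\<^sup>2 * f (U \<omega> 0 0 0)) = (1 - (U \<omega> 0 0 0)\<^sup>2) * f (U \<omega> 0 0 0)"
      by (simp flip: sum_distrib_right)
  qed
  also have "\<dots> = (LINT \<omega>|Pr. (1 - (ip x (U \<omega>))\<^sup>2) * f (ip x (U \<omega>)))"
    using two_frame_law[OF xb orthonormal_basis[of 0 1] G] d by (simp add: ip_basis)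
  finally show ?thesis by (simp add: f_def mult.assoc)
qed

text \<open>A point of the sphere corresponds to the idempotent \<open>(1 + U) / 2\<close> of a spin
  factor, a Jordan algebra of rank 2 whose off-diagonal part is the \<open>d\<close>-dimensional
  complement of \<open>x\<close>. This is why the rank is 2 and the multiplicity
  \<open>d\<close>.\<close>

lemma sphere_jordan_frame:
  assumes xb: "orthonormal x b"
  shows "jordan_frame Pr 2 d (\<lambda>q \<omega>. if q = 0 then (1 + ip x (U \<omega>)) / 2 else (1 - ip x (U \<omega>)) / 2) (\<lambda>q \<omega>. ip b (U \<omega>) / 2)"
proof -
  interpret prob_space Pr by (rule Pr)
  have S: "x \<in> S" "b \<in> S" using xb by (auto simp: orthonormal_def)
  note [measurable] = measurable_ip_U[OF S(1)] measurable_ip_U[OF S(2)]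
  have bd: "\<bar>ip x (U \<omega>)\<bar> \<le> 1" "\<bar>ip b (U \<omega>)\<bar> \<le> 1" if "\<omega> \<in> space Pr" for \<omega>
    using abs_ip_le_1 S U_mem[OF that] by auto
  show ?thesis
  proof
    show "(\<lambda>\<omega>. if q = 0 then (1 + ip x (U \<omega>)) / 2 else (1 - ip x (U \<omega>)) / 2) \<in> borel_measurable Pr" for q :: nat
      by (cases "q = 0") simp_all
    show "\<bar>if q = 0 then (1 + ip x (U \<omega>)) / 2 else (1 - ip x (U \<omega>)) / 2\<bar> \<le> 1" if "\<omega> \<in> space Pr" for q :: nat and \<omega>
      using bd[OF that] by (auto simp: abs_le_iff)
    show "\<bar>ip b (U \<omega>) / 2\<bar> \<le> 1" if "\<omega> \<in> space Pr" for \<omega>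
      using bd[OF that] by auto
    show "(\<Sum>q<(2::nat). if q = 0 then (1 + ip x (U \<omega>)) / 2 else (1 - ip x (U \<omega>)) / 2) = 1" for \<omega>
      by (simp add: numeral_2_eq_2 field_simps)
  next
    fix q i j :: nat
    assume "1 \<le> q" "q < 2"
    hence q: "q = 1" by simp
    have "real d * expectation (\<lambda>\<omega>. (ip b (U \<omega>) / 2)\<^sup>2 * ((1 + ip x (U \<omega>)) / 2) ^ i * ((1 - ip x (U \<omega>)) / 2) ^ j)
       = real d * expectation (\<lambda>\<omega>. ((ip b (U \<omega>))\<^sup>2 * ((1 + ip x (U \<omega>)) / 2) ^ i * ((1 - ip x (U \<omega>)) / 2) ^ j) / 4)"
      by (simp add: power_divide)
    also have "\<dots> = real d * expectation (\<lambda>\<omega>. (ip b (U \<omega>))\<^sup>2 * ((1 + ip x (U \<omega>)) / 2) ^ i * ((1 - ip x (U \<omega>)) / 2) ^ j) / 4"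
      by simp
    also have "\<dots> = expectation (\<lambda>\<omega>. ((1 - (ip x (U \<omega>))\<^sup>2) * ((1 + ip x (U \<omega>)) / 2) ^ i * ((1 - ip x (U \<omega>)) / 2) ^ j) / 4)"
      unfolding sphere_second_moment[OF xb] by simp
    also have "\<dots> = expectation (\<lambda>\<omega>. ((1 + ip x (U \<omega>)) / 2) ^ Suc i * ((1 - ip x (U \<omega>)) / 2) * ((1 - ip x (U \<omega>)) / 2) ^ j)"
    proof (rule Bochner_Integration.integral_cong[OF refl])
      fix \<omega>
      let ?y = "ip x (U \<omega>)"
      have "(1 - ?y\<^sup>2) / 4 = (1 + ?y) / 2 * ((1 - ?y) / 2)" by (simp add: power2_eq_square algebra_simps)
      moreover have "((1 - ?y\<^sup>2) * ((1 + ?y) / 2) ^ i * ((1 - ?y) / 2) ^ j) / 4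
        = ((1 - ?y\<^sup>2) / 4) * ((1 + ?y) / 2) ^ i * ((1 - ?y) / 2) ^ j" by simp
      ultimately show "((1 - ?y\<^sup>2) * ((1 + ?y) / 2) ^ i * ((1 - ?y) / 2) ^ j) / 4
        = ((1 + ?y) / 2) ^ Suc i * ((1 - ?y) / 2) * ((1 - ?y) / 2) ^ j"
        by (simp only: power_Suc mult_ac)
    qed
    finally show "real d * expectation (\<lambda>\<omega>. (ip b (U \<omega>) / 2)\<^sup>2 *
           (if (0::nat) = 0 then (1 + ip x (U \<omega>)) / 2 else (1 - ip x (U \<omega>)) / 2) ^ i *
           (if (1::nat) = 0 then (1 + ip x (U \<omega>)) / 2 else (1 - ip x (U \<omega>)) / 2) ^ j) =
       expectation (\<lambda>\<omega>. (if (0::nat) = 0 then (1 + ip x (U \<omega>)) / 2 else (1 - ip x (U \<omega>)) / 2) ^ Suc i *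
           (if q = 0 then (1 + ip x (U \<omega>)) / 2 else (1 - ip x (U \<omega>)) / 2) *
           (if (1::nat) = 0 then (1 + ip x (U \<omega>)) / 2 else (1 - ip x (U \<omega>)) / 2) ^ j)"
      using q by simp
  next
    fix q :: nat and C S' :: real and F :: "real \<times> real \<times> real \<times> real \<Rightarrow> real"
    assume "1 \<le> q" "q < 2" and CS: "C\<^sup>2 + S'\<^sup>2 = 1" and F: "F \<in> borel_measurable borel"
    hence q: "q = 1" by simp
    \<comment> \<open>Double angles: conjugating a rank 2 idempotent by an angle moves the sphere by
      twice that angle, here through a reflection of the plane of \<open>x\<close> and
      \<open>b\<close>.\<close>
    define x' where "x' = comb (C\<^sup>2 - S'\<^sup>2) x (2 * C * S') b"
    define b' where "b' = comb (2 * C * S') x (- (C\<^sup>2 - S'\<^sup>2)) b"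
    have ips: "ip x x = 1" "ip b b = 1" "ip x b = 0" "ip b x = 0" "column x" "column b"
      using xb by (auto simp: orthonormal_def sphere_iff ip_commute[of b x])
    have "(C\<^sup>2 - S'\<^sup>2)\<^sup>2 + (2 * C * S')\<^sup>2 = (C\<^sup>2 + S'\<^sup>2)\<^sup>2"
      by (simp add: power2_eq_square algebra_simps)
    hence one: "(C\<^sup>2 - S'\<^sup>2)\<^sup>2 + (2 * C * S')\<^sup>2 = 1" using CS by simp
    have xb': "orthonormal x' b'"
      using one ips unfolding orthonormal_def sphere_iff x'_def b'_def
      by (simp add: ip_comb column_comb power2_eq_square algebra_simps)
    define G where "G p = F ((1 + fst p) / 2, (1 - fst p) / 2, snd p / 2, (1 - fst p) / 2)" for p :: "real \<times> real"
    have G: "G \<in> borel_measurable borel"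
      unfolding G_def
      by (rule measurable_compose[OF _ F], rule borel_measurable_continuous_onI, intro continuous_intros) auto
    have S2: "S'\<^sup>2 = 1 - C\<^sup>2" using CS by simp
    have "G (ip x' y, ip b' y) = F (C\<^sup>2 * ((1 + ip x y) / 2) + S'\<^sup>2 * ((1 - ip x y) / 2) + 2 * C * S' * (ip b y / 2),
          S'\<^sup>2 * ((1 + ip x y) / 2) + C\<^sup>2 * ((1 - ip x y) / 2) - 2 * C * S' * (ip b y / 2),
          C * S' * ((1 + ip x y) / 2 - (1 - ip x y) / 2) - (C\<^sup>2 - S'\<^sup>2) * (ip b y / 2),
          S'\<^sup>2 * ((1 + ip x y) / 2) + C\<^sup>2 * ((1 - ip x y) / 2) - 2 * C * S' * (ip b y / 2))" for y
      unfolding G_def x'_def b'_def ip_comb S2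
      by (intro arg_cong[where f = F]) (simp add: field_simps)
    thus "expectation (\<lambda>\<omega>. F (if (0::nat) = 0 then (1 + ip x (U \<omega>)) / 2 else (1 - ip x (U \<omega>)) / 2,
             if q = 0 then (1 + ip x (U \<omega>)) / 2 else (1 - ip x (U \<omega>)) / 2, ip b (U \<omega>) / 2,
             if (1::nat) = 0 then (1 + ip x (U \<omega>)) / 2 else (1 - ip x (U \<omega>)) / 2)) =
       expectation (\<lambda>\<omega>. F (C\<^sup>2 * (if (0::nat) = 0 then (1 + ip x (U \<omega>)) / 2 else (1 - ip x (U \<omega>)) / 2) +
             S'\<^sup>2 * (if q = 0 then (1 + ip x (U \<omega>)) / 2 else (1 - ip x (U \<omega>)) / 2) + 2 * C * S' * (ip b (U \<omega>) / 2),
             S'\<^sup>2 * (if (0::nat) = 0 then (1 + ip x (U \<omega>)) / 2 else (1 - ip x (U \<omega>)) / 2) +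
             C\<^sup>2 * (if q = 0 then (1 + ip x (U \<omega>)) / 2 else (1 - ip x (U \<omega>)) / 2) - 2 * C * S' * (ip b (U \<omega>) / 2),
             C * S' * ((if (0::nat) = 0 then (1 + ip x (U \<omega>)) / 2 else (1 - ip x (U \<omega>)) / 2) -
               (if q = 0 then (1 + ip x (U \<omega>)) / 2 else (1 - ip x (U \<omega>)) / 2)) - (C\<^sup>2 - S'\<^sup>2) * (ip b (U \<omega>) / 2),
             if q = 1 then S'\<^sup>2 * (if (0::nat) = 0 then (1 + ip x (U \<omega>)) / 2 else (1 - ip x (U \<omega>)) / 2) +
               C\<^sup>2 * (if q = 0 then (1 + ip x (U \<omega>)) / 2 else (1 - ip x (U \<omega>)) / 2) - 2 * C * S' * (ip b (U \<omega>) / 2)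
             else if (1::nat) = 0 then (1 + ip x (U \<omega>)) / 2 else (1 - ip x (U \<omega>)) / 2))"
      using two_frame_law[OF xb xb' G] q by (simp add: G_def)
  qed (use d in simp_all)
qed

lemma sphere_product_formula:
  assumes x: "x1 \<in> S" "x2 \<in> S" and ab: "\<beta> = (real d - 2) / 2" "\<alpha> = (real d - 2) / 2"
  shows "(jacobi_a \<alpha> \<beta> n)\<^sup>2 * (LINT \<omega>|Pr. jacobiP \<alpha> \<beta> n (cos (sphere_dist d x1 (U \<omega>))) *
      jacobiP \<alpha> \<beta> n (cos (sphere_dist d x2 (U \<omega>)))) = jacobiP \<alpha> \<beta> n (cos (sphere_dist d x1 x2))"
proof -
  define q where "q = ip x1 x2"
  obtain b where b: "orthonormal x1 b" "x2 = comb q x1 (sqrt (1 - q\<^sup>2)) b"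
    using orthonormal_decomposition[OF x] unfolding q_def by blast
  interpret jordan_frame Pr 2 d "\<lambda>q \<omega>. if q = 0 then (1 + ip x1 (U \<omega>)) / 2 else (1 - ip x1 (U \<omega>)) / 2" "\<lambda>q \<omega>. ip b (U \<omega>) / 2"
    by (rule sphere_jordan_frame[OF b(1)])
  let ?P = "jacobiP \<alpha> \<beta> n"
  define s where "s = (1 + q) / 2"
  have q1: "\<bar>q\<bar> \<le> 1" unfolding q_def by (rule abs_ip_le_1[OF x])
  hence s: "0 \<le> s" "s \<le> 1" by (auto simp: s_def)
  have "s * (1 - s) = (1 - q\<^sup>2) / 2\<^sup>2" by (simp add: s_def power2_eq_square field_simps)
  from arg_cong[OF this, of sqrt] have sq: "2 * sqrt (s * (1 - s)) = sqrt (1 - q\<^sup>2)"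
    by (simp add: real_sqrt_divide)
  have t: "cos (sphere_dist d x2 (U \<omega>)) = 2 * (s * ((1 + ip x1 (U \<omega>)) / 2) + (1 - s) * ((1 - ip x1 (U \<omega>)) / 2)
     + 2 * sqrt (s * (1 - s)) * (ip b (U \<omega>) / 2)) - 1" if "\<omega> \<in> space Pr" for \<omega>
  proof -
    have "cos (sphere_dist d x2 (U \<omega>)) = q * ip x1 (U \<omega>) + sqrt (1 - q\<^sup>2) * ip b (U \<omega>)"
      unfolding cos_sphere_dist[OF x(2) U_mem[OF that]] by (subst b(2)) (rule ip_comb)
    thus ?thesis unfolding sq by (simp add: s_def field_simps)
  qed
  have t1: "cos (sphere_dist d x1 (U \<omega>)) = 2 * ((1 + ip x1 (U \<omega>)) / 2) - 1" if "\<omega> \<in> space Pr" for \<omega>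
    by (simp add: cos_sphere_dist[OF x(1) U_mem[OF that]] add_divide_distrib)
  have "(LINT \<omega>|Pr. ?P (cos (sphere_dist d x1 (U \<omega>))) * ?P (cos (sphere_dist d x2 (U \<omega>)))) =
     expectation (\<lambda>\<omega>. ?P (2 * ((1 + ip x1 (U \<omega>)) / 2) - 1) * ?P (2 * (s * ((1 + ip x1 (U \<omega>)) / 2) + (1 - s) * ((1 - ip x1 (U \<omega>)) / 2)
     + 2 * sqrt (s * (1 - s)) * (ip b (U \<omega>) / 2)) - 1))"
    by (rule Bochner_Integration.integral_cong[OF refl]) (simp only: t t1)
  moreover have "1 < c" "\<beta> = a - 1" "\<alpha> = c - a - 1"
    using d by (simp_all add: ab a_def c_def field_simps)
  note jacobi_product_formula[OF s this, of n]
  ultimately have "(jacobi_a \<alpha> \<beta> n)\<^sup>2 * (LINT \<omega>|Pr. ?P (cos (sphere_dist d x1 (U \<omega>))) * ?P (cos (sphere_dist d x2 (U \<omega>)))) = ?P (2 * s - 1)"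
    by simp
  moreover have "2 * s - 1 = cos (sphere_dist d x1 x2)" by (simp add: cos_sphere_dist[OF x] s_def q_def field_simps)
  ultimately show ?thesis by simp
qed

end

end

section \<open>Orthogonal series of random variables\<close>

context prob_space
begin

definition L2 :: "('a \<Rightarrow> real) \<Rightarrow> bool" where
  "L2 X \<longleftrightarrow> X \<in> borel_measurable M \<and> integrable M (\<lambda>\<omega>. (X \<omega>)\<^sup>2)"

lemma L2_measurable: "L2 X \<Longrightarrow> X \<in> borel_measurable M"
  by (simp add: L2_def)

lemma L2_mult_integrable:
  assumes "L2 X" "L2 Y"
  shows "integrable M (\<lambda>\<omega>. X \<omega> * Y \<omega>)"
proof (rule Bochner_Integration.integrable_bound)
  show "integrable M (\<lambda>\<omega>. (X \<omega>)\<^sup>2 + (Y \<omega>)\<^sup>2)" using assms by (auto simp: L2_def)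
  show "AE \<omega> in M. norm (X \<omega> * Y \<omega>) \<le> norm ((X \<omega>)\<^sup>2 + (Y \<omega>)\<^sup>2)"
  proof (rule AE_I2)
    fix \<omega>
    have *: "2 * (\<bar>X \<omega>\<bar> * \<bar>Y \<omega>\<bar>) \<le> (X \<omega>)\<^sup>2 + (Y \<omega>)\<^sup>2"
      using sum_squares_bound[of "\<bar>X \<omega>\<bar>" "\<bar>Y \<omega>\<bar>"] by (simp only: power2_abs mult.assoc)
    have "\<bar>X \<omega> * Y \<omega>\<bar> \<le> 2 * (\<bar>X \<omega>\<bar> * \<bar>Y \<omega>\<bar>)" by (simp add: abs_mult)
    also note *
    finally show "norm (X \<omega> * Y \<omega>) \<le> norm ((X \<omega>)\<^sup>2 + (Y \<omega>)\<^sup>2)" by simp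
  qed
qed (use assms in \<open>auto simp: L2_def\<close>)

lemma L2_const: "L2 (\<lambda>_. c)"
  by (simp add: L2_def)

lemma L2_integrable: "L2 X \<Longrightarrow> integrable M X"
  using L2_mult_integrable[OF _ L2_const[of 1], of X] by simp

lemma L2_add:
  assumes "L2 X" "L2 Y"
  shows "L2 (\<lambda>\<omega>. X \<omega> + Y \<omega>)"
proof -
  have "integrable M (\<lambda>\<omega>. (X \<omega>)\<^sup>2 + (Y \<omega>)\<^sup>2 + 2 * (X \<omega> * Y \<omega>))"
    using assms L2_mult_integrable[OF assms] by (auto simp: L2_def)
  moreover have "(\<lambda>\<omega>. X \<omega> + Y \<omega>) \<in> borel_measurable M"
    using assms by (intro borel_measurable_add L2_measurable)
  ultimately show ?thesis by (simp add: L2_def power2_sum mult.assoc)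
qed

lemma L2_cmult: "L2 X \<Longrightarrow> L2 (\<lambda>\<omega>. c * X \<omega>)"
  by (auto simp: L2_def power_mult_distrib)

lemma L2_diff: "L2 X \<Longrightarrow> L2 Y \<Longrightarrow> L2 (\<lambda>\<omega>. X \<omega> - Y \<omega>)"
  using L2_add[of X "\<lambda>\<omega>. (-1) * Y \<omega>"] L2_cmult[of Y "-1"] by simp

lemma L2_sum: "(\<And>i. i \<in> I \<Longrightarrow> L2 (X i)) \<Longrightarrow> L2 (\<lambda>\<omega>. \<Sum>i\<in>I. X i \<omega>)"
  by (induction I rule: infinite_finite_induct) (auto intro: L2_add L2_const)

lemma L2_tendsto_inner:
  assumes X: "\<And>n. L2 (X n)" "L2 Z" and Y: "L2 Y"
    and lim: "(\<lambda>n. expectation (\<lambda>\<omega>. (Z \<omega> - X n \<omega>)\<^sup>2)) \<longlonglongrightarrow> 0"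
  shows "(\<lambda>n. expectation (\<lambda>\<omega>. X n \<omega> * Y \<omega>)) \<longlonglongrightarrow> expectation (\<lambda>\<omega>. Z \<omega> * Y \<omega>)"
proof (rule LIMSEQ_I)
  fix e :: real assume e: "e > 0"
  define G where "G = expectation (\<lambda>\<omega>. (Y \<omega>)\<^sup>2)"
  \<comment> \<open>Chosen so that \<open>\<eta> * G < e\<close>. Expanding the square of
    \<open>(Z - X n) - t Y\<close> at \<open>t = \<eta>\<close> and \<open>t = - \<eta>\<close> then
    bounds the inner product by \<open>e\<close>; the summand 1 covers \<open>G = 0\<close>.\<close>
  define \<eta> where "\<eta> = e / (1 + G)"
  have G: "G \<ge> 0" by (simp add: G_def)
  have \<eta>: "\<eta> > 0" using e G by (simp add: \<eta>_def)
  have \<eta>G: "\<eta> * G < e" using e G by (simp add: \<eta>_def field_simps)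
  obtain N where N: "\<And>n. n \<ge> N \<Longrightarrow> \<bar>expectation (\<lambda>\<omega>. (Z \<omega> - X n \<omega>)\<^sup>2)\<bar> < e * \<eta>"
    using LIMSEQ_D[OF lim, of "e * \<eta>"] e \<eta> by auto
  show "\<exists>N. \<forall>n\<ge>N. norm (expectation (\<lambda>\<omega>. X n \<omega> * Y \<omega>) - expectation (\<lambda>\<omega>. Z \<omega> * Y \<omega>)) < e"
  proof (intro exI allI impI)
    fix n assume "n \<ge> N"
    define F where "F = expectation (\<lambda>\<omega>. (Z \<omega> - X n \<omega>)\<^sup>2)"
    have F: "F < e * \<eta>" using N[OF \<open>n \<ge> N\<close>] by (simp add: F_def)
    define P where "P = expectation (\<lambda>\<omega>. (Z \<omega> - X n \<omega>) * Y \<omega>)"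
    note D = L2_diff[OF X(2) X(1)[of n]]
    have ge: "0 \<le> F + t\<^sup>2 * G - 2 * t * P" for t
    proof -
      have "0 \<le> expectation (\<lambda>\<omega>. ((Z \<omega> - X n \<omega>) - t * Y \<omega>)\<^sup>2)" by simp
      also have "\<dots> = expectation (\<lambda>\<omega>. (Z \<omega> - X n \<omega>)\<^sup>2 + t\<^sup>2 * (Y \<omega>)\<^sup>2 - 2 * t * ((Z \<omega> - X n \<omega>) * Y \<omega>))"
        by (simp add: power2_diff power_mult_distrib mult_ac)
      also have "\<dots> = F + t\<^sup>2 * G - 2 * t * P"
        using D Y L2_mult_integrable[OF D Y] by (simp add: F_def G_def P_def L2_def)
      finally show ?thesis .
    qed
    have "2 * \<eta> * \<bar>P\<bar> \<le> F + \<eta>\<^sup>2 * G"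
      using ge[of \<eta>] ge[of "- \<eta>"] by (cases "P \<ge> 0") auto
    also have "\<dots> < e * \<eta> + \<eta> * e"
      using F mult_strict_left_mono[OF \<eta>G \<eta>] unfolding power2_eq_square mult.assoc mult.commute[of e \<eta>] by linarith
    finally have "\<bar>P\<bar> < e" using \<eta> by (simp add: mult.commute)
    moreover have "P = expectation (\<lambda>\<omega>. Z \<omega> * Y \<omega>) - expectation (\<lambda>\<omega>. X n \<omega> * Y \<omega>)"
      using L2_mult_integrable[OF X(2) Y] L2_mult_integrable[OF X(1) Y] by (simp add: P_def algebra_simps)
    ultimately show "norm (expectation (\<lambda>\<omega>. X n \<omega> * Y \<omega>) - expectation (\<lambda>\<omega>. Z \<omega> * Y \<omega>)) < e"
      by (simp add: abs_minus_commute)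
  qed
qed

lemma L2_tendsto_inner2:
  assumes X: "\<And>n. L2 (X n)" "L2 Z" and Y: "\<And>n. L2 (Y n)" "L2 W"
    and lim: "(\<lambda>n. expectation (\<lambda>\<omega>. (Z \<omega> - X n \<omega>)\<^sup>2)) \<longlonglongrightarrow> 0" "(\<lambda>n. expectation (\<lambda>\<omega>. (W \<omega> - Y n \<omega>)\<^sup>2)) \<longlonglongrightarrow> 0"
  shows "(\<lambda>n. expectation (\<lambda>\<omega>. X n \<omega> * Y n \<omega>)) \<longlonglongrightarrow> expectation (\<lambda>\<omega>. Z \<omega> * W \<omega>)"
proof -
  let ?R = "\<lambda>n. expectation (\<lambda>\<omega>. (Z \<omega> - X n \<omega>) * (W \<omega> - Y n \<omega>))"
  have R: "?R \<longlonglongrightarrow> 0"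
  proof (rule tendsto_rabs_zero_cancel, rule tendsto_sandwich[OF always_eventually always_eventually tendsto_const])
    let ?u = "\<lambda>n. expectation (\<lambda>\<omega>. (Z \<omega> - X n \<omega>)\<^sup>2) + expectation (\<lambda>\<omega>. (W \<omega> - Y n \<omega>)\<^sup>2)"
    show "?u \<longlonglongrightarrow> 0" using tendsto_add[OF lim] by simp
    show "\<forall>n. \<bar>?R n\<bar> \<le> ?u n"
    proof
      fix n
      note D = L2_diff[OF X(2) X(1)[of n]] and E = L2_diff[OF Y(2) Y(1)[of n]]
      have "\<bar>?R n\<bar> \<le> expectation (\<lambda>\<omega>. \<bar>(Z \<omega> - X n \<omega>) * (W \<omega> - Y n \<omega>)\<bar>)" by (rule integral_abs_bound)
      also have "\<dots> \<le> expectation (\<lambda>\<omega>. (Z \<omega> - X n \<omega>)\<^sup>2 + (W \<omega> - Y n \<omega>)\<^sup>2)"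
      proof (rule integral_mono)
        show "\<bar>(Z \<omega> - X n \<omega>) * (W \<omega> - Y n \<omega>)\<bar> \<le> (Z \<omega> - X n \<omega>)\<^sup>2 + (W \<omega> - Y n \<omega>)\<^sup>2" for \<omega>
          using sum_squares_bound[of "\<bar>Z \<omega> - X n \<omega>\<bar>" "\<bar>W \<omega> - Y n \<omega>\<bar>"]
            abs_ge_zero[of "(Z \<omega> - X n \<omega>) * (W \<omega> - Y n \<omega>)"]
          unfolding abs_mult power2_abs by linarith
      qed (use D E L2_mult_integrable[OF D E] in \<open>auto simp: L2_def\<close>)
      also have "\<dots> = ?u n" using D E by (simp add: L2_def)
      finally show "\<bar>?R n\<bar> \<le> ?u n" .
    qed
  qed simp
  \<comment> \<open>Solving \<open>(Z - X) (W - Y)\<close> for \<open>X Y\<close> leaves, besides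
    the small remainder, products in which only one factor varies with \<open>n\<close>.\<close>
  have eq: "expectation (\<lambda>\<omega>. X n \<omega> * Y n \<omega>) = ?R n + expectation (\<lambda>\<omega>. X n \<omega> * W \<omega>) + expectation (\<lambda>\<omega>. Y n \<omega> * Z \<omega>) - expectation (\<lambda>\<omega>. Z \<omega> * W \<omega>)" for n
  proof -
    have "expectation (\<lambda>\<omega>. X n \<omega> * Y n \<omega>) =
      expectation (\<lambda>\<omega>. (Z \<omega> - X n \<omega>) * (W \<omega> - Y n \<omega>) + X n \<omega> * W \<omega> + Y n \<omega> * Z \<omega> - Z \<omega> * W \<omega>)"
      by (rule Bochner_Integration.integral_cong) (simp_all add: algebra_simps)
    thus ?thesis
      using L2_mult_integrable[OF L2_diff[OF X(2) X(1)[of n]] L2_diff[OF Y(2) Y(1)[of n]]]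
        L2_mult_integrable[OF X(1)[of n] Y(2)] L2_mult_integrable[OF Y(1)[of n] X(2)] L2_mult_integrable[OF X(2) Y(2)]
      by simp
  qed
  have "(\<lambda>n. ?R n + expectation (\<lambda>\<omega>. X n \<omega> * W \<omega>) + expectation (\<lambda>\<omega>. Y n \<omega> * Z \<omega>) - expectation (\<lambda>\<omega>. Z \<omega> * W \<omega>))
     \<longlonglongrightarrow> 0 + expectation (\<lambda>\<omega>. Z \<omega> * W \<omega>) + expectation (\<lambda>\<omega>. W \<omega> * Z \<omega>) - expectation (\<lambda>\<omega>. Z \<omega> * W \<omega>)"
    by (intro tendsto_add tendsto_diff R tendsto_const L2_tendsto_inner[OF X Y(2) lim(1)] L2_tendsto_inner[OF Y X(2) lim(2)])
  thus ?thesis unfolding eq by (simp add: mult.commute)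
qed

text \<open>Via an almost surely convergent subsequence and Fatou's lemma.\<close>

lemma L2_complete:
  assumes S: "\<And>n. L2 (S n)"
    and cauchy: "\<And>e. e > 0 \<Longrightarrow> \<exists>N. \<forall>m\<ge>N. \<forall>n\<ge>N. expectation (\<lambda>\<omega>. (S m \<omega> - S n \<omega>)\<^sup>2) < e"
  shows "\<exists>Z. L2 Z \<and> (\<lambda>n. expectation (\<lambda>\<omega>. (Z \<omega> - S n \<omega>)\<^sup>2)) \<longlonglongrightarrow> 0"
proof -
  note [measurable] = L2_measurable[OF S]
  have "\<forall>k. \<exists>N. \<forall>m\<ge>N. \<forall>n\<ge>N. expectation (\<lambda>\<omega>. (S m \<omega> - S n \<omega>)\<^sup>2) < (1 / 4) ^ k"
    using cauchy by simp
  from choice[OF this] obtain K where K: "\<And>k m n. m \<ge> K k \<Longrightarrow> n \<ge> K k \<Longrightarrow> expectation (\<lambda>\<omega>. (S m \<omega> - S n \<omega>)\<^sup>2) < (1 / 4) ^ k"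
    by blast
  \<comment> \<open>Adding up the thresholds makes \<open>r\<close> monotone, so \<open>r k\<close>
    and \<open>r (Suc k)\<close> both lie beyond \<open>K k\<close>.\<close>
  define r where "r k = (\<Sum>j\<le>k. K j)" for k
  have rK: "r k \<ge> K k" "r (Suc k) \<ge> K k" for k
    by (simp_all add: r_def member_le_sum[of k "{..k}" K] trans_le_add1)
  define T where "T k = S (r k)" for k
  have T [measurable]: "T k \<in> borel_measurable M" for k by (simp add: T_def)
  have TL: "L2 (\<lambda>\<omega>. T (Suc k) \<omega> - T k \<omega>)" for k unfolding T_def by (intro L2_diff S)
  have Tint: "integrable M (\<lambda>\<omega>. \<bar>T (Suc k) \<omega> - T k \<omega>\<bar>)" for k
    by (intro integrable_abs L2_integrable TL)
  have ET: "expectation (\<lambda>\<omega>. \<bar>T (Suc k) \<omega> - T k \<omega>\<bar>) \<le> (1 / 2) ^ k" for k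
  proof -
    \<comment> \<open>The inequality \<open>2 |x| \<le> 2^k x^2 + 2^(-k)\<close>, its weight matched
      to the bound \<open>4^(-k)\<close> on the mean square.\<close>
    have "expectation (\<lambda>\<omega>. \<bar>T (Suc k) \<omega> - T k \<omega>\<bar>) \<le> expectation (\<lambda>\<omega>. (2 ^ k * (T (Suc k) \<omega> - T k \<omega>)\<^sup>2 + (1 / 2) ^ k) / 2)"
    proof (rule integral_mono[OF Tint])
      show "integrable M (\<lambda>\<omega>. (2 ^ k * (T (Suc k) \<omega> - T k \<omega>)\<^sup>2 + (1 / 2) ^ k) / 2)"
        using TL[of k] by (auto simp: L2_def)
      fix \<omega>
      let ?x = "\<bar>T (Suc k) \<omega> - T k \<omega>\<bar>"
      have "0 \<le> (2 ^ k * ?x - 1)\<^sup>2 * (1 / 2) ^ k" by simp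
      also have "\<dots> = 2 ^ k * ?x\<^sup>2 + (1 / 2) ^ k - 2 * ?x"
        by (simp add: power2_diff power_mult_distrib power_one_over field_simps power2_eq_square)
      finally show "?x \<le> (2 ^ k * (T (Suc k) \<omega> - T k \<omega>)\<^sup>2 + (1 / 2) ^ k) / 2" by simp
    qed
    also have "\<dots> = (2 ^ k * expectation (\<lambda>\<omega>. (T (Suc k) \<omega> - T k \<omega>)\<^sup>2) + (1 / 2) ^ k) / 2"
      using TL[of k] by (simp add: L2_def prob_space)
    also have "\<dots> \<le> (2 ^ k * (1 / 4) ^ k + (1 / 2) ^ k) / 2"
      using K[OF rK(2,1), of k] by (simp add: T_def less_imp_le)
    also have "(2::real) ^ k * (1 / 4) ^ k = (1 / 2) ^ k" by (simp flip: power_mult_distrib)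
    finally show ?thesis by simp
  qed
  have "(\<integral>\<^sup>+\<omega>. (\<Sum>k. ennreal \<bar>T (Suc k) \<omega> - T k \<omega>\<bar>) \<partial>M) = (\<Sum>k. \<integral>\<^sup>+\<omega>. ennreal \<bar>T (Suc k) \<omega> - T k \<omega>\<bar> \<partial>M)"
    by (rule nn_integral_suminf) measurable
  also have "\<dots> = (\<Sum>k. ennreal (expectation (\<lambda>\<omega>. \<bar>T (Suc k) \<omega> - T k \<omega>\<bar>)))"
    using Tint by (simp add: nn_integral_eq_integral)
  also have "\<dots> \<le> (\<Sum>k. ennreal ((1 / 2) ^ k))"
    using ET by (intro suminf_le summableI ennreal_leI) auto
  also have "\<dots> = ennreal (\<Sum>k. (1 / 2) ^ k)"
    by (rule suminf_ennreal2) (auto intro: summable_geometric)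
  finally have fin: "(\<integral>\<^sup>+\<omega>. (\<Sum>k. ennreal \<bar>T (Suc k) \<omega> - T k \<omega>\<bar>) \<partial>M) \<noteq> \<infinity>"
    by (auto simp: top_unique)
  have "AE \<omega> in M. (\<Sum>k. ennreal \<bar>T (Suc k) \<omega> - T k \<omega>\<bar>) \<noteq> \<infinity>"
    by (rule nn_integral_noteq_infinite[OF _ fin]) measurable
  hence conv: "AE \<omega> in M. (\<lambda>k. T k \<omega>) \<longlonglongrightarrow> lim (\<lambda>k. T k \<omega>)"
  proof eventually_elim
    case (elim \<omega>)
    hence "summable (\<lambda>k. \<bar>T (Suc k) \<omega> - T k \<omega>\<bar>)"
      by (intro summable_suminf_not_top) (auto simp: top.not_eq_extremum)
    hence "summable (\<lambda>k. T (Suc k) \<omega> - T k \<omega>)" by (rule summable_rabs_cancel)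
    hence "convergent (\<lambda>n. \<Sum>k<n. T (Suc k) \<omega> - T k \<omega>)" by (simp add: summable_iff_convergent)
    hence "convergent (\<lambda>n. (\<Sum>k<n. T (Suc k) \<omega> - T k \<omega>) + T 0 \<omega>)" by (intro convergent_add convergent_const)
    hence "convergent (\<lambda>k. T k \<omega>)" by (simp add: sum_lessThan_telescope[of "\<lambda>k. T k \<omega>"])
    thus ?case by (simp add: convergent_LIMSEQ_iff)
  qed
  define Z where "Z \<omega> = lim (\<lambda>k. T k \<omega>)" for \<omega>
  have Z [measurable]: "Z \<in> borel_measurable M" unfolding Z_def by measurable
  have fatou: "(\<integral>\<^sup>+\<omega>. ennreal ((Z \<omega> - S n \<omega>)\<^sup>2) \<partial>M) \<le> ennreal ((1 / 4) ^ k)" if n: "n \<ge> K k" for n k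
  proof -
    have "(\<integral>\<^sup>+\<omega>. ennreal ((Z \<omega> - S n \<omega>)\<^sup>2) \<partial>M) = (\<integral>\<^sup>+\<omega>. liminf (\<lambda>j. ennreal ((T j \<omega> - S n \<omega>)\<^sup>2)) \<partial>M)"
    proof (rule nn_integral_cong_AE)
      show "AE \<omega> in M. ennreal ((Z \<omega> - S n \<omega>)\<^sup>2) = liminf (\<lambda>j. ennreal ((T j \<omega> - S n \<omega>)\<^sup>2))"
        using conv
      proof eventually_elim
        case (elim \<omega>)
        hence "(\<lambda>j. ennreal ((T j \<omega> - S n \<omega>)\<^sup>2)) \<longlonglongrightarrow> ennreal ((Z \<omega> - S n \<omega>)\<^sup>2)"
          unfolding Z_def by (intro tendsto_ennrealI tendsto_intros)
        thus ?case by (intro lim_imp_Liminf[symmetric]) auto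
      qed
    qed
    also have "\<dots> \<le> liminf (\<lambda>j. \<integral>\<^sup>+\<omega>. ennreal ((T j \<omega> - S n \<omega>)\<^sup>2) \<partial>M)"
      by (rule nn_integral_liminf) measurable
    also have "\<dots> \<le> ennreal ((1 / 4) ^ k)"
    proof (rule Liminf_le)
      show "sequentially \<noteq> bot" by simp
      have "(\<integral>\<^sup>+\<omega>. ennreal ((T j \<omega> - S n \<omega>)\<^sup>2) \<partial>M) \<le> ennreal ((1 / 4) ^ k)" if "j \<ge> k" for j
      proof -
        have "K k \<le> r j" using that by (simp add: r_def member_le_sum[of k "{..j}" K])
        from K[OF this n] show ?thesis
          using L2_diff[OF S S, of "r j" n] by (simp add: nn_integral_eq_integral L2_def T_def less_imp_le)
      qed
      thus "\<forall>\<^sub>F j in sequentially. (\<integral>\<^sup>+\<omega>. ennreal ((T j \<omega> - S n \<omega>)\<^sup>2) \<partial>M) \<le> ennreal ((1 / 4) ^ k)"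
        by (auto simp: eventually_sequentially)
    qed
    finally show ?thesis .
  qed
  have D: "L2 (\<lambda>\<omega>. Z \<omega> - S n \<omega>)" "expectation (\<lambda>\<omega>. (Z \<omega> - S n \<omega>)\<^sup>2) \<le> (1 / 4) ^ k" if "n \<ge> K k" for n k
  proof -
    have f: "(\<integral>\<^sup>+\<omega>. ennreal ((Z \<omega> - S n \<omega>)\<^sup>2) \<partial>M) \<le> ennreal ((1 / 4) ^ k)" by (rule fatou[OF that])
    have int: "integrable M (\<lambda>\<omega>. (Z \<omega> - S n \<omega>)\<^sup>2)"
    proof (rule integrableI_nonneg)
      show "(\<integral>\<^sup>+\<omega>. ennreal ((Z \<omega> - S n \<omega>)\<^sup>2) \<partial>M) < \<infinity>" using f by (rule le_less_trans) simp
    qed auto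
    thus "L2 (\<lambda>\<omega>. Z \<omega> - S n \<omega>)" by (simp add: L2_def)
    show "expectation (\<lambda>\<omega>. (Z \<omega> - S n \<omega>)\<^sup>2) \<le> (1 / 4) ^ k"
      using f int by (simp add: nn_integral_eq_integral)
  qed
  have "L2 Z" using L2_add[OF D(1)[of 0 "K 0"] S[of "K 0"]] by simp
  moreover have "(\<lambda>n. expectation (\<lambda>\<omega>. (Z \<omega> - S n \<omega>)\<^sup>2)) \<longlonglongrightarrow> 0"
  proof (rule LIMSEQ_I)
    fix e :: real assume "e > 0"
    then obtain k where "(1 / 4 :: real) ^ k < e" using real_arch_pow_inv[of e "1 / 4"] by auto
    thus "\<exists>N. \<forall>n\<ge>N. norm (expectation (\<lambda>\<omega>. (Z \<omega> - S n \<omega>)\<^sup>2) - 0) < e"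
      using D(2)[of k] by (intro exI[of _ "K k"]) (auto intro: le_less_trans)
  qed
  ultimately show ?thesis by blast
qed

text \<open>By orthogonality the mean square of a block of terms is a block of the summable
  numerical series, so the partial sums are Cauchy.\<close>

lemma L2_orthogonal_series:
  assumes X: "\<And>n. L2 (X n)" and orth: "\<And>m n. m \<noteq> n \<Longrightarrow> expectation (\<lambda>\<omega>. X m \<omega> * X n \<omega>) = 0"
    and sm: "summable (\<lambda>n. expectation (\<lambda>\<omega>. (X n \<omega>)\<^sup>2))"
  shows "\<exists>Z. L2 Z \<and> (\<lambda>N. expectation (\<lambda>\<omega>. (Z \<omega> - (\<Sum>n<N. X n \<omega>))\<^sup>2)) \<longlonglongrightarrow> 0"
proof (rule L2_complete)
  show "L2 (\<lambda>\<omega>. \<Sum>n<N. X n \<omega>)" for N by (intro L2_sum X)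
  have sq: "expectation (\<lambda>\<omega>. (\<Sum>n\<in>A. X n \<omega>)\<^sup>2) = (\<Sum>n\<in>A. expectation (\<lambda>\<omega>. (X n \<omega>)\<^sup>2))" if "finite A" for A
  proof -
    have "expectation (\<lambda>\<omega>. (\<Sum>n\<in>A. X n \<omega>)\<^sup>2) = (\<Sum>m\<in>A. \<Sum>n\<in>A. expectation (\<lambda>\<omega>. X m \<omega> * X n \<omega>))"
      unfolding power2_eq_square sum_product using L2_mult_integrable[OF X X] by simp
    also have "\<dots> = (\<Sum>m\<in>A. \<Sum>n\<in>A. if m = n then expectation (\<lambda>\<omega>. (X n \<omega>)\<^sup>2) else 0)"
      by (intro sum.cong refl) (auto simp: orth power2_eq_square)
    also have "\<dots> = (\<Sum>n\<in>A. expectation (\<lambda>\<omega>. (X n \<omega>)\<^sup>2))" using that by simp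
    finally show ?thesis .
  qed
  fix e :: real assume "e > 0"
  then obtain N where N: "\<And>m n. m \<ge> N \<Longrightarrow> norm (\<Sum>i=m..<n. expectation (\<lambda>\<omega>. (X i \<omega>)\<^sup>2)) < e"
    using sm unfolding summable_Cauchy by blast
  have le: "expectation (\<lambda>\<omega>. ((\<Sum>i<m. X i \<omega>) - (\<Sum>i<n. X i \<omega>))\<^sup>2) < e" if "n \<ge> N" "m \<ge> n" for m n
  proof -
    have "(\<Sum>i<m. X i \<omega>) - (\<Sum>i<n. X i \<omega>) = (\<Sum>i=n..<m. X i \<omega>)" for \<omega>
      using that(2) sum_diff_nat_ivl[of 0 n m "\<lambda>i. X i \<omega>"] by (simp add: atLeast0LessThan)
    thus ?thesis using N[OF that(1), of m] by (simp add: sq)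
  qed
  show "\<exists>N. \<forall>m\<ge>N. \<forall>n\<ge>N. expectation (\<lambda>\<omega>. ((\<Sum>i<m. X i \<omega>) - (\<Sum>i<n. X i \<omega>))\<^sup>2) < e"
  proof (intro exI allI impI)
    fix m n assume "m \<ge> N" "n \<ge> N"
    thus "expectation (\<lambda>\<omega>. ((\<Sum>i<m. X i \<omega>) - (\<Sum>i<n. X i \<omega>))\<^sup>2) < e"
      using le[of n m] le[of m n] by (cases "m \<ge> n") (auto simp: power2_commute)
  qed
qed

end

text \<open>Composition with real functions brings the two elements to a common type, where
  expectations of independent variables multiply. The preimages of Borel sets are closed under
  intersection, so factorisation on them extends to the generated sigma algebras.\<close>

lemma indep_elems_expectation:
  fixes f :: "'a \<Rightarrow> real" and g :: "'b \<Rightarrow> real"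
  assumes "prob_space Pr" and ind: "indep_elems Pr MX X MY Y"
    and f: "f \<in> borel_measurable MX" and g: "g \<in> borel_measurable MY"
    and int: "integrable Pr (\<lambda>\<omega>. f (X \<omega>))" "integrable Pr (\<lambda>\<omega>. g (Y \<omega>))"
  shows "(LINT \<omega>|Pr. f (X \<omega>) * g (Y \<omega>)) = (LINT \<omega>|Pr. f (X \<omega>)) * (LINT \<omega>|Pr. g (Y \<omega>))"
    and "integrable Pr (\<lambda>\<omega>. f (X \<omega>) * g (Y \<omega>))"
proof -
  interpret prob_space Pr by fact
  have X: "X \<in> measurable Pr MX" and Y: "Y \<in> measurable Pr MY" using ind by (auto simp: indep_elems_def)
  have fX: "(\<lambda>\<omega>. f (X \<omega>)) \<in> borel_measurable Pr" and gY: "(\<lambda>\<omega>. g (Y \<omega>)) \<in> borel_measurable Pr"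
    using X Y f g by (auto intro: measurable_compose)
  have stable: "Int_stable {h -` A \<inter> space Pr |A. A \<in> sets borel}" for h :: "'c \<Rightarrow> real"
  proof (safe intro!: Int_stableI)
    fix A B :: "real set" assume "A \<in> sets borel" "B \<in> sets borel"
    thus "\<exists>C. (h -` A \<inter> space Pr) \<inter> (h -` B \<inter> space Pr) = (h -` C \<inter> space Pr) \<and> C \<in> sets borel"
      by (intro exI[of _ "A \<inter> B"]) auto
  qed
  have "indep_var borel (\<lambda>\<omega>. f (X \<omega>)) borel (\<lambda>\<omega>. g (Y \<omega>))"
    unfolding indep_var_eq
  proof (intro conjI indep_set_sigma_sets stable fX gY)
    show "indep_set {(\<lambda>\<omega>. f (X \<omega>)) -` A \<inter> space Pr |A. A \<in> sets borel} {(\<lambda>\<omega>. g (Y \<omega>)) -` A \<inter> space Pr |A. A \<in> sets borel}"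
    proof (safe intro!: indep_setI)
      fix A B :: "real set" assume A: "A \<in> sets borel" and B: "B \<in> sets borel"
      show "(\<lambda>\<omega>. f (X \<omega>)) -` A \<inter> space Pr \<in> events" using fX A by (rule measurable_sets)
      show "(\<lambda>\<omega>. g (Y \<omega>)) -` A \<inter> space Pr \<in> events" using gY A by (rule measurable_sets)
      have 1: "(\<lambda>\<omega>. f (X \<omega>)) -` A \<inter> space Pr = {\<omega> \<in> space Pr. X \<omega> \<in> f -` A \<inter> space MX}"
        using measurable_space[OF X] by auto
      have 2: "(\<lambda>\<omega>. g (Y \<omega>)) -` B \<inter> space Pr = {\<omega> \<in> space Pr. Y \<omega> \<in> g -` B \<inter> space MY}"
        using measurable_space[OF Y] by auto
      have 3: "{\<omega> \<in> space Pr. X \<omega> \<in> f -` A \<inter> space MX} \<inter> {\<omega> \<in> space Pr. Y \<omega> \<in> g -` B \<inter> space MY}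
          = {\<omega> \<in> space Pr. X \<omega> \<in> f -` A \<inter> space MX \<and> Y \<omega> \<in> g -` B \<inter> space MY}" by auto
      show "prob ((\<lambda>\<omega>. f (X \<omega>)) -` A \<inter> space Pr \<inter> ((\<lambda>\<omega>. g (Y \<omega>)) -` B \<inter> space Pr)) =
          prob ((\<lambda>\<omega>. f (X \<omega>)) -` A \<inter> space Pr) * prob ((\<lambda>\<omega>. g (Y \<omega>)) -` B \<inter> space Pr)"
        unfolding 1 2 3
        using ind measurable_sets[OF f A] measurable_sets[OF g B] unfolding indep_elems_def by blast
    qed
  qed
  from indep_var_lebesgue_integral[OF this int] indep_var_integrable[OF this int]
  show "(LINT \<omega>|Pr. f (X \<omega>) * g (Y \<omega>)) = (LINT \<omega>|Pr. f (X \<omega>)) * (LINT \<omega>|Pr. g (Y \<omega>))"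
    "integrable Pr (\<lambda>\<omega>. f (X \<omega>) * g (Y \<omega>))" .
qed

section \<open>The random field\<close>

text \<open>With an algebra of real dimension \<open>2 ^ k\<close> the space has dimension
  \<open>d = (N - 1) * 2 ^ k\<close>, so all four projective families share one formula for \<alpha>
  and one for \<beta>.\<close>

lemma tphs_cases:
  assumes "d \<ge> 2" "tphs d M \<rho> \<alpha> \<beta>"
  obtains (sphere) "M = sphere_pts d" "\<rho> = sphere_dist d" "\<alpha> = (real d - 2) / 2" "\<beta> = (real d - 2) / 2" "unit_sphere d"
  | (projective) k N where "M = proj_pts k N" "\<rho> = proj_dist k N" "cd_projective k N"
      "\<beta> = 2 ^ k / 2 - 1" "\<alpha> = (real N - 1) * 2 ^ k / 2 - 1"
proof -
  show thesis
    using assms(2) unfolding tphs_def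
  proof (elim disjE conjE)
    assume "M = sphere_pts d" "\<rho> = sphere_dist d" "\<alpha> = (real d - 2) / 2" "\<beta> = (real d - 2) / 2"
    moreover have "unit_sphere d" using assms(1) by (simp add: unit_sphere_def)
    ultimately show thesis by (rule sphere)
  next
    assume *: "M = proj_pts 0 (d + 1)" "\<rho> = proj_dist 0 (d + 1)" "\<alpha> = (real d - 2) / 2" "\<beta> = - 1 / 2"
    show thesis
      using assms(1) *(3,4) by (intro projective[OF *(1,2)]) (simp_all add: cd_projective_def field_simps)
  next
    assume *: "even d" "d \<ge> 4" "M = proj_pts 1 (d div 2 + 1)" "\<rho> = proj_dist 1 (d div 2 + 1)"
      "\<alpha> = (real d - 2) / 2" "\<beta> = 0"
    then obtain e where "d = 2 * e" by (elim evenE)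
    with * show thesis by (intro projective[OF *(3,4)]) (simp_all add: cd_projective_def field_simps)
  next
    assume *: "4 dvd d" "d \<ge> 8" "M = proj_pts 2 (d div 4 + 1)" "\<rho> = proj_dist 2 (d div 4 + 1)"
      "\<alpha> = (real d - 2) / 2" "\<beta> = 1"
    then obtain e where "d = 4 * e" by (elim dvdE)
    with * show thesis by (intro projective[OF *(3,4)]) (simp_all add: cd_projective_def field_simps)
  next
    assume *: "M = proj_pts 3 3" "\<rho> = proj_dist 3 3" "\<alpha> = 7" "\<beta> = 3"
    thus thesis by (intro projective[OF *(1,2)]) (simp_all add: cd_projective_def)
  qed
qed

lemma tphs_product_formula:
  assumes "d \<ge> 2" "tphs d M \<rho> \<alpha> \<beta>" "prob_space Pr" "uniform_elem Pr M \<rho> U" "x1 \<in> M" "x2 \<in> M"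
  shows "(jacobi_a \<alpha> \<beta> n)\<^sup>2 * (LINT \<omega>|Pr. jacobiP \<alpha> \<beta> n (cos (\<rho> x1 (U \<omega>))) * jacobiP \<alpha> \<beta> n (cos (\<rho> x2 (U \<omega>))))
     = jacobiP \<alpha> \<beta> n (cos (\<rho> x1 x2))"
  using assms(1,2)
proof (cases rule: tphs_cases)
  case sphere
  interpret unit_sphere d by fact
  show ?thesis
    using assms(4-6) unfolding sphere(1-4) by (intro sphere_product_formula[OF assms(3)]) simp_all
next
  case (projective k N)
  interpret cd_projective k N by fact
  show ?thesis
    using proj_product_formula[OF assms(3), of U x1 x2 \<beta> \<alpha> n] assms projective by blast
qed

lemma tphs_cos_dist_self:
  assumes "d \<ge> 2" "tphs d M \<rho> \<alpha> \<beta>" "x \<in> M"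
  shows "cos (\<rho> x x) = 1"
  using assms(1,2)
proof (cases rule: tphs_cases)
  case sphere
  interpret unit_sphere d by fact
  show ?thesis using assms(3) sphere(1,2) by (simp add: cos_sphere_dist sphere_iff)
next
  case (projective k N)
  interpret cd_projective k N by fact
  have x: "x \<in> proj_pts k N" using assms(3) projective(1) by simp
  \<comment> \<open>For the pair \<open>(x, x)\<close> the two normal forms describe the same point;
    comparing their corner entries gives \<open>s = 1\<close>.\<close>
  obtain g where g: "g x = E0" "g x = std_pt (frob k N x x)" "0 \<le> frob k N x x"
    using proj_two_point[OF x x] by blast
  have "E0 0 0 0 = std_pt (frob k N x x) 0 0 0" using g by simp
  hence "frob k N x x = 1" using N g(3) by (simp add: rank_one_def std_pt_def)
  thus ?thesis using cos_proj_dist[OF x x] projective(2) by simp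
qed

lemma L2_component_mult:
  assumes "prob_space Pr" "V \<in> borel_measurable Pr" "\<And>i. integrable Pr (\<lambda>\<omega>. (V \<omega> $ i)\<^sup>2)"
  shows "prob_space.L2 Pr (\<lambda>\<omega>. (R *v V \<omega>) $ i)"
proof -
  interpret prob_space Pr by fact
  have "L2 (\<lambda>\<omega>. V \<omega> $ j)" for j
    unfolding L2_def using assms by (auto intro!: measurable_compose[OF assms(2)] borel_measurable_continuous_onI continuous_intros)
  thus ?thesis unfolding matrix_vector_mult_def by (simp add: L2_sum L2_cmult)
qed

lemma integral_vec_nth:
  fixes X :: "'w \<Rightarrow> real^'m"
  assumes "\<And>i. integrable Pr (\<lambda>\<omega>. X \<omega> $ i)"
  shows "integrable Pr X" "(LINT \<omega>|Pr. X \<omega>) $ i = (LINT \<omega>|Pr. X \<omega> $ i)"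
proof -
  have X: "X = (\<lambda>\<omega>. \<Sum>i\<in>UNIV. X \<omega> $ i *\<^sub>R axis i 1)"
    by (rule ext) (simp add: basis_expansion scalar_mult_eq_scaleR[symmetric])
  have "integrable Pr (\<lambda>\<omega>. \<Sum>i\<in>UNIV. X \<omega> $ i *\<^sub>R axis i 1)"
    using assms by (intro Bochner_Integration.integrable_sum integrable_scaleR_left) auto
  thus int: "integrable Pr X" by (subst X)
  show "(LINT \<omega>|Pr. X \<omega>) $ i = (LINT \<omega>|Pr. X \<omega> $ i)"
    using integral_bounded_linear[OF bounded_linear_vec_nth int, of i] by simp
qed

lemma mcov_centred:
  fixes X Y :: "'w \<Rightarrow> real^'m"
  assumes "\<And>i. (LINT \<omega>|Pr. X \<omega> $ i) = 0" "\<And>i. (LINT \<omega>|Pr. Y \<omega> $ i) = 0"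
  shows "mcov Pr X Y $ i $ j = (LINT \<omega>|Pr. X \<omega> $ i * Y \<omega> $ j)"
  by (simp add: mcov_def assms)

locale jacobi_series =
  fixes d :: nat and M :: "pt set" and \<rho> :: "pt \<Rightarrow> pt \<Rightarrow> real" and \<alpha> \<beta> :: real
    and Pr :: "'w measure" and V :: "nat \<Rightarrow> 'w \<Rightarrow> real^'m" and U :: "'w \<Rightarrow> pt"
    and B :: "nat \<Rightarrow> real^'m^'m"
  assumes d: "d \<ge> 2"
    and tphs: "tphs d M \<rho> \<alpha> \<beta>"
    and Pr: "prob_space Pr"
    and V_meas: "\<And>n. V n \<in> borel_measurable Pr"
    and V_indep: "prob_space.indep_vars Pr (\<lambda>_. borel) V UNIV"
    and V_square: "\<And>n i. integrable Pr (\<lambda>\<omega>. (V n \<omega> $ i)\<^sup>2)"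
    and V_mean: "\<And>n. (LINT \<omega>|Pr. V n \<omega>) = 0"
    and V_cov: "\<And>n. mcov Pr (V n) (V n) = (jacobi_a \<alpha> \<beta> n)\<^sup>2 *\<^sub>R mat 1"
    and U: "uniform_elem Pr M \<rho> U"
    and UV: "indep_elems Pr (metric_sigma M \<rho>) U (PiM UNIV (\<lambda>_. borel)) (\<lambda>\<omega> n. V n \<omega>)"
    and B: "\<And>n. sym_nnd (B n)"
    and B_summable: "\<And>i j. summable (\<lambda>n. B n $ i $ j * jacobiP \<alpha> \<beta> n 1)"
begin

sublocale prob_space Pr by (rule Pr)

definition J :: "nat \<Rightarrow> pt \<Rightarrow> pt \<Rightarrow> real" where
  "J n x y = jacobiP \<alpha> \<beta> n (cos (\<rho> x y))"

definition W :: "nat \<Rightarrow> 'm \<Rightarrow> 'w \<Rightarrow> real" where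
  "W n i \<omega> = (msqrt (B n) *v V n \<omega>) $ i"

definition X :: "nat \<Rightarrow> pt \<Rightarrow> 'm \<Rightarrow> 'w \<Rightarrow> real" where
  "X n x i \<omega> = sterm \<alpha> \<beta> \<rho> B V U n x \<omega> $ i"

lemma X_eq: "X n x i \<omega> = J n x (U \<omega>) * W n i \<omega>"
  by (simp add: X_def sterm_def J_def W_def)

lemma J_measurable: "x \<in> M \<Longrightarrow> J n x \<in> borel_measurable (metric_sigma M \<rho>)"
  unfolding J_def
  by (rule measurable_compose[OF _ borel_measurable_jacobiP], rule measurable_compose[OF measurable_dist_metric_sigma])
     (auto intro: borel_measurable_continuous_onI continuous_intros)

lemma J_bounded: "\<exists>K. \<forall>x y. \<bar>J n x y\<bar> \<le> K"
proof -
  have "continuous_on {-1..1} (jacobiP \<alpha> \<beta> n)"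
    unfolding jacobiP_def by (intro continuous_intros) auto
  hence "compact (jacobiP \<alpha> \<beta> n ` {-1..1})" by (intro compact_continuous_image) auto
  from compact_imp_bounded[OF this] obtain K where "\<forall>t\<in>{-1..1}. \<bar>jacobiP \<alpha> \<beta> n t\<bar> \<le> K"
    unfolding bounded_iff by auto
  thus ?thesis unfolding J_def by (intro exI[of _ K]) auto
qed

lemma J_mult_integrable:
  assumes "x1 \<in> M" "x2 \<in> M"
  shows "integrable Pr (\<lambda>\<omega>. J m x1 (U \<omega>) * J n x2 (U \<omega>))"
proof -
  obtain K L where K: "\<And>x y. \<bar>J m x y\<bar> \<le> K" and L: "\<And>x y. \<bar>J n x y\<bar> \<le> L"
    using J_bounded[of m] J_bounded[of n] by metis
  show ?thesis
  proof (rule integrable_const_bound[where B = "K * L"])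
    show "AE \<omega> in Pr. norm (J m x1 (U \<omega>) * J n x2 (U \<omega>)) \<le> K * L"
      using K L order_trans[OF abs_ge_zero K] by (auto simp: abs_mult intro!: mult_mono)
    show "(\<lambda>\<omega>. J m x1 (U \<omega>) * J n x2 (U \<omega>)) \<in> borel_measurable Pr"
      by (intro borel_measurable_times uniform_elem_measurable[OF U] J_measurable assms)
  qed
qed

lemma J_integrable:
  assumes "x \<in> M"
  shows "integrable Pr (\<lambda>\<omega>. J n x (U \<omega>))"
proof -
  obtain K where K: "\<And>x y. \<bar>J n x y\<bar> \<le> K" using J_bounded[of n] by metis
  show ?thesis
    by (rule integrable_const_bound[where B = K])
       (use K uniform_elem_measurable[OF U J_measurable[OF assms]] in auto)
qed

lemma V_component:
  shows "L2 (\<lambda>\<omega>. V n \<omega> $ i)" and "expectation (\<lambda>\<omega>. V n \<omega> $ i) = 0"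
proof -
  show L: "L2 (\<lambda>\<omega>. V n \<omega> $ i)" for i
    using L2_component_mult[OF Pr V_meas[of n] V_square[of n], of "mat 1" i] by simp
  show "expectation (\<lambda>\<omega>. V n \<omega> $ i) = 0"
    using integral_vec_nth(2)[of Pr "V n" i] L2_integrable[OF L] V_mean[of n] by simp
qed

lemma V_covariance:
  "expectation (\<lambda>\<omega>. V m \<omega> $ i * V n \<omega> $ j) = (if m = n \<and> i = j then (jacobi_a \<alpha> \<beta> n)\<^sup>2 else 0)"
proof (cases "m = n")
  case True
  have "expectation (\<lambda>\<omega>. V n \<omega> $ i * V n \<omega> $ j) = mcov Pr (V n) (V n) $ i $ j"
    by (simp add: mcov_centred V_component)
  also have "\<dots> = (if i = j then (jacobi_a \<alpha> \<beta> n)\<^sup>2 else 0)"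
    unfolding V_cov by (simp add: mat_def)
  finally show ?thesis using True by simp
next
  case False
  define Y where "Y l v = v $ (if l = m then i else j)" for l :: nat and v :: "real^'m"
  have "indep_vars (\<lambda>_. borel) V {m, n}" by (rule indep_vars_subset[OF V_indep]) simp
  hence "indep_vars (\<lambda>_. borel) (\<lambda>l \<omega>. Y l (V l \<omega>)) {m, n}"
    by (rule indep_vars_compose2) (auto simp: Y_def intro!: borel_measurable_continuous_onI continuous_intros)
  from indep_vars_lebesgue_integral[OF _ this] show ?thesis
    using False L2_integrable[OF V_component(1)] V_component(2) by (simp add: Y_def)
qed

lemma W_L2: "L2 (W n i)"
  unfolding W_def by (rule L2_component_mult[OF Pr V_meas V_square])

lemma W_eq: "W n i = (\<lambda>\<omega>. \<Sum>p\<in>UNIV. msqrt (B n) $ i $ p * V n \<omega> $ p)"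
  by (rule ext) (simp add: W_def matrix_vector_mult_def)

lemma W_mean: "expectation (W n i) = 0"
  unfolding W_eq using L2_integrable[OF V_component(1)] by (simp add: V_component(2))

lemma W_covariance:
  "expectation (\<lambda>\<omega>. W m i \<omega> * W n j \<omega>) = (if m = n then (jacobi_a \<alpha> \<beta> n)\<^sup>2 * B n $ i $ j else 0)"
proof -
  have "expectation (\<lambda>\<omega>. W m i \<omega> * W n j \<omega>) =
     expectation (\<lambda>\<omega>. \<Sum>p\<in>UNIV. \<Sum>q\<in>UNIV. msqrt (B m) $ i $ p * msqrt (B n) $ j $ q * (V m \<omega> $ p * V n \<omega> $ q))"
    unfolding W_eq sum_product by (simp add: mult_ac)
  also have "\<dots> = (\<Sum>p\<in>UNIV. \<Sum>q\<in>UNIV. msqrt (B m) $ i $ p * msqrt (B n) $ j $ q * expectation (\<lambda>\<omega>. V m \<omega> $ p * V n \<omega> $ q))"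
    using L2_mult_integrable[OF V_component(1) V_component(1)] by simp
  also have "\<dots> = (if m = n then (jacobi_a \<alpha> \<beta> n)\<^sup>2 * (msqrt (B n) ** transpose (msqrt (B n))) $ i $ j else 0)"
    unfolding V_covariance
    by (auto simp: matrix_matrix_mult_def transpose_def sum_distrib_left if_distrib[of "\<lambda>x. _ * x"] mult_ac cong: if_cong)
  finally show ?thesis by (simp add: msqrt_mult_transpose[OF B])
qed

lemma UV_expectation:
  assumes f: "f \<in> borel_measurable (metric_sigma M \<rho>)" "integrable Pr (\<lambda>\<omega>. f (U \<omega>))"
    and g: "integrable Pr (\<lambda>\<omega>. W m i \<omega> * W n j \<omega>)"
  shows "expectation (\<lambda>\<omega>. f (U \<omega>) * (W m i \<omega> * W n j \<omega>)) = expectation (\<lambda>\<omega>. f (U \<omega>)) * expectation (\<lambda>\<omega>. W m i \<omega> * W n j \<omega>)"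
    and "integrable Pr (\<lambda>\<omega>. f (U \<omega>) * (W m i \<omega> * W n j \<omega>))"
    and "expectation (\<lambda>\<omega>. f (U \<omega>) * W n j \<omega>) = 0"
proof -
  \<comment> \<open>\<open>W\<close> as a measurable function of the whole sequence, since
    \<open>U\<close> is independent of the sequence as one random element of the product
    space.\<close>
  define G where "G n i v = (\<Sum>p\<in>UNIV. msqrt (B n) $ i $ p * v n $ p)" for n i and v :: "nat \<Rightarrow> real^'m"
  have G: "G n i \<in> borel_measurable (PiM UNIV (\<lambda>_. borel))" for n i
    unfolding G_def
    by (intro borel_measurable_sum borel_measurable_times borel_measurable_const
        measurable_compose[OF measurable_component_singleton[of n UNIV]])
       (auto intro!: borel_measurable_continuous_onI continuous_intros)
  have WG: "W n i \<omega> = G n i (\<lambda>n. V n \<omega>)" for n i \<omega> by (simp add: W_eq G_def)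
  have GG: "(\<lambda>v. G m i v * G n j v) \<in> borel_measurable (PiM UNIV (\<lambda>_. borel))"
    by (intro borel_measurable_times G)
  show "expectation (\<lambda>\<omega>. f (U \<omega>) * (W m i \<omega> * W n j \<omega>)) = expectation (\<lambda>\<omega>. f (U \<omega>)) * expectation (\<lambda>\<omega>. W m i \<omega> * W n j \<omega>)"
    "integrable Pr (\<lambda>\<omega>. f (U \<omega>) * (W m i \<omega> * W n j \<omega>))"
    using indep_elems_expectation[where f = f and X = U and g = "\<lambda>v. G m i v * G n j v" and Y = "\<lambda>\<omega> n. V n \<omega>", OF Pr UV f(1) GG f(2)] g
    by (simp_all add: WG)
  show "expectation (\<lambda>\<omega>. f (U \<omega>) * W n j \<omega>) = 0"
    using indep_elems_expectation(1)[where f = f and X = U and g = "G n j" and Y = "\<lambda>\<omega> n. V n \<omega>", OF Pr UV f(1) G f(2)] L2_integrable[OF W_L2[of n j]] W_mean[of n j]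
    by (simp add: WG[abs_def])
qed

text \<open>Independence splits off the factor from the vectors. For different indices that factor
  is 0; for equal ones it supplies \<open>(jacobi_a \<alpha> \<beta> n)\<^sup>2\<close> and
  \<open>B n\<close>, and the product formula evaluates the rest.\<close>

lemma X_product:
  assumes x: "x1 \<in> M" "x2 \<in> M"
  shows "expectation (\<lambda>\<omega>. X m x1 i \<omega> * X n x2 j \<omega>) = (if m = n then B n $ i $ j * jacobiP \<alpha> \<beta> n (cos (\<rho> x1 x2)) else 0)"
    and "integrable Pr (\<lambda>\<omega>. X m x1 i \<omega> * X n x2 j \<omega>)"
proof -
  have JJ: "(\<lambda>y. J m x1 y * J n x2 y) \<in> borel_measurable (metric_sigma M \<rho>)"
    by (intro borel_measurable_times J_measurable x)
  have e: "X m x1 i \<omega> * X n x2 j \<omega> = J m x1 (U \<omega>) * J n x2 (U \<omega>) * (W m i \<omega> * W n j \<omega>)" for \<omega>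
    by (simp add: X_eq mult_ac)
  note WW = L2_mult_integrable[OF W_L2 W_L2]
  show "integrable Pr (\<lambda>\<omega>. X m x1 i \<omega> * X n x2 j \<omega>)"
    unfolding e by (rule UV_expectation(2)[OF JJ J_mult_integrable[OF x] WW])
  have "expectation (\<lambda>\<omega>. X m x1 i \<omega> * X n x2 j \<omega>) =
     expectation (\<lambda>\<omega>. J m x1 (U \<omega>) * J n x2 (U \<omega>)) * expectation (\<lambda>\<omega>. W m i \<omega> * W n j \<omega>)"
    unfolding e by (rule UV_expectation(1)[OF JJ J_mult_integrable[OF x] WW])
  thus "expectation (\<lambda>\<omega>. X m x1 i \<omega> * X n x2 j \<omega>) = (if m = n then B n $ i $ j * jacobiP \<alpha> \<beta> n (cos (\<rho> x1 x2)) else 0)"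
    using tphs_product_formula[OF d tphs Pr U x, of n] by (simp add: W_covariance J_def mult_ac)
qed

lemma X_L2:
  assumes "x \<in> M"
  shows "L2 (X n x i)"
proof -
  have "X n x i = (\<lambda>\<omega>. J n x (U \<omega>) * W n i \<omega>)" by (rule ext) (rule X_eq)
  hence "X n x i \<in> borel_measurable Pr"
    using uniform_elem_measurable[OF U J_measurable[OF assms]] L2_measurable[OF W_L2] by simp
  thus ?thesis using X_product(2)[OF assms assms, of n i n i] by (simp add: L2_def power2_eq_square)
qed

lemma X_mean: "x \<in> M \<Longrightarrow> expectation (X n x i) = 0"
  unfolding X_eq
  by (rule UV_expectation(3)[where f = "J n x" and m = n and i = i, OF J_measurable J_integrable L2_mult_integrable[OF W_L2 W_L2]])

lemma exists_field:
  "\<exists>Z. \<forall>x\<in>M. \<forall>i. L2 (Z x i) \<and> (\<lambda>N. expectation (\<lambda>\<omega>. (Z x i \<omega> - (\<Sum>n<N. X n x i \<omega>))\<^sup>2)) \<longlonglongrightarrow> 0"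
proof -
  have "\<exists>Z. L2 Z \<and> (\<lambda>N. expectation (\<lambda>\<omega>. (Z \<omega> - (\<Sum>n<N. X n x i \<omega>))\<^sup>2)) \<longlonglongrightarrow> 0" if x: "x \<in> M" for x i
  proof (rule L2_orthogonal_series[OF X_L2[OF x]])
    show "expectation (\<lambda>\<omega>. X m x i \<omega> * X n x i \<omega>) = 0" if "m \<noteq> n" for m n
      using X_product(1)[OF x x] that by simp
    \<comment> \<open>At coinciding points the cosine is 1, so the diagonal of the assumed matrix
      series consists of exactly the mean squares of the terms.\<close>
    have "expectation (\<lambda>\<omega>. (X n x i \<omega>)\<^sup>2) = B n $ i $ i * jacobiP \<alpha> \<beta> n 1" for n
      using X_product(1)[OF x x, of n i n i] tphs_cos_dist_self[OF d tphs x] by (simp add: power2_eq_square)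
    thus "summable (\<lambda>n. expectation (\<lambda>\<omega>. (X n x i \<omega>)\<^sup>2))" using B_summable by simp
  qed
  hence "\<forall>x i. \<exists>Z. x \<in> M \<longrightarrow> L2 Z \<and> (\<lambda>N. expectation (\<lambda>\<omega>. (Z \<omega> - (\<Sum>n<N. X n x i \<omega>))\<^sup>2)) \<longlonglongrightarrow> 0" by blast
  thus ?thesis unfolding choice_iff by blast
qed

lemma sterm_uncorrelated:
  assumes "m \<noteq> n" "x1 \<in> M" "x2 \<in> M"
  shows "mcov Pr (sterm \<alpha> \<beta> \<rho> B V U m x1) (sterm \<alpha> \<beta> \<rho> B V U n x2) = 0"
proof -
  have "mcov Pr (sterm \<alpha> \<beta> \<rho> B V U m x1) (sterm \<alpha> \<beta> \<rho> B V U n x2) $ i $ j = expectation (\<lambda>\<omega>. X m x1 i \<omega> * X n x2 j \<omega>)" for i j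
    unfolding X_def by (rule mcov_centred) (use X_mean assms in \<open>auto simp: X_def[abs_def]\<close>)
  thus ?thesis using X_product(1)[OF assms(2,3)] assms(1) by (simp add: vec_eq_iff)
qed

lemma field_exists:
  "\<exists>Z :: pt \<Rightarrow> 'w \<Rightarrow> real^'m.
     (\<forall>x\<in>M. Z x \<in> borel_measurable Pr \<and> integrable Pr (\<lambda>\<omega>. (norm (Z x \<omega>))\<^sup>2)
         \<and> (\<lambda>N. LINT \<omega>|Pr. (norm (Z x \<omega> - (\<Sum>n<N. sterm \<alpha> \<beta> \<rho> B V U n x \<omega>)))\<^sup>2) \<longlonglongrightarrow> 0)
   \<and> (\<forall>x\<in>M. (LINT \<omega>|Pr. Z x \<omega>) = 0)
   \<and> isotropic_field Pr M \<rho> Z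
   \<and> (\<forall>x1\<in>M. \<forall>x2\<in>M. \<forall>i j.
        (\<lambda>n. B n $ i $ j * jacobiP \<alpha> \<beta> n (cos (\<rho> x1 x2))) sums (mcov Pr (Z x1) (Z x2) $ i $ j))"
proof -
  obtain z where z': "\<forall>x\<in>M. \<forall>i. L2 (z x i) \<and>
      (\<lambda>N. expectation (\<lambda>\<omega>. (z x i \<omega> - (\<Sum>n<N. X n x i \<omega>))\<^sup>2)) \<longlonglongrightarrow> 0"
    using exists_field by (elim exE)
  have z: "L2 (z x i)" "(\<lambda>N. expectation (\<lambda>\<omega>. (z x i \<omega> - (\<Sum>n<N. X n x i \<omega>))\<^sup>2)) \<longlonglongrightarrow> 0"
    if "x \<in> M" for x i
    using z' that by simp_all
  define Z :: "pt \<Rightarrow> 'w \<Rightarrow> real^'m" where "Z x \<omega> = (\<chi> i. z x i \<omega>)" for x \<omega>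
  have Zi: "Z x \<omega> $ i = z x i \<omega>" for x \<omega> i by (simp add: Z_def)
  have norm2: "(norm v)\<^sup>2 = (\<Sum>i\<in>UNIV. (v $ i)\<^sup>2)" for v :: "real^'m"
    by (simp only: power2_norm_eq_inner inner_vec_def) (simp add: power2_eq_square)
  have SL: "L2 (\<lambda>\<omega>. \<Sum>n<N. X n x i \<omega>)" if "x \<in> M" for x i N by (intro L2_sum X_L2 that)
  have meas: "Z x \<in> borel_measurable Pr" if "x \<in> M" for x
    using integral_vec_nth(1)[of Pr "Z x"] L2_integrable[OF z(1)[OF that]] by (auto simp: Zi)
  have int: "integrable Pr (\<lambda>\<omega>. (norm (Z x \<omega>))\<^sup>2)" if "x \<in> M" for x
    unfolding norm2 Zi using z(1)[OF that] by (auto simp: L2_def)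
  have conv: "(\<lambda>N. LINT \<omega>|Pr. (norm (Z x \<omega> - (\<Sum>n<N. sterm \<alpha> \<beta> \<rho> B V U n x \<omega>)))\<^sup>2) \<longlonglongrightarrow> 0" if x: "x \<in> M" for x
  proof -
    have "(LINT \<omega>|Pr. (norm (Z x \<omega> - (\<Sum>n<N. sterm \<alpha> \<beta> \<rho> B V U n x \<omega>)))\<^sup>2)
       = (\<Sum>i\<in>UNIV. expectation (\<lambda>\<omega>. (z x i \<omega> - (\<Sum>n<N. X n x i \<omega>))\<^sup>2))" for N
    proof -
      have "(norm (Z x \<omega> - (\<Sum>n<N. sterm \<alpha> \<beta> \<rho> B V U n x \<omega>)))\<^sup>2 = (\<Sum>i\<in>UNIV. (z x i \<omega> - (\<Sum>n<N. X n x i \<omega>))\<^sup>2)" for \<omega>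
        unfolding norm2 by (simp add: Zi X_def sum_component)
      thus ?thesis using L2_diff[OF z(1)[OF x] SL[OF x]] by (simp add: L2_def)
    qed
    thus ?thesis using tendsto_sum[of UNIV, OF z(2)[OF x]] by simp
  qed
  have zmean: "expectation (z x i) = 0" if x: "x \<in> M" for x i
  proof -
    have "(\<lambda>N. expectation (\<lambda>\<omega>. (\<Sum>n<N. X n x i \<omega>) * 1)) \<longlonglongrightarrow> expectation (\<lambda>\<omega>. z x i \<omega> * 1)"
      by (rule L2_tendsto_inner[OF SL[OF x] z(1)[OF x] L2_const z(2)[OF x]])
    moreover have "expectation (\<lambda>\<omega>. (\<Sum>n<N. X n x i \<omega>) * 1) = 0" for N
      using L2_integrable[OF X_L2[OF x]] X_mean[OF x] by simp
    ultimately show ?thesis by (simp add: LIMSEQ_const_iff)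
  qed
  have mean: "(LINT \<omega>|Pr. Z x \<omega>) = 0" if x: "x \<in> M" for x
    using integral_vec_nth(2)[of Pr "Z x"] L2_integrable[OF z(1)[OF x]] zmean[OF x] by (simp add: vec_eq_iff Zi)
  have cov: "(\<lambda>n. B n $ i $ j * jacobiP \<alpha> \<beta> n (cos (\<rho> x1 x2))) sums (mcov Pr (Z x1) (Z x2) $ i $ j)"
    if x: "x1 \<in> M" "x2 \<in> M" for x1 x2 i j
  proof -
    have "mcov Pr (Z x1) (Z x2) $ i $ j = expectation (\<lambda>\<omega>. z x1 i \<omega> * z x2 j \<omega>)"
      by (subst mcov_centred) (simp_all add: Zi zmean x)
    \<comment> \<open>Convergence of the covariance series at arbitrary pairs of points is a
      consequence of mean square convergence: its partial sums are the covariances of the partial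
      sums.\<close>
    moreover have "(\<lambda>N. expectation (\<lambda>\<omega>. (\<Sum>n<N. X n x1 i \<omega>) * (\<Sum>n<N. X n x2 j \<omega>))) \<longlonglongrightarrow> expectation (\<lambda>\<omega>. z x1 i \<omega> * z x2 j \<omega>)"
      by (rule L2_tendsto_inner2[OF SL[OF x(1)] z(1)[OF x(1)] SL[OF x(2)] z(1)[OF x(2)] z(2)[OF x(1)] z(2)[OF x(2)]])
    moreover have "expectation (\<lambda>\<omega>. (\<Sum>n<N. X n x1 i \<omega>) * (\<Sum>n<N. X n x2 j \<omega>)) = (\<Sum>n<N. B n $ i $ j * jacobiP \<alpha> \<beta> n (cos (\<rho> x1 x2)))" for N
    proof -
      have "expectation (\<lambda>\<omega>. (\<Sum>n<N. X n x1 i \<omega>) * (\<Sum>n<N. X n x2 j \<omega>)) = (\<Sum>m<N. \<Sum>n<N. expectation (\<lambda>\<omega>. X m x1 i \<omega> * X n x2 j \<omega>))"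
        unfolding sum_product using X_product(2)[OF x] by simp
      also have "\<dots> = (\<Sum>m<N. \<Sum>n<N. if m = n then B n $ i $ j * jacobiP \<alpha> \<beta> n (cos (\<rho> x1 x2)) else 0)"
        by (simp add: X_product(1)[OF x])
      finally show ?thesis by simp
    qed
    ultimately show ?thesis by (simp add: sums_def)
  qed
  have "isotropic_field Pr M \<rho> Z"
    unfolding isotropic_field_def
  proof (intro conjI)
    show "\<forall>x\<in>M. Z x \<in> borel_measurable Pr \<and> integrable Pr (\<lambda>\<omega>. (norm (Z x \<omega>))\<^sup>2)" using meas int by blast
    show "\<exists>\<mu>. \<forall>x\<in>M. (LINT \<omega>|Pr. Z x \<omega>) = \<mu>" using mean by blast
    have "mcov Pr (Z x1) (Z x2) = (\<chi> i j. \<Sum>n. B n $ i $ j * jacobiP \<alpha> \<beta> n (cos (\<rho> x1 x2)))" if "x1 \<in> M" "x2 \<in> M" for x1 x2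
      using sums_unique[OF cov[OF that]] by (simp add: vec_eq_iff)
    thus "\<exists>C. \<forall>x1\<in>M. \<forall>x2\<in>M. mcov Pr (Z x1) (Z x2) = C (\<rho> x1 x2)"
      by (intro exI[of _ "\<lambda>r. \<chi> i j. \<Sum>n. B n $ i $ j * jacobiP \<alpha> \<beta> n (cos r)"]) blast
  qed
  thus ?thesis using meas int conv mean cov by blast
qed

end

theorem theorem1:
  fixes d :: nat and M :: "pt set" and \<rho> :: "pt \<Rightarrow> pt \<Rightarrow> real" and \<alpha> \<beta> :: real
    and Pr :: "'w measure" and V :: "nat \<Rightarrow> 'w \<Rightarrow> real^'m" and U :: "'w \<Rightarrow> pt"
    and B :: "nat \<Rightarrow> real^'m^'m"
  assumes "d \<ge> 2"
    and "tphs d M \<rho> \<alpha> \<beta>"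
    and "prob_space Pr"
    and "\<forall>n. V n \<in> borel_measurable Pr"
    and "prob_space.indep_vars Pr (\<lambda>_. borel) V UNIV"
    and "\<forall>n i. integrable Pr (\<lambda>\<omega>. (V n \<omega> $ i)\<^sup>2)"
    and "\<forall>n. (LINT \<omega>|Pr. V n \<omega>) = 0"
    and "\<forall>n. mcov Pr (V n) (V n) = (jacobi_a \<alpha> \<beta> n)\<^sup>2 *\<^sub>R mat 1"
    and "uniform_elem Pr M \<rho> U"
    and "indep_elems Pr (metric_sigma M \<rho>) U (PiM UNIV (\<lambda>_. borel)) (\<lambda>\<omega> n. V n \<omega>)"
    and "\<forall>n. sym_nnd (B n)"
    and "\<forall>i j. summable (\<lambda>n. B n $ i $ j * jacobiP \<alpha> \<beta> n 1)"
  shows "(\<exists>Z :: pt \<Rightarrow> 'w \<Rightarrow> real^'m.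
            (\<forall>x\<in>M. Z x \<in> borel_measurable Pr \<and> integrable Pr (\<lambda>\<omega>. (norm (Z x \<omega>))\<^sup>2)
                \<and> (\<lambda>N. LINT \<omega>|Pr. (norm (Z x \<omega> - (\<Sum>n<N. sterm \<alpha> \<beta> \<rho> B V U n x \<omega>)))\<^sup>2)
                     \<longlonglongrightarrow> 0)
          \<and> (\<forall>x\<in>M. (LINT \<omega>|Pr. Z x \<omega>) = 0)
          \<and> isotropic_field Pr M \<rho> Z
          \<and> (\<forall>x1\<in>M. \<forall>x2\<in>M. \<forall>i j.
               (\<lambda>n. B n $ i $ j * jacobiP \<alpha> \<beta> n (cos (\<rho> x1 x2))) sums (mcov Pr (Z x1) (Z x2) $ i $ j)))
       \<and> (\<forall>i j. i \<noteq> j \<longrightarrow> (\<forall>x1\<in>M. \<forall>x2\<in>M.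
            mcov Pr (sterm \<alpha> \<beta> \<rho> B V U i x1) (sterm \<alpha> \<beta> \<rho> B V U j x2) = 0))"
proof -
  interpret jacobi_series d M \<rho> \<alpha> \<beta> Pr V U B
    by (rule jacobi_series.intro) (use assms in \<open>blast+\<close>)
  show ?thesis by (intro conjI allI impI ballI field_exists sterm_uncorrelated)
qed

end
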